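(* Let $F$ be a field of characteristic $p$, let $K/F$ be a purely inseparable field extension of exponent one, and let $\delta$ be an algebraic derivation on $K$ with ${\rm Const}(\delta)=F$ and minimum polynomial $g(t)=t^{p^e}+c_1t^{p^{e-1}}+\dots+c_et\in F[t]$. Let $R=K[t;\delta]$ and $x=g(t)$, and let $N$ be the reduced norm of the central simple $F(x)$-algebra $K(t;\delta)$. Let $f\in R$. If $N(f)$ is irreducible in $F[x]$, then $f$ is irreducible in $R$.
   Context: ${\rm Const}(\delta)=\{a\in K:\delta(a)=0\}$. $K[t;\delta]$ is the ring of polynomials $\sum a_it^i$, $a_i\in K$, with $ta=at+\delta(a)$ for $a\in K$. Its center is $F[x]$, $x=g(t)$. The ring of central quotients $K(t;\delta)=\{f/q: f\in R,\ 0\neq q\in F[x]\}$ is a central simple algebra of degree $p^e$ over $F(x)$; $N$ is its reduced norm, and $N(f)\in F[x]$ for $f\in R$. An element $f\in R$ is irreducible if it is not a unit and is not a product $qr$ with $q,r\in R$ and $1\le\deg q,\deg r<\deg f$. *)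

theory Defs
  imports
    "HOL-Algebra.Embedded_Algebras"
    "HOL-Algebra.Ring_Divisibility"
    "HOL-Algebra.Finite_Extensions"
    "HOL-Algebra.Algebraic_Closure_Type"
    "HOL-Computational_Algebra.Fraction_Field"
    "Jordan_Normal_Form.Determinant"
begin

section \<open>Derivations\<close>

definition derivation :: "('k::field \<Rightarrow> 'k) \<Rightarrow> bool" where
  "derivation \<delta> \<longleftrightarrow>
     (\<forall>a b. \<delta> (a + b) = \<delta> a + \<delta> b) \<and> (\<forall>a b. \<delta> (a * b) = a * \<delta> b + \<delta> a * b)"

definition Const :: "('k::field \<Rightarrow> 'k) \<Rightarrow> 'k set" where
  "Const \<delta> = {a. \<delta> a = 0}"

definition polys_over :: "'k::field set \<Rightarrow> 'k poly set" where
  "polys_over F = {h. \<forall>i. Polynomial.coeff h i \<in> F}"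

definition poly_at_operator :: "'k::field poly \<Rightarrow> ('k \<Rightarrow> 'k) \<Rightarrow> 'k \<Rightarrow> 'k" where
  "poly_at_operator h \<delta> a = (\<Sum>i\<le>Polynomial.degree h. Polynomial.coeff h i * (\<delta> ^^ i) a)"

definition algebraic_over :: "'k::field set \<Rightarrow> ('k \<Rightarrow> 'k) \<Rightarrow> bool" where
  "algebraic_over F \<delta> \<longleftrightarrow> (\<exists>h\<in>polys_over F. h \<noteq> 0 \<and> (\<forall>a. poly_at_operator h \<delta> a = 0))"

definition minimum_polynomial :: "'k::field set \<Rightarrow> ('k \<Rightarrow> 'k) \<Rightarrow> 'k poly \<Rightarrow> bool" where
  "minimum_polynomial F \<delta> g \<longleftrightarrow>
     g \<in> polys_over F \<and> Polynomial.lead_coeff g = 1 \<and> (\<forall>a. poly_at_operator g \<delta> a = 0) \<and>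
     (\<forall>h\<in>polys_over F. h \<noteq> 0 \<and> (\<forall>a. poly_at_operator h \<delta> a = 0)
        \<longrightarrow> Polynomial.degree g \<le> Polynomial.degree h)"

text \<open>The extension is that of the ambient field, the whole type, over its subset \<open>F\<close>;
  the exponent is the least \<open>n\<close> such that all \<open>p ^ n\<close>-th powers lie in \<open>F\<close>.\<close>

definition purely_inseparable_of_exponent :: "nat \<Rightarrow> nat \<Rightarrow> 'k::field set \<Rightarrow> bool" where
  "purely_inseparable_of_exponent p n F \<longleftrightarrow>
     (\<forall>a. a ^ (p ^ n) \<in> F) \<and> (\<forall>m<n. \<exists>a. a ^ (p ^ m) \<notin> F)"


section \<open>The differential polynomial ring\<close>

text \<open>The polynomial with coefficients \<open>a\<^sub>i\<close> stands for the sum of the \<open>a\<^sub>i t\<^sup>i\<close>, coefficients on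
  the left. \<open>skew_shift \<delta>\<close> is left multiplication by \<open>t\<close>, since \<open>t (b t\<^sup>j) = b t\<^sup>j\<^sup>+\<^sup>1 + \<delta>(b) t\<^sup>j\<close>.\<close>

definition skew_shift :: "('k::field \<Rightarrow> 'k) \<Rightarrow> 'k poly \<Rightarrow> 'k poly" where
  "skew_shift \<delta> q = pCons 0 q + map_poly \<delta> q"

definition skew_mult :: "('k::field \<Rightarrow> 'k) \<Rightarrow> 'k poly \<Rightarrow> 'k poly \<Rightarrow> 'k poly" where
  "skew_mult \<delta> f q =
     (\<Sum>i\<le>Polynomial.degree f. Polynomial.smult (Polynomial.coeff f i) ((skew_shift \<delta> ^^ i) q))"

definition diff_poly_ring :: "('k::field \<Rightarrow> 'k) \<Rightarrow> 'k poly ring" where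
  "diff_poly_ring \<delta> = \<lparr>carrier = UNIV, monoid.mult = skew_mult \<delta>, one = 1, ring.zero = 0, add = (+)\<rparr>"

lemma diff_poly_ring_commutation:
  assumes "derivation \<delta>"
  shows "[:0, 1:] \<otimes>\<^bsub>diff_poly_ring \<delta>\<^esub> [:a:] = [:a:] \<otimes>\<^bsub>diff_poly_ring \<delta>\<^esub> [:0, 1:] \<oplus>\<^bsub>diff_poly_ring \<delta>\<^esub> [:\<delta> a:]"
proof -
  have "\<delta> 0 = 0"
    using assms unfolding derivation_def by (metis add_cancel_right_right)
  then show ?thesis
    by (simp add: diff_poly_ring_def skew_mult_def skew_shift_def map_poly_pCons)
qed

definition irreducible_diff_poly :: "('k::field \<Rightarrow> 'k) \<Rightarrow> 'k poly \<Rightarrow> bool" where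
  "irreducible_diff_poly \<delta> f \<longleftrightarrow>
     f \<notin> Units (diff_poly_ring \<delta>) \<and>
     \<not> (\<exists>q r. f = q \<otimes>\<^bsub>diff_poly_ring \<delta>\<^esub> r \<and>
          1 \<le> Polynomial.degree q \<and> Polynomial.degree q < Polynomial.degree f \<and>
          1 \<le> Polynomial.degree r \<and> Polynomial.degree r < Polynomial.degree f)"

text \<open>\<open>F[x]\<close> for \<open>x = g(t)\<close>, as a subset of \<open>K[t;\<delta>]\<close>.\<close>

definition center_polys :: "('k::field \<Rightarrow> 'k) \<Rightarrow> 'k set \<Rightarrow> 'k poly \<Rightarrow> 'k poly set" where
  "center_polys \<delta> F g = ring.simple_extension (diff_poly_ring \<delta>) ((\<lambda>a. [:a:]) ` F) g"


section \<open>Central quotients\<close>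

text \<open>Fractions \<open>a/s\<close> with numerator in \<open>R\<close> and denominator in a multiplicative set \<open>S\<close> of
  central elements that are not zero divisors.\<close>

definition fraction_rel :: "('a, 'm) ring_scheme \<Rightarrow> 'a set \<Rightarrow> (('a \<times> 'a) \<times> ('a \<times> 'a)) set" where
  "fraction_rel R S =
     {((a, s), (b, t)). a \<in> carrier R \<and> b \<in> carrier R \<and> s \<in> S \<and> t \<in> S \<and>
        a \<otimes>\<^bsub>R\<^esub> t = b \<otimes>\<^bsub>R\<^esub> s}"

definition fraction :: "('a, 'm) ring_scheme \<Rightarrow> 'a set \<Rightarrow> 'a \<Rightarrow> 'a \<Rightarrow> ('a \<times> 'a) set" where
  "fraction R S a s = fraction_rel R S `` {(a, s)}"

definition ring_of_fractions :: "('a, 'm) ring_scheme \<Rightarrow> 'a set \<Rightarrow> ('a \<times> 'a) set ring" where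
  "ring_of_fractions R S =
     \<lparr>carrier = (carrier R \<times> S) // fraction_rel R S,
      monoid.mult = (\<lambda>U V. \<Union>{fraction R S (a \<otimes>\<^bsub>R\<^esub> b) (s \<otimes>\<^bsub>R\<^esub> t) | a s b t. (a, s) \<in> U \<and> (b, t) \<in> V}),
      one = fraction R S \<one>\<^bsub>R\<^esub> \<one>\<^bsub>R\<^esub>,
      ring.zero = fraction R S \<zero>\<^bsub>R\<^esub> \<one>\<^bsub>R\<^esub>,
      add = (\<lambda>U V. \<Union>{fraction R S ((a \<otimes>\<^bsub>R\<^esub> t) \<oplus>\<^bsub>R\<^esub> (b \<otimes>\<^bsub>R\<^esub> s)) (s \<otimes>\<^bsub>R\<^esub> t) | a s b t.
                          (a, s) \<in> U \<and> (b, t) \<in> V})\<rparr>"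

text \<open>\<open>K(t;\<delta>)\<close>, the embedding of \<open>K[t;\<delta>]\<close> into it, and its subsets \<open>F[x]\<close> and \<open>F(x)\<close>.\<close>

definition diff_quotients ::
    "('k::field \<Rightarrow> 'k) \<Rightarrow> 'k set \<Rightarrow> 'k poly \<Rightarrow> ('k poly \<times> 'k poly) set ring" where
  "diff_quotients \<delta> F g = ring_of_fractions (diff_poly_ring \<delta>) (center_polys \<delta> F g - {0})"

definition diff_quot ::
    "('k::field \<Rightarrow> 'k) \<Rightarrow> 'k set \<Rightarrow> 'k poly \<Rightarrow> 'k poly \<Rightarrow> 'k poly \<Rightarrow> ('k poly \<times> 'k poly) set" where
  "diff_quot \<delta> F g f q = fraction (diff_poly_ring \<delta>) (center_polys \<delta> F g - {0}) f q"

definition embed_diff_poly ::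
    "('k::field \<Rightarrow> 'k) \<Rightarrow> 'k set \<Rightarrow> 'k poly \<Rightarrow> 'k poly \<Rightarrow> ('k poly \<times> 'k poly) set" where
  "embed_diff_poly \<delta> F g f = diff_quot \<delta> F g f 1"

definition center_poly_ring ::
    "('k::field \<Rightarrow> 'k) \<Rightarrow> 'k set \<Rightarrow> 'k poly \<Rightarrow> ('k poly \<times> 'k poly) set ring" where
  "center_poly_ring \<delta> F g =
     (diff_quotients \<delta> F g)\<lparr>carrier := embed_diff_poly \<delta> F g ` center_polys \<delta> F g\<rparr>"

definition center_field ::
    "('k::field \<Rightarrow> 'k) \<Rightarrow> 'k set \<Rightarrow> 'k poly \<Rightarrow> ('k poly \<times> 'k poly) set set" where
  "center_field \<delta> F g =
     {diff_quot \<delta> F g a q | a q. a \<in> center_polys \<delta> F g \<and> q \<in> center_polys \<delta> F g - {0}}"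


section \<open>Reduced norm of a central simple algebra\<close>

text \<open>\<open>A\<close> is a central simple algebra with center \<open>E\<close>. A homomorphism \<open>\<phi>\<close> from \<open>A\<close> to the
  \<open>n \<times> n\<close> matrices over \<open>L\<close> that maps \<open>E\<close> to scalar matrices makes \<open>L\<close> an extension field of
  \<open>E\<close> and induces an \<open>L\<close>-algebra homomorphism from \<open>A \<otimes>\<^sub>E L\<close> to these matrices. Since an
  \<open>E\<close>-basis of \<open>A\<close> is an \<open>L\<close>-basis of \<open>A \<otimes>\<^sub>E L\<close>, the last conjunct says that the induced map
  is bijective, that is, that \<open>\<phi>\<close> is a splitting of \<open>A\<close> over \<open>L\<close>.\<close>

definition splitting ::
    "('a, 'm) ring_scheme \<Rightarrow> 'a set \<Rightarrow> nat \<Rightarrow> ('a \<Rightarrow> 'l::field mat) \<Rightarrow> bool" where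
  "splitting A E n \<phi> \<longleftrightarrow>
     \<phi> \<in> Ring.ring_hom A (ring_mat TYPE('l) n ()) \<and>
     (\<forall>z\<in>E. \<exists>l. \<phi> z = l \<cdot>\<^sub>m 1\<^sub>m n) \<and>
     (\<exists>bs. ring.independent A E bs \<and> ring.Span A E bs = carrier A \<and>
        (\<forall>M\<in>carrier_mat n n. \<exists>!ls. length ls = length bs \<and>
           (\<forall>i<n. \<forall>j<n. M $$ (i, j) = (\<Sum>k<length bs. ls ! k * \<phi> (bs ! k) $$ (i, j)))))"

text \<open>The reduced norm of \<open>a\<close> is the element of \<open>E\<close> that is the determinant of the image of \<open>a\<close>
  under every splitting over \<open>L\<close>. It does not depend on \<open>L\<close>, provided that \<open>L\<close> is a splitting
  field of \<open>A\<close>; a type argument is needed because one cannot quantify over types.\<close>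

definition reduced_norm ::
    "'l::field itself \<Rightarrow> ('a, 'm) ring_scheme \<Rightarrow> 'a set \<Rightarrow> 'a \<Rightarrow> 'a" where
  "reduced_norm L A E a =
     (THE c. c \<in> E \<and>
        (\<forall>n (\<phi> :: 'a \<Rightarrow> 'l mat). splitting A E n \<phi> \<longrightarrow> \<phi> c = det (\<phi> a) \<cdot>\<^sub>m 1\<^sub>m n))"

text \<open>For \<open>K(t;\<delta>)\<close> the rational function field over \<open>K\<close>, isomorphic to the maximal subfield
  \<open>K(x)\<close>, is a splitting field.\<close>

definition diff_norm ::
    "('k::field \<Rightarrow> 'k) \<Rightarrow> 'k set \<Rightarrow> 'k poly \<Rightarrow> 'k poly \<Rightarrow> ('k poly \<times> 'k poly) set" where
  "diff_norm \<delta> F g f =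
     reduced_norm TYPE('k poly fract) (diff_quotients \<delta> F g) (center_field \<delta> F g)
       (embed_diff_poly \<delta> F g f)"

end

theory Submission
  imports Defs
begin

text \<open>The powers of \<open>t\<close> are a basis of \<open>R\<close> as a left module over \<open>K[x]\<close>, so right multiplication by
  \<open>f\<close> has a matrix \<open>P f\<close> over \<open>K[x]\<close>, multiplicative in \<open>f\<close>. Comparison with left multiplication by
  \<open>t\<close> shows that \<open>\<delta>\<close>, applied to the coefficients, maps \<open>P f\<close> to a commutator with \<open>P f\<close>, hence
  \<open>det (P f)\<close> to \<open>0\<close>, so that \<open>det (P f)\<close> lies in \<open>F[x]\<close>. If it is a unit there, then \<open>f\<close> has a left
  inverse and its degree is \<open>0\<close>. The theorem follows since \<open>det (P f)\<close> is the reduced norm: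
  by the nonvanishing of a Wronskian, \<open>P\<close> is a splitting over \<open>K(x)\<close>. For an arbitrary splitting
  \<open>\<phi>\<close>, apply the Frobenius map to the matrix entries. As \<open>k\<^sup>p \<in> F\<close> for \<open>k \<in> K\<close>, the resulting
  action of \<open>K\<close> on row vectors has a common eigenvector \<open>w\<close>. The vectors \<open>w t\<^sup>j\<close> form an invertible
  matrix that conjugates the image of \<open>f\<close> into that of \<open>P f\<close>, which gives
  \<open>det (\<phi> f)\<^sup>p = \<phi> (det (P f))\<^sup>p\<close>.\<close>

section \<open>The differential polynomial ring\<close>

hide_const (open) UnivPoly.monom UnivPoly.coeff
no_notation fps_nth (infixl "$" 75)

text \<open>The reduced norm is a definite description over all splittings by matrices over
  \<open>K(x)\<close>. So one splitting, \<open>rep\<close>, must be exhibited for uniqueness, and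
  for existence every splitting has to be controlled, also one whose embedding \<iota> of
  \<open>F(x)\<close> into \<open>K(x)\<close> has nothing to do with the inclusion. Under such an
  \<iota> an element \<open>k\<close> of \<open>K\<close> need not have an eigenvalue in the target
  field: it would be a \<open>p\<close>-th root of \<open>\<iota> (k ^ p)\<close>. The Frobenius map
  on matrix entries removes this obstacle, because the eigenvalue then sought is a
  \<open>p\<close>-th root of \<open>\<iota> (k ^ p) ^ p\<close>, namely
  \<open>\<iota> (k ^ p)\<close>. Nothing is lost, since Frobenius is injective on a field. In the
  representation by \<open>P\<close> the row vector belonging to \<open>t ^ 0\<close> is an
  eigenvector of \<open>K\<close>, and \<open>w\<close> plays its part in the twisted
  representation; so an explicit conjugation takes the place of the Skolem-Noether theorem.\<close>

locale derivation_field =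
  fixes \<delta> :: "'k::field \<Rightarrow> 'k"
  assumes derivation: "derivation \<delta>"
begin

abbreviation D :: "'k poly \<Rightarrow> 'k poly" where "D \<equiv> skew_shift \<delta>"
abbreviation \<Delta> :: "'k poly \<Rightarrow> 'k poly" where "\<Delta> \<equiv> map_poly \<delta>"
abbreviation skew_times :: "'k poly \<Rightarrow> 'k poly \<Rightarrow> 'k poly" (infixl "\<star>" 70) where
  "f \<star> q \<equiv> skew_mult \<delta> f q"
abbreviation R :: "'k poly ring" where "R \<equiv> diff_poly_ring \<delta>"
abbreviation var_t :: "'k poly" where "var_t \<equiv> [:0, 1:]"

lemma delta_add: "\<delta> (a + b) = \<delta> a + \<delta> b"
  and delta_mult: "\<delta> (a * b) = a * \<delta> b + \<delta> a * b"
  using derivation by (auto simp: derivation_def)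

lemma delta_0 [simp]: "\<delta> 0 = 0"
  by (metis add_cancel_right_right delta_add)

lemma delta_1 [simp]: "\<delta> 1 = 0"
  by (metis add_cancel_right_right delta_mult mult_1 mult_1_right)

lemma delta_minus: "\<delta> (- a) = - \<delta> a"
  using delta_add[of a "- a"] by (simp add: eq_neg_iff_add_eq_0 add.commute)

lemma delta_sum: "\<delta> (sum u A) = (\<Sum>i\<in>A. \<delta> (u i))"
  by (induction A rule: infinite_finite_induct) (auto simp: delta_add)

lemma coeff_Delta [simp]: "coeff (\<Delta> f) i = \<delta> (coeff f i)"
  by (simp add: coeff_map_poly)

lemma Delta_0 [simp]: "\<Delta> 0 = 0" by (simp add: poly_eq_iff)

lemma Delta_add: "\<Delta> (f + q) = \<Delta> f + \<Delta> q"
  by (simp add: poly_eq_iff delta_add)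

lemma Delta_minus: "\<Delta> (- f) = - \<Delta> f"
  by (simp add: poly_eq_iff delta_minus)

lemma Delta_sum: "\<Delta> (sum u A) = (\<Sum>i\<in>A. \<Delta> (u i))"
  by (induction A rule: infinite_finite_induct) (auto simp: Delta_add)

lemma Delta_pCons [simp]: "\<Delta> (pCons a f) = pCons (\<delta> a) (\<Delta> f)"
  by (simp add: map_poly_pCons)

lemma Delta_1 [simp]: "\<Delta> 1 = 0"
  by (simp add: one_pCons)

lemma Delta_smult: "\<Delta> (Polynomial.smult a f) = Polynomial.smult a (\<Delta> f) + Polynomial.smult (\<delta> a) f"
  by (simp add: poly_eq_iff delta_mult)

lemma Delta_mult: "\<Delta> (f * q) = f * \<Delta> q + \<Delta> f * q"
  by (induction f) (simp_all add: Delta_add Delta_smult algebra_simps)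

lemma Delta_power_eq_0: "\<Delta> f = 0 \<Longrightarrow> \<Delta> (f ^ m) = 0"
  by (induction m) (simp_all add: Delta_mult one_pCons)

lemma D_eq: "D f = var_t * f + \<Delta> f"
  by (simp add: skew_shift_def)

lemma D_0 [simp]: "D 0 = 0" by (simp add: D_eq)

lemma D_add: "D (f + q) = D f + D q"
  by (simp add: D_eq Delta_add algebra_simps)

lemma D_smult: "D (Polynomial.smult a f) = Polynomial.smult a (D f) + Polynomial.smult (\<delta> a) f"
  by (simp add: D_eq Delta_smult smult_add_right)

lemma skew_mult_0_left [simp]: "0 \<star> q = 0"
  by (simp add: skew_mult_def)

lemma skew_mult_eq_sum:
  assumes "Polynomial.degree f < m"
  shows "f \<star> q = (\<Sum>i<m. Polynomial.smult (coeff f i) ((D ^^ i) q))"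
  unfolding skew_mult_def
  by (rule sum.mono_neutral_left) (use assms in \<open>auto simp: coeff_eq_0\<close>)

lemma skew_mult_pCons: "pCons a f \<star> q = Polynomial.smult a q + f \<star> D q"
proof -
  let ?m = "Suc (Polynomial.degree f)"
  have "pCons a f \<star> q = (\<Sum>i<Suc ?m. Polynomial.smult (coeff (pCons a f) i) ((D ^^ i) q))"
    by (rule skew_mult_eq_sum) (simp add: le_imp_less_Suc degree_pCons_le)
  also have "\<dots> = Polynomial.smult a q + f \<star> D q"
    by (subst sum.lessThan_Suc_shift, subst skew_mult_eq_sum[of f ?m])
       (simp_all add: funpow_swap1)
  finally show ?thesis .
qed

lemma skew_mult_const [simp]: "[:a:] \<star> q = Polynomial.smult a q"
  by (simp add: skew_mult_pCons)

lemma skew_mult_1_left [simp]: "1 \<star> q = q"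
  by (simp add: one_pCons)

lemma skew_mult_var [simp]: "var_t \<star> q = D q"
  by (simp add: skew_mult_pCons)

lemma skew_mult_0_right [simp]: "f \<star> 0 = 0"
  by (induction f) (simp_all add: skew_mult_pCons)

lemma skew_mult_add_right: "f \<star> (q + r) = f \<star> q + f \<star> r"
  by (induction f arbitrary: q r) (simp_all add: skew_mult_pCons D_add smult_add_right)

lemma skew_mult_add_left: "(f + q) \<star> r = f \<star> r + q \<star> r"
proof -
  obtain m where "Polynomial.degree f < m" "Polynomial.degree q < m"
    using gt_ex[of "max (Polynomial.degree f) (Polynomial.degree q)"] by auto
  moreover from this have "Polynomial.degree (f + q) < m" by (rule degree_add_less)
  ultimately show ?thesis
    by (simp add: skew_mult_eq_sum smult_add_left sum.distrib)
qed

lemma skew_mult_smult_left: "Polynomial.smult a f \<star> q = Polynomial.smult a (f \<star> q)"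
  by (induction f arbitrary: q) (simp_all add: skew_mult_pCons smult_add_right)

lemma skew_mult_sum_left: "sum u A \<star> q = (\<Sum>i\<in>A. u i \<star> q)"
  by (induction A rule: infinite_finite_induct) (auto simp: skew_mult_add_left)

text \<open>Associativity for the left factor \<open>t\<close>. This is the only case with content,
  since \<open>skew_mult_pCons\<close> builds every left multiplication from scalars and
  \<open>D\<close>.\<close>

lemma skew_mult_D: "D f \<star> q = D (f \<star> q)"
proof (induction f arbitrary: q)
  case (pCons a f)
  have "D (pCons a f) = pCons 0 (pCons a f) + pCons (\<delta> a) (\<Delta> f)"
    by (simp add: skew_shift_def map_poly_pCons)
  also have "\<dots> \<star> q = Polynomial.smult a (D q) + f \<star> D (D q) + Polynomial.smult (\<delta> a) q + \<Delta> f \<star> D q"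
    by (simp only: skew_mult_add_left skew_mult_pCons) simp
  also have "f \<star> D (D q) = D f \<star> D q - \<Delta> f \<star> D q"
    by (simp add: D_eq[of f] skew_mult_add_left skew_mult_pCons)
  finally show ?case
    using pCons.IH by (simp add: skew_mult_pCons D_add D_smult)
qed simp

lemma skew_mult_assoc: "(f \<star> q) \<star> r = f \<star> (q \<star> r)"
  by (induction f arbitrary: q)
    (simp_all add: skew_mult_pCons skew_mult_add_left skew_mult_smult_left skew_mult_D)

text \<open>A polynomial whose coefficients are constants of \<delta> commutes with
  \<open>t\<close>, so moving \<open>t\<close> past it leaves no derivative behind. Both products
  live on the type \<open>'k poly\<close>, and skew computations are reduced to commutative ones
  wherever possible.\<close>

lemma skew_mult_eq_mult:
  assumes "\<Delta> q = 0"
  shows "f \<star> q = f * q"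
  using assms
proof (induction f arbitrary: q)
  case (pCons a f)
  have "\<Delta> (var_t * q) = 0" using pCons.prems by (simp add: Delta_mult)
  then have "f \<star> D q = f * (var_t * q)" using pCons by (simp add: D_eq)
  then show ?case by (simp add: skew_mult_pCons)
qed simp

lemma skew_mult_1_right [simp]: "f \<star> 1 = f"
  by (simp add: skew_mult_eq_mult one_pCons)

text \<open>\<Delta> does not raise the degree, so \<open>D\<close> raises it by exactly one, and
  degrees add as in the commutative ring.\<close>

lemma skew_mult_degree:
  assumes "f \<noteq> 0" "q \<noteq> 0"
  shows "f \<star> q \<noteq> 0 \<and> Polynomial.degree (f \<star> q) = Polynomial.degree f + Polynomial.degree q"
  using assms
proof (induction f arbitrary: q)
  case (pCons a f)
  have "Polynomial.degree (\<Delta> q) \<le> Polynomial.degree q" by (auto intro: degree_le simp: coeff_eq_0)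
  with pCons.prems have Dq: "Polynomial.degree (D q) = Suc (Polynomial.degree q)"
    unfolding skew_shift_def by (subst degree_add_eq_left) auto
  then have "D q \<noteq> 0" by auto
  show ?case
  proof (cases "f = 0")
    case True
    with pCons show ?thesis by auto
  next
    case False
    with pCons.IH \<open>D q \<noteq> 0\<close> Dq
    have *: "Polynomial.degree (f \<star> D q) = Suc (Polynomial.degree f + Polynomial.degree q)" by simp
    moreover have "Polynomial.degree (Polynomial.smult a q) \<le> Polynomial.degree q"
      by (rule degree_smult_le)
    ultimately have "Polynomial.degree (pCons a f \<star> q) = Suc (Polynomial.degree f + Polynomial.degree q)"
      unfolding skew_mult_pCons by (subst degree_add_eq_right) auto
    with False show ?thesis by auto
  qed
qed simp

lemma skew_mult_eq_0_iff: "f \<star> q = 0 \<longleftrightarrow> f = 0 \<or> q = 0"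
  using skew_mult_degree by auto

lemma diff_poly_ring_simps [simp]:
  "carrier R = UNIV" "f \<otimes>\<^bsub>R\<^esub> q = f \<star> q" "f \<oplus>\<^bsub>R\<^esub> q = f + q" "\<one>\<^bsub>R\<^esub> = 1" "\<zero>\<^bsub>R\<^esub> = 0"
  by (simp_all add: diff_poly_ring_def)

lemma ring_diff_poly_ring: "ring R"
proof (rule ringI)
  show "abelian_group R"
  proof (rule abelian_groupI)
    fix x :: "'k poly" assume "x \<in> carrier R"
    show "\<exists>y\<in>carrier R. y \<oplus>\<^bsub>R\<^esub> x = \<zero>\<^bsub>R\<^esub>"
      by (rule bexI[of _ "- x"]) auto
  qed (auto simp: algebra_simps)
  show "monoid R" by (rule monoidI) (auto simp: skew_mult_assoc)
qed (auto simp: skew_mult_add_left skew_mult_add_right)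

text \<open>Taking the constant coefficient is the projection of \<open>R\<close> onto
  \<open>R / R t\<close>, a left \<open>R\<close>-module that is \<open>K\<close> with
  \<open>t\<close> acting as \<delta>. Operator identities on \<open>K\<close> thus follow from
  computations in \<open>R\<close>.\<close>

lemma poly_at_operator_eq: "poly_at_operator h \<delta> (coeff f 0) = coeff (h \<star> f) 0"
proof -
  have "coeff ((D ^^ i) f) 0 = (\<delta> ^^ i) (coeff f 0)" for i
    by (induction i) (simp_all add: skew_shift_def)
  then show ?thesis by (simp add: poly_at_operator_def skew_mult_def coeff_sum)
qed

lemma poly_at_operator_const: "poly_at_operator h \<delta> a = coeff (h \<star> [:a:]) 0"
  using poly_at_operator_eq[of h "[:a:]"] by simp

lemma poly_at_operator_mult:
  "poly_at_operator (f \<star> q) \<delta> a = poly_at_operator f \<delta> (poly_at_operator q \<delta> a)"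
  by (metis poly_at_operator_const poly_at_operator_eq skew_mult_assoc)

lemma monom_skew_mult: "Polynomial.monom a k \<star> f = Polynomial.smult a ((D ^^ k) f)"
  by (induction k arbitrary: f) (simp_all add: monom_0 monom_Suc skew_mult_pCons funpow_swap1)

end

text \<open>The binomial theorem for commuting additive maps. Besides the characteristic
  \<open>p\<close> case it supplies the Leibniz rule \<open>D_pow_monom\<close>, with
  \<open>D\<close> split into multiplication by \<open>t\<close> and \<Delta>.\<close>

lemma additive_funpow_binomial:
  fixes M N U :: "'a::comm_ring_1 \<Rightarrow> 'a"
  assumes M: "\<And>x y. M (x + y) = M x + M y" and N: "\<And>x y. N (x + y) = N x + N y"
    and MN: "\<And>x. N (M x) = M (N x)" and U: "\<And>x. U x = M x + N x"
  shows "(U ^^ m) x = (\<Sum>i\<le>m. of_nat (m choose i) * (M ^^ i) ((N ^^ (m - i)) x))"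
proof (induction m)
  case (Suc m)
  define u where "u i j = (M ^^ i) ((N ^^ j) x)" for i j
  have nat: "V (of_nat k * y) = of_nat k * V y" if "\<And>x y. V (x + y) = V x + V y"
    for V :: "'a \<Rightarrow> 'a" and k y
  proof -
    have "V 0 = 0" using that[of 0 0] by simp
    then show ?thesis by (induction k) (simp_all add: that algebra_simps)
  qed
  have Uadd: "U (x + y) = U x + U y" for x y by (simp add: U M N)
  have Usum: "U (sum v A) = (\<Sum>i\<in>A. U (v i))" if "finite A" for v and A :: "nat set"
    using that Uadd[of 0 0] by (induction A rule: finite_induct) (simp_all add: Uadd)
  have comm: "N ((M ^^ i) y) = (M ^^ i) (N y)" for i y
    by (induction i) (simp_all add: MN)
  have Uu: "U (u i j) = u (Suc i) j + u i (Suc j)" for i j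
    by (simp add: U u_def comm)
  have "(U ^^ Suc m) x = (\<Sum>i\<le>m. of_nat (m choose i) * u (Suc i) (m - i)) +
      (\<Sum>i\<le>m. of_nat (m choose i) * u i (Suc m - i))"
    by (simp add: Suc.IH Usum nat[of U, OF Uadd] flip: u_def)
       (simp add: Uu sum.distrib distrib_left Suc_diff_le)
  also have "(\<Sum>i\<le>m. of_nat (m choose i) * u i (Suc m - i)) =
      (\<Sum>i\<le>Suc m. of_nat (m choose i) * u i (Suc m - i))"
    by (simp add: binomial_eq_0)
  also have "\<dots> = u 0 (Suc m) + (\<Sum>i\<le>m. of_nat (m choose Suc i) * u (Suc i) (m - i))"
    by (subst sum.atMost_Suc_shift) simp
  finally have "(U ^^ Suc m) x =
      u 0 (Suc m) + (\<Sum>i\<le>m. of_nat (Suc m choose Suc i) * u (Suc i) (m - i))"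
    by (simp add: sum.distrib algebra_simps)
  then show ?case
    by (subst sum.atMost_Suc_shift) (simp add: u_def)
qed simp

text \<open>The prime \<open>p\<close> divides the inner binomial coefficients, so taking
  \<open>p\<close>-th iterates is additive on commuting maps; the induction repeats this with the
  maps iterated \<open>p ^ k\<close> times.\<close>

lemma additive_funpow_CHAR:
  fixes M N U :: "'a::comm_ring_1 \<Rightarrow> 'a"
  assumes p: "Factorial_Ring.prime p" "CHAR('a) = p"
    and M: "\<And>x y. M (x + y) = M x + M y" and N: "\<And>x y. N (x + y) = N x + N y"
    and MN: "\<And>x. N (M x) = M (N x)" and U: "\<And>x. U x = M x + N x"
  shows "(U ^^ (p ^ k)) x = (M ^^ (p ^ k)) x + (N ^^ (p ^ k)) x"
proof -
  have add: "(V ^^ i) (x + y) = (V ^^ i) x + (V ^^ i) y" if "\<And>x y. V (x + y) = V x + V y"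
    for V :: "'a \<Rightarrow> 'a" and i x y
    by (induction i) (simp_all add: that)
  have comm: "(N ^^ j) ((M ^^ i) y) = (M ^^ i) ((N ^^ j) y)" for i j y
  proof (induction j)
    case (Suc j)
    have "N ((M ^^ i) y) = (M ^^ i) (N y)" for y
      by (induction i) (simp_all add: MN)
    with Suc show ?case by simp
  qed simp
  have "\<forall>x. (U ^^ (p ^ k)) x = (M ^^ (p ^ k)) x + (N ^^ (p ^ k)) x"
  proof (induction k)
    case (Suc k)
    let ?q = "p ^ k"
    have "p > 0" using p(1) prime_gt_0_nat by blast
    show ?case
    proof
      fix x
      have "(U ^^ (p ^ Suc k)) x = ((U ^^ ?q) ^^ p) x"
        by (simp add: funpow_mult mult.commute)
      also have "\<dots> = (\<Sum>i\<le>p. of_nat (p choose i) * ((M ^^ ?q) ^^ i) (((N ^^ ?q) ^^ (p - i)) x))"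
        by (rule additive_funpow_binomial) (use Suc add M N comm in auto)
      also have "\<dots> = (\<Sum>i\<in>{0,p}. of_nat (p choose i) * ((M ^^ ?q) ^^ i) (((N ^^ ?q) ^^ (p - i)) x))"
      proof (rule sum.mono_neutral_right)
        have "of_nat (p choose i) = (0 :: 'a)" if "0 < i" "i < p" for i
          using dvd_choose_prime[of i p] that p by (simp add: of_nat_eq_0_iff_char_dvd)
        then show "\<forall>i\<in>{..p} - {0, p}.
            of_nat (p choose i) * ((M ^^ ?q) ^^ i) (((N ^^ ?q) ^^ (p - i)) x) = 0"
          by (metis Diff_iff atMost_iff insertCI le_neq_implies_less mult_zero_left not_gr_zero)
      qed auto
      also have "\<dots> = ((M ^^ ?q) ^^ p) x + ((N ^^ ?q) ^^ p) x"
        using \<open>p > 0\<close> by (simp add: add.commute)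
      also have "\<dots> = (M ^^ (p ^ Suc k)) x + (N ^^ (p ^ Suc k)) x"
        by (simp add: funpow_mult mult.commute)
      finally show "(U ^^ (p ^ Suc k)) x = (M ^^ (p ^ Suc k)) x + (N ^^ (p ^ Suc k)) x" .
    qed
  qed (simp add: U)
  then show ?thesis by blast
qed

section \<open>The central element \<open>x = g(t)\<close>\<close>

locale algebraic_derivation = derivation_field \<delta> for \<delta> :: "'k::field \<Rightarrow> 'k" +
  fixes p e :: nat and F :: "'k set" and c :: "nat \<Rightarrow> 'k" and g :: "'k poly"
  assumes prime_p: "Factorial_Ring.prime p" and CHAR_p: "CHAR('k) = p"
    and Const_F: "Const \<delta> = F"
    and g_eq: "g = Polynomial.monom 1 (p ^ e) + (\<Sum>i=1..e. Polynomial.monom (c i) (p ^ (e - i)))"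
    and min_g: "minimum_polynomial F \<delta> g"
begin

abbreviation n :: nat where "n \<equiv> p ^ e"

lemma mem_F_iff: "a \<in> F \<longleftrightarrow> \<delta> a = 0"
  using Const_F by (auto simp: Const_def)

lemma polys_over_iff: "h \<in> polys_over F \<longleftrightarrow> \<Delta> h = 0"
  by (simp add: polys_over_def mem_F_iff poly_eq_iff)

lemma p_gt_1: "p > 1" and n_pos: "n > 0"
  using prime_p prime_gt_1_nat prime_gt_0_nat by auto

lemma degree_g: "Polynomial.degree g = n"
proof -
  have "Polynomial.degree (\<Sum>i=1..e. Polynomial.monom (c i) (p ^ (e - i))) < n"
  proof (rule degree_sum_less)
    fix i assume "i \<in> {1..e}"
    then have "p ^ (e - i) < n" using p_gt_1 by (intro power_strict_increasing) auto
    then show "Polynomial.degree (Polynomial.monom (c i) (p ^ (e - i))) < n"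
      using degree_monom_le le_less_trans by blast
  qed (rule n_pos)
  then show ?thesis
    unfolding g_eq by (subst degree_add_eq_left) (simp_all add: degree_monom_eq)
qed

lemma monic_g: "lead_coeff g = 1"
  using min_g by (simp add: minimum_polynomial_def)

lemma g_nonzero: "g \<noteq> 0"
  using monic_g by auto

lemma Delta_g: "\<Delta> g = 0"
  using min_g by (simp add: minimum_polynomial_def polys_over_iff)

text \<open>Only powers \<open>t ^ (p ^ k)\<close> occur in \<open>g\<close>. In characteristic
  \<open>p\<close> the iterate of \<open>D\<close> of that order is the sum of the iterates of its
  two commuting parts, so left multiplication by \<open>g(t)\<close> is commutative multiplication
  by \<open>g\<close> plus \<open>g(\<Delta>)\<close>. The latter, called \<open>V\<close> below,
  applies \<open>g(\<delta>) = 0\<close> to every coefficient.\<close>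

lemma g_skew_mult: "g \<star> f = g * f"
proof -
  have D_pow: "(D ^^ (p ^ k)) f = var_t ^ (p ^ k) * f + (\<Delta> ^^ (p ^ k)) f" for k
  proof -
    have "(D ^^ (p ^ k)) f = ((*) var_t ^^ (p ^ k)) f + (\<Delta> ^^ (p ^ k)) f"
      by (rule additive_funpow_CHAR)
         (auto simp: prime_p CHAR_p Delta_add Delta_mult D_eq algebra_simps)
    also have "((*) var_t ^^ m) f = var_t ^ m * f" for m
      by (induction m) (simp_all add: mult.assoc)
    finally show ?thesis .
  qed
  have coeff_pow: "coeff ((\<Delta> ^^ m) f) j = (\<delta> ^^ m) (coeff f j)" for m j
    by (induction m) simp_all
  have monom: "Polynomial.monom a (p ^ k) \<star> f = Polynomial.monom a (p ^ k) * f + Polynomial.smult a ((\<Delta> ^^ (p ^ k)) f)" for a k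
    by (subst monom_skew_mult) (simp add: D_pow smult_add_right monom_altdef)
  define V where "V = (\<Delta> ^^ n) f + (\<Sum>i=1..e. Polynomial.smult (c i) ((\<Delta> ^^ (p ^ (e - i))) f))"
  have "g \<star> f = g * f + V"
    unfolding g_eq V_def
    by (simp only: skew_mult_add_left skew_mult_sum_left monom sum.distrib distrib_right sum_distrib_right smult_1_left add_ac)
  moreover have "coeff V j = 0" for j
  proof -
    let ?a = "coeff f j"
    have "coeff ((D ^^ i) [:?a:]) 0 = (\<delta> ^^ i) ?a" for i
      by (induction i) (simp_all add: skew_shift_def)
    then have "coeff V j = coeff (g \<star> [:?a:]) 0"
      unfolding g_eq V_def
      by (simp add: skew_mult_add_left skew_mult_sum_left coeff_sum monom_skew_mult coeff_pow)
    also have "\<dots> = poly_at_operator g \<delta> ?a" by (simp add: poly_at_operator_const)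
    also have "\<dots> = 0" using min_g by (simp add: minimum_polynomial_def)
    finally show ?thesis .
  qed
  ultimately show ?thesis by (simp add: poly_eq_iff)
qed

text \<open>\<open>at_g\<close> is the embedding of \<open>K[x]\<close>, \<open>x = g(t)\<close>. Since \<open>F\<close> is the field of constants, \<open>F[x]\<close>
  consists of the \<open>h\<close> with \<open>\<Delta> h = 0\<close>.\<close>

abbreviation at_g :: "'k poly \<Rightarrow> 'k poly" where "at_g h \<equiv> pcompose h g"

text \<open>From the left, every element of \<open>K[x]\<close> multiplies commutatively; from the
  right, \<open>skew_mult_at_g\<close> asks for constant coefficients. This asymmetry is why
  coordinates over \<open>K[x]\<close> are taken on the left.\<close>

lemma at_g_skew_mult: "at_g h \<star> f = at_g h * f"
proof (induction h)
  case (pCons a h)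
  have "(g * at_g h) \<star> f = g * (at_g h \<star> f)"
    by (metis g_skew_mult skew_mult_assoc)
  with pCons show ?case by (simp add: pcompose_pCons skew_mult_add_left algebra_simps)
qed simp

lemma mult_at_g_skew_mult: "(at_g h * f) \<star> q = at_g h * (f \<star> q)"
  by (metis at_g_skew_mult skew_mult_assoc)

lemma Delta_at_g: "\<Delta> (at_g h) = at_g (\<Delta> h)"
  by (induction h) (simp_all add: pcompose_pCons Delta_add Delta_mult Delta_g)

lemma skew_mult_at_g: "\<Delta> h = 0 \<Longrightarrow> f \<star> at_g h = f * at_g h"
  by (simp add: skew_mult_eq_mult Delta_at_g)

lemma inj_at_g: "at_g h = 0 \<longleftrightarrow> h = 0"
  using pcompose_eq_0[of h g] degree_g n_pos by auto

end

section \<open>Determinants and Wronskians\<close>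

text \<open>The dual numbers. Determinants commute with ring homomorphisms but not with derivations;
  over this ring a derivation becomes part of a homomorphism.\<close>

datatype 'a dual = Dual (real_part: 'a) (eps_part: 'a)

instantiation dual :: (comm_ring_1) comm_ring_1
begin
definition "0 = Dual 0 0"
definition "1 = Dual 1 0"
definition "x + y = Dual (real_part x + real_part y) (eps_part x + eps_part y)"
definition "x - y = Dual (real_part x - real_part y) (eps_part x - eps_part y)"
definition "- x = Dual (- real_part x) (- eps_part x)"
definition "x * y = Dual (real_part x * real_part y) (real_part x * eps_part y + eps_part x * real_part y)"
instance
  by standard
     (simp_all add: zero_dual_def one_dual_def plus_dual_def minus_dual_def uminus_dual_def
       times_dual_def algebra_simps dual.expand)
end

definition dual_mat :: "nat \<Rightarrow> 'a mat \<Rightarrow> 'a mat \<Rightarrow> 'a dual mat" where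
  "dual_mat n M N = mat n n (\<lambda>ij. Dual (M $$ ij) (N $$ ij))"

lemma dual_mat_mult:
  assumes "M \<in> carrier_mat n n" "M' \<in> carrier_mat n n" "N \<in> carrier_mat n n" "N' \<in> carrier_mat n n"
  shows "dual_mat n M M' * dual_mat n N N' = dual_mat n (M * N) (M * N' + M' * N)"
proof -
  have sum: "(\<Sum>k\<in>A. Dual (u k) (v k)) = Dual (\<Sum>k\<in>A. u k) (\<Sum>k\<in>A. v k)" for u v :: "nat \<Rightarrow> 'a" and A
    by (induction A rule: infinite_finite_induct) (auto simp: zero_dual_def plus_dual_def)
  show ?thesis
    by (rule eq_matI) (use assms in \<open>auto simp: dual_mat_def scalar_prod_def times_dual_def sum sum.distrib\<close>)
qed

lemma dual_mat_carrier: "dual_mat n M N \<in> carrier_mat n n"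
  by (simp add: dual_mat_def)

text \<open>With \<open>\<epsilon>\<^sup>2 = 0\<close>, the hypothesis says that the ring homomorphism \<open>a \<mapsto> a + \<epsilon> d a\<close> maps \<open>P\<close> to
  \<open>(1 + \<epsilon> T) P (1 - \<epsilon> T)\<close>, which has the same determinant as \<open>P\<close>.\<close>

lemma derivation_det_eq_0:
  fixes d :: "'a::comm_ring_1 \<Rightarrow> 'a"
  assumes add: "\<And>a b. d (a + b) = d a + d b" and mult: "\<And>a b. d (a * b) = a * d b + d a * b"
    and P: "P \<in> carrier_mat n n" and T: "T \<in> carrier_mat n n"
    and comm: "map_mat d P = T * P - P * T"
  shows "d (det P) = 0"
proof -
  have d0: "d 0 = 0" using add[of 0 0] by simp
  have d1: "d 1 = 0" using mult[of 1 1] by simp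
  interpret h: comm_ring_hom "\<lambda>a. Dual a (d a)"
    by unfold_locales (simp_all add: zero_dual_def one_dual_def plus_dual_def times_dual_def add mult d0 d1)
  interpret i: comm_ring_hom "\<lambda>a::'a. Dual a 0"
    by unfold_locales (simp_all add: zero_dual_def one_dual_def plus_dual_def times_dual_def)
  note c = dual_mat_carrier mult_carrier_mat[of _ n n] add_carrier_mat[of _ n n] P T
  have one: "dual_mat n (1\<^sub>m n) (0\<^sub>m n n) = 1\<^sub>m n"
    by (rule eq_matI) (auto simp: dual_mat_def one_dual_def zero_dual_def)
  have hP: "map_mat (\<lambda>a. Dual a (d a)) P = dual_mat n P (T * P - P * T)"
    by (rule eq_matI) (use P T comm[symmetric] in \<open>auto simp: dual_mat_def\<close>)
  have iP: "map_mat (\<lambda>a. Dual a 0) P = dual_mat n P (0\<^sub>m n n)"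
    by (rule eq_matI) (use P in \<open>auto simp: dual_mat_def\<close>)
  have 1: "dual_mat n (1\<^sub>m n) T * dual_mat n P (0\<^sub>m n n) = dual_mat n P (T * P)"
    using P T by (subst dual_mat_mult) auto
  have TP: "P * (- T) + T * P = T * P - P * T"
    by (rule eq_matI) (use P T in \<open>auto simp: scalar_prod_def sum_negf\<close>)
  have 2: "dual_mat n P (T * P) * dual_mat n (1\<^sub>m n) (- T) = dual_mat n P (T * P - P * T)"
    using P T TP by (subst dual_mat_mult) auto
  have "- T + T = 0\<^sub>m n n" by (rule eq_matI) (use T in auto)
  then have 3: "dual_mat n (1\<^sub>m n) T * dual_mat n (1\<^sub>m n) (- T) = 1\<^sub>m n"
    using T one by (subst dual_mat_mult) auto
  let ?A = "det (dual_mat n (1\<^sub>m n) T)" and ?B = "det (dual_mat n (1\<^sub>m n) (- T))"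
  have "Dual (det P) (d (det P)) = det (dual_mat n P (T * P - P * T))"
    using h.hom_det[of P] by (simp add: hP)
  also have "\<dots> = ?A * det (dual_mat n P (0\<^sub>m n n)) * ?B"
    unfolding 2[symmetric] 1[symmetric]
    by (simp add: det_mult[of _ n] dual_mat_carrier mult_carrier_mat[of _ n n])
  also have "\<dots> = det (dual_mat n P (0\<^sub>m n n)) * (?A * ?B)" by (simp add: ac_simps)
  also have "?A * ?B = 1"
    using arg_cong[OF 3, of det] by (simp add: det_mult[of _ n] dual_mat_carrier)
  also have "det (dual_mat n P (0\<^sub>m n n)) = Dual (det P) 0"
    using i.hom_det[of P] by (simp add: iP)
  finally show ?thesis by simp
qed

text \<open>Padding with zero rows gives a square matrix of determinant \<open>0\<close>.\<close>

lemma ex_kernel_wide_mat: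
  fixes A :: "'a::field mat"
  assumes A: "A \<in> carrier_mat nr nc" and "nr < nc"
  obtains v where "v \<in> carrier_vec nc" "v \<noteq> 0\<^sub>v nc" "A *\<^sub>v v = 0\<^sub>v nr"
proof -
  define B where "B = mat nc nc (\<lambda>(i,j). if i < nr then A $$ (i,j) else 0)"
  have B: "B \<in> carrier_mat nc nc" by (simp add: B_def)
  have "det B = (\<Sum>j<nc. B $$ (nr,j) * cofactor B nr j)"
    by (rule laplace_expansion_row[OF B \<open>nr < nc\<close>])
  also have "\<dots> = 0" using \<open>nr < nc\<close> by (simp add: B_def)
  finally obtain v where v: "v \<in> carrier_vec nc" "v \<noteq> 0\<^sub>v nc" "B *\<^sub>v v = 0\<^sub>v nc"
    using det_0_iff_vec_prod_zero_field[OF B] by auto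
  have "A *\<^sub>v v = 0\<^sub>v nr"
  proof (rule eq_vecI)
    fix i assume "i < dim_vec (0\<^sub>v nr :: 'a vec)"
    then have i: "i < nr" by simp
    have "row B i = row A i"
      by (rule eq_vecI) (use i A \<open>nr < nc\<close> in \<open>auto simp: B_def\<close>)
    then show "(A *\<^sub>v v) $ i = 0\<^sub>v nr $ i"
      using arg_cong[OF v(3), of "\<lambda>w. vec_index w i"] i \<open>nr < nc\<close> A B by auto
  qed (use A in auto)
  with v that show ?thesis by blast
qed

lemma ex_solution:
  fixes A :: "'a::field mat"
  assumes A: "A \<in> carrier_mat n n" and "det A \<noteq> 0" and b: "b \<in> carrier_vec n"
  obtains v where "v \<in> carrier_vec n" "A *\<^sub>v v = b"
proof -
  obtain B where B: "B \<in> carrier_mat n n" "A * B = 1\<^sub>m n"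
    using det_non_zero_imp_unit[OF assms(1,2)] unfolding Units_def ring_mat_def by auto
  have "A *\<^sub>v (B *\<^sub>v b) = b"
    using A B b by (metis assoc_mult_mat_vec one_mult_mat_vec)
  with B b show ?thesis by (intro that[of "B *\<^sub>v b"]) auto
qed

text \<open>With the last point left variable, expansion along the last row is a linear combination
  of the \<open>u j\<close>. Its coefficient at \<open>u m\<close> is the nonzero determinant from
  the induction hypothesis, so by independence it does not vanish at every point.\<close>

lemma ex_evaluation_points:
  fixes u :: "nat \<Rightarrow> 'b \<Rightarrow> 'a::field"
  assumes "\<And>a. (\<And>x. (\<Sum>j<m. a j * u j x) = 0) \<Longrightarrow> \<forall>j<m. a j = 0"
  shows "\<exists>xs. det (mat m m (\<lambda>(i,j). u j (xs i))) \<noteq> 0"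
  using assms
proof (induction m)
  case (Suc m)
  have "\<forall>j<m. a j = 0" if "\<And>x. (\<Sum>j<m. a j * u j x) = 0" for a
  proof -
    let ?b = "\<lambda>j. if j < m then a j else 0"
    have "(\<Sum>j<Suc m. ?b j * u j x) = (\<Sum>j<m. a j * u j x)" for x by simp
    with that have "\<forall>j<Suc m. ?b j = 0" by (intro Suc.prems) simp
    then show ?thesis by (metis less_SucI)
  qed
  with Suc.IH obtain xs where xs: "det (mat m m (\<lambda>(i,j). u j (xs i))) \<noteq> 0" by blast
  define M where "M x = mat (Suc m) (Suc m) (\<lambda>(i,j). u j ((xs(m := x)) i))" for x
  \<comment> \<open>The cofactors of row \<open>m\<close> do not see that row, so any argument
    serves and \<open>undefined\<close> is as good as another.\<close>
  define a where "a j = cofactor (M undefined) m j" for j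
  have M: "M x \<in> carrier_mat (Suc m) (Suc m)" for x by (simp add: M_def)
  have del: "mat_delete (M x) m j = mat_delete (M undefined) m j" if "j < Suc m" for x j
    by (rule eq_matI) (auto simp: mat_delete_def M_def)
  have cof: "cofactor (M x) m j = a j" if "j < Suc m" for x j
    unfolding a_def cofactor_def del[OF that, of x] ..
  have row: "M x $$ (m, j) = u j x" if "j < Suc m" for x j
    using that by (simp add: M_def)
  have det: "det (M x) = (\<Sum>j<Suc m. a j * u j x)" for x
    unfolding laplace_expansion_row[OF M[of x] lessI] by (simp add: cof row mult.commute)
  have "mat_delete (M undefined) m m = mat m m (\<lambda>(i,j). u j (xs i))"
    by (rule eq_matI) (auto simp: mat_delete_def M_def)
  then have "a m \<noteq> 0" using xs by (simp add: a_def cofactor_def)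
  then obtain x where "(\<Sum>j<Suc m. a j * u j x) \<noteq> 0" using Suc.prems[of a] by blast
  then have "det (M x) \<noteq> 0" by (simp only: det not_False_eq_True)
  then show ?case unfolding M_def by (intro exI)
qed (simp add: det_def)

section \<open>Wronskians of \<delta>\<close>

context algebraic_derivation
begin

text \<open>The minimality of \<open>g\<close> concerns operators with coefficients in
  \<open>F\<close>; here it is extended to coefficients in \<open>K\<close>. The commutator of
  \<open>t\<close> with an annihilating monic \<open>q\<close> is \<open>\<Delta> q\<close>, which
  annihilates as well and has smaller degree. By induction it is zero, so \<open>q\<close> has
  coefficients in \<open>F\<close>.\<close>

lemma operator_independent:
  assumes "h \<noteq> 0" "Polynomial.degree h < n"
  shows "\<exists>a. poly_at_operator h \<delta> a \<noteq> 0"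
  using assms
proof (induction "Polynomial.degree h" arbitrary: h rule: less_induct)
  case less
  show ?case
  proof (rule ccontr)
    assume "\<not> ?thesis"
    then have h: "poly_at_operator h \<delta> a = 0" for a by simp
    define q where "q = Polynomial.smult (inverse (lead_coeff h)) h"
    have q: "poly_at_operator q \<delta> a = 0" for a
      using h[of a] by (simp add: poly_at_operator_const q_def skew_mult_smult_left)
    have q0: "q \<noteq> 0" and deg_q: "Polynomial.degree q = Polynomial.degree h" and lc: "lead_coeff q = 1"
      using less.prems by (auto simp: q_def)
    have "\<Delta> var_t = 0" by simp
    then have "\<Delta> q = var_t \<star> q - q \<star> var_t"
      by (simp only: skew_mult_eq_mult skew_mult_var D_eq) (simp add: algebra_simps)
    then have "var_t \<star> q = \<Delta> q + q \<star> var_t" by simp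
    then have eq: "poly_at_operator (var_t \<star> q) \<delta> a = poly_at_operator (\<Delta> q) \<delta> a + poly_at_operator (q \<star> var_t) \<delta> a" for a
      by (simp add: poly_at_operator_const skew_mult_add_left del: skew_mult_var)
    have Dq: "poly_at_operator (\<Delta> q) \<delta> a = 0" for a
    proof -
      have "poly_at_operator var_t \<delta> 0 = 0"
        by (simp add: poly_at_operator_const)
      then show ?thesis
        using eq[of a] by (simp add: poly_at_operator_mult q del: skew_mult_var)
    qed
    show False
    proof (cases "\<Delta> q = 0")
      case True
      then have "n \<le> Polynomial.degree q"
        using min_g q0 q degree_g by (auto simp: minimum_polynomial_def polys_over_iff)
      with less.prems deg_q show False by simp
    next
      case False
      have "Polynomial.degree (\<Delta> q) \<le> Polynomial.degree q" by (auto intro: degree_le simp: coeff_eq_0)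
      moreover have "coeff (\<Delta> q) (Polynomial.degree q) = 0" using lc by simp
      ultimately have "Polynomial.degree (\<Delta> q) < Polynomial.degree h"
        using False deg_q by (metis le_neq_implies_less leading_coeff_0_iff)
      with less.hyps[of "\<Delta> q"] less.prems False Dq show False by auto
    qed
  qed
qed

definition wronski :: "(nat \<Rightarrow> 'k) \<Rightarrow> 'k mat" where
  "wronski ks = mat n n (\<lambda>(i,j). (\<delta> ^^ j) (ks i))"

lemma ex_wronski: "\<exists>ks. det (wronski ks) \<noteq> 0"
  unfolding wronski_def
proof (rule ex_evaluation_points)
  fix a assume a: "\<And>x. (\<Sum>j<n. a j * (\<delta> ^^ j) x) = 0"
  define h where "h = (\<Sum>j<n. Polynomial.monom (a j) j)"
  have "poly_at_operator h \<delta> x = (\<Sum>j<n. a j * (\<delta> ^^ j) x)" for x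
  proof -
    have "coeff ((D ^^ i) [:x:]) 0 = (\<delta> ^^ i) x" for i
      by (induction i) (simp_all add: skew_shift_def)
    then show ?thesis
      by (simp add: poly_at_operator_const h_def skew_mult_sum_left coeff_sum monom_skew_mult)
  qed
  moreover have "Polynomial.degree h < n"
    unfolding h_def using n_pos
    by (intro degree_sum_less) (auto intro: le_less_trans[OF degree_monom_le])
  ultimately have "h = 0" using operator_independent[of h] a by auto
  moreover have "coeff h j = a j" if "j < n" for j
    using that by (simp add: h_def coeff_sum)
  ultimately show "\<forall>j<n. a j = 0" by auto
qed

text \<open>Chosen for their Wronskian, these elements also span \<open>K\<close> over
  \<open>F\<close> by \<open>ks_span\<close>.\<close>

definition ks :: "nat \<Rightarrow> 'k" where "ks = (SOME ks. det (wronski ks) \<noteq> 0)"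

lemma det_wronski: "det (wronski ks) \<noteq> 0"
  unfolding ks_def by (rule someI_ex[OF ex_wronski])

lemma delta_pow_n: "\<exists>b. (\<forall>j<n. \<delta> (b j) = 0) \<and> (\<forall>a. (\<delta> ^^ n) a = (\<Sum>j<n. b j * (\<delta> ^^ j) a))"
proof (intro exI conjI allI impI)
  fix j show "\<delta> (- coeff g j) = 0"
    using Delta_g by (metis coeff_0 coeff_Delta delta_minus neg_equal_0_iff_equal)
next
  fix a
  have "0 = poly_at_operator g \<delta> a" using min_g by (simp add: minimum_polynomial_def)
  also have "\<dots> = (\<Sum>j<Suc n. coeff g j * (\<delta> ^^ j) a)"
    by (simp add: poly_at_operator_def degree_g lessThan_Suc_atMost)
  also have "\<dots> = (\<Sum>j<n. coeff g j * (\<delta> ^^ j) a) + (\<delta> ^^ n) a"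
    using monic_g by (simp add: degree_g)
  finally have "(\<Sum>j<n. coeff g j * (\<delta> ^^ j) a) + (\<delta> ^^ n) a = 0" by simp
  then show "(\<delta> ^^ n) a = (\<Sum>j<n. - coeff g j * (\<delta> ^^ j) a)"
    by (simp add: sum_negf eq_neg_iff_add_eq_0 add.commute)
qed

text \<open>A ring homomorphism keeps the unit \<open>det (wronski ks)\<close> nonzero, so the
  Wronskian matrix stays nonsingular after transport to \<open>'l\<close>. This version concerns
  relations between its rows, \<open>ks_independent_hom'\<close> those between its columns.\<close>

lemma ks_independent_hom:
  fixes \<kappa> :: "'k \<Rightarrow> 'l::field"
  assumes "comm_ring_hom \<kappa>"
    and "\<And>j. j < n \<Longrightarrow> (\<Sum>i<n. u i * \<kappa> ((\<delta> ^^ j) (ks i))) = 0" and "i < n"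
  shows "u i = 0"
proof -
  interpret comm_ring_hom \<kappa> by fact
  let ?W = "map_mat \<kappa> (transpose_mat (wronski ks))" and ?v = "vec n u"
  have W: "?W \<in> carrier_mat n n" by (simp add: wronski_def)
  have "?W *\<^sub>v ?v = 0\<^sub>v n"
  proof (rule eq_vecI)
    fix j assume "j < dim_vec (0\<^sub>v n :: 'l vec)"
    then show "(?W *\<^sub>v ?v) $ j = 0\<^sub>v n $ j"
      using assms(2)[of j] by (simp add: wronski_def scalar_prod_def atLeast0LessThan mult.commute)
  qed (simp add: wronski_def)
  moreover have "det ?W \<noteq> 0"
  proof -
    define d where "d = det (wronski ks)"
    have "\<kappa> d * \<kappa> (inverse d) = 1"
      using det_wronski by (simp add: d_def flip: hom_mult)
    then have "\<kappa> d \<noteq> 0" by auto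
    then show ?thesis
      using det_transpose[of "wronski ks" n] by (simp add: d_def wronski_def)
  qed
  ultimately have "?v = 0\<^sub>v n"
    using det_0_iff_vec_prod_zero_field[OF W] vec_carrier[of n u] by blast
  then show ?thesis using assms(3) by (metis index_vec index_zero_vec(1))
qed

lemma ks_independent_hom':
  fixes \<kappa> :: "'k \<Rightarrow> 'l::field"
  assumes "comm_ring_hom \<kappa>"
    and "\<And>i. i < n \<Longrightarrow> (\<Sum>j<n. u j * \<kappa> ((\<delta> ^^ j) (ks i))) = 0" and "j < n"
  shows "u j = 0"
proof -
  interpret comm_ring_hom \<kappa> by fact
  let ?W = "map_mat \<kappa> (wronski ks)" and ?v = "vec n u"
  have W: "?W \<in> carrier_mat n n" by (simp add: wronski_def)
  have "?W *\<^sub>v ?v = 0\<^sub>v n"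
  proof (rule eq_vecI)
    fix i assume "i < dim_vec (0\<^sub>v n :: 'l vec)"
    then show "(?W *\<^sub>v ?v) $ i = 0\<^sub>v n $ i"
      using assms(2)[of i] by (simp add: wronski_def scalar_prod_def atLeast0LessThan mult.commute)
  qed (simp add: wronski_def)
  moreover have "det ?W \<noteq> 0"
  proof -
    have "\<kappa> (det (wronski ks)) * \<kappa> (inverse (det (wronski ks))) = 1"
      using det_wronski by (simp flip: hom_mult)
    then show ?thesis by auto
  qed
  ultimately have "?v = 0\<^sub>v n"
    using det_0_iff_vec_prod_zero_field[OF W] vec_carrier[of n u] by blast
  then show ?thesis using assms(3) by (metis index_vec index_zero_vec(1))
qed

text \<open>Since the Wronskian matrix is invertible, \<open>k\<close> and its first
  \<open>n - 1\<close> derivatives are the same combination of the \<open>ks i\<close> and their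
  derivatives, with coefficients \<open>v $ i\<close> in \<open>K\<close>. Differentiating these
  equations leaves a homogeneous Wronskian system for the \<open>\<delta> (v $ i)\<close>, which
  therefore vanish.\<close>

lemma ks_span: "\<exists>u. (\<forall>i<n. \<delta> (u i) = 0) \<and> k = (\<Sum>i<n. u i * ks i)"
proof -
  let ?W = "transpose_mat (wronski ks)"
  have W: "?W \<in> carrier_mat n n" by (simp add: wronski_def)
  have dW: "det ?W \<noteq> 0"
    using det_wronski det_transpose[of "wronski ks" n] by (simp add: wronski_def)
  define b where "b = vec n (\<lambda>j. (\<delta> ^^ j) k)"
  obtain v where v: "v \<in> carrier_vec n" and Wv: "?W *\<^sub>v v = b"
    using ex_solution[OF W dW, of b] by (auto simp: b_def)
  have eq: "(\<delta> ^^ j) k = (\<Sum>i<n. v $ i * (\<delta> ^^ j) (ks i))" if "j < n" for j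
    using arg_cong[OF Wv, of "\<lambda>w. vec_index w j"] that v
    by (simp add: b_def wronski_def scalar_prod_def atLeast0LessThan mult.commute)
  obtain c where c: "\<And>j. j < n \<Longrightarrow> \<delta> (c j) = 0" "\<And>a. (\<delta> ^^ n) a = (\<Sum>j<n. c j * (\<delta> ^^ j) a)"
    using delta_pow_n by blast
  \<comment> \<open>The equation of order \<open>n\<close> is needed too, since differentiating the
    one of order \<open>n - 1\<close> leads to it.\<close>
  have "(\<delta> ^^ n) k = (\<Sum>j<n. c j * (\<Sum>i<n. v $ i * (\<delta> ^^ j) (ks i)))"
    using eq by (simp add: c(2))
  also have "\<dots> = (\<Sum>i<n. v $ i * (\<delta> ^^ n) (ks i))"
    unfolding c(2) sum_distrib_left by (subst sum.swap) (simp add: mult_ac)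
  finally have eq': "(\<delta> ^^ j) k = (\<Sum>i<n. v $ i * (\<delta> ^^ j) (ks i))" if "j \<le> n" for j
    using eq that by (cases "j = n") auto
  have "\<delta> (v $ i) = 0" if "i < n" for i
  proof (rule ks_independent_hom[where \<kappa> = "\<lambda>a. a", OF _ _ that])
    show "comm_ring_hom (\<lambda>a::'k. a)" by unfold_locales simp_all
  next
    fix j assume "j < n"
    then have "(\<Sum>i<n. v $ i * (\<delta> ^^ Suc j) (ks i)) = \<delta> (\<Sum>i<n. v $ i * (\<delta> ^^ j) (ks i))"
      using eq'[of j] eq'[of "Suc j"] by simp
    also have "\<dots> = (\<Sum>i<n. v $ i * (\<delta> ^^ Suc j) (ks i)) + (\<Sum>i<n. \<delta> (v $ i) * (\<delta> ^^ j) (ks i))"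
      by (simp add: delta_sum delta_mult sum.distrib)
    finally show "(\<Sum>i<n. \<delta> (v $ i) * (\<delta> ^^ j) (ks i)) = 0" by simp
  qed
  moreover have "k = (\<Sum>i<n. v $ i * ks i)" using eq[of 0] n_pos by simp
  ultimately show ?thesis by blast
qed

end

section \<open>Coordinates over \<open>K[x]\<close> and the determinant of right
  multiplication\<close>

context algebraic_derivation
begin

abbreviation t_pow :: "nat \<Rightarrow> 'k poly" where "t_pow j \<equiv> Polynomial.monom 1 j"

text \<open>The expansion of \<open>f\<close> in base \<open>g\<close>, by ordinary division with
  remainder, collected by powers of \<open>t\<close>: the remainder supplies the constant
  coefficients of the coordinates and the quotient the higher ones.\<close>

lemma coords_exist: "\<exists>b. f = (\<Sum>j<n. at_g (b j) * t_pow j)"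
proof (induction "Polynomial.degree f" arbitrary: f rule: less_induct)
  case less
  define q r where "q = f div g" and "r = f mod g"
  have f: "f = r + g * q" by (simp add: q_def r_def)
  have deg_r: "Polynomial.degree r < n"
    using degree_mod_less'[of g f] degree_g n_pos g_nonzero by (cases "r = 0") (auto simp: r_def)
  have r: "r = (\<Sum>j<n. Polynomial.monom (coeff r j) j)"
    using deg_r by (auto simp: poly_eq_iff coeff_sum coeff_eq_0)
  obtain b where b: "q = (\<Sum>j<n. at_g (b j) * t_pow j)"
  proof (cases "q = 0")
    case True
    then show ?thesis by (intro that[of "\<lambda>_. 0"]) simp
  next
    case False
    then have "Polynomial.degree f = n + Polynomial.degree q"
      unfolding f using deg_r g_nonzero by (subst degree_add_eq_right) (auto simp: degree_mult_eq degree_g)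
    then show ?thesis using less[of q] that n_pos by auto
  qed
  have "f = (\<Sum>j<n. at_g (pCons (coeff r j) (b j)) * t_pow j)"
    by (subst f, subst r, subst b)
       (simp add: pcompose_pCons distrib_right sum.distrib sum_distrib_left mult.assoc smult_monom)
  then show ?case by (rule exI[of _ "\<lambda>j. pCons (coeff r j) (b j)"])
qed

text \<open>Modulo \<open>g\<close> only the constant coefficients of the \<open>b j\<close> remain.
  They form a polynomial of degree below \<open>n\<close>, hence vanish; then \<open>g\<close>
  cancels and \<open>poly_shift 1\<close> passes to the next coefficients.\<close>

lemma coords_unique_0:
  assumes "(\<Sum>j<n. at_g (b j) * t_pow j) = 0" "j < n"
  shows "b j = 0"
proof -
  have split: "\<forall>j<n. coeff (b j) 0 = 0" "(\<Sum>j<n. at_g (poly_shift 1 (b j)) * t_pow j) = 0"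
    if "(\<Sum>j<n. at_g (b j) * t_pow j) = 0" for b
  proof -
    define r where "r = (\<Sum>j<n. Polynomial.monom (coeff (b j) 0) j)"
    define q where "q = (\<Sum>j<n. at_g (poly_shift 1 (b j)) * t_pow j)"
    have "b j = pCons (coeff (b j) 0) (poly_shift 1 (b j))" for j
      by (simp add: poly_eq_iff coeff_pCons coeff_poly_shift split: nat.split)
    then have "at_g (b j) = [:coeff (b j) 0:] + g * at_g (poly_shift 1 (b j))" for j
      by (metis pcompose_pCons)
    then have "r + g * q = 0"
      using that unfolding r_def q_def
      by (simp add: distrib_right sum.distrib sum_distrib_left mult.assoc smult_monom)
    moreover have "Polynomial.degree r < n"
      unfolding r_def using n_pos
      by (intro degree_sum_less) (auto intro: le_less_trans[OF degree_monom_le])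
    ultimately have "q = 0"
      by (metis add_eq_0_iff degree_g degree_minus degree_mult_eq g_nonzero le_add1 linorder_not_less)
    with \<open>r + g * q = 0\<close> have "r = 0" by simp
    moreover have "coeff r j = coeff (b j) 0" if "j < n" for j
      using that by (simp add: r_def coeff_sum)
    ultimately show "\<forall>j<n. coeff (b j) 0 = 0" by auto
    show "(\<Sum>j<n. at_g (poly_shift 1 (b j)) * t_pow j) = 0" using \<open>q = 0\<close> by (simp add: q_def)
  qed
  have "\<forall>j<n. coeff (b j) m = 0" for m
    using assms(1)
  proof (induction m arbitrary: b)
    case (0 b)
    show ?case using split[OF 0] by simp
  next
    case (Suc m b)
    show ?case
    proof (intro allI impI)
      fix j assume "j < n"
      with Suc.IH[OF split(2)[OF Suc.prems]] have "coeff (poly_shift 1 (b j)) m = 0" by blast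
      then show "coeff (b j) (Suc m) = 0" by (simp add: coeff_poly_shift)
    qed
  qed
  with assms(2) show ?thesis by (auto simp: poly_eq_iff)
qed

definition coord :: "'k poly \<Rightarrow> nat \<Rightarrow> 'k poly" where
  "coord f = (SOME b. f = (\<Sum>j<n. at_g (b j) * t_pow j))"

lemma coord_eq: "f = (\<Sum>j<n. at_g (coord f j) * t_pow j)"
  unfolding coord_def by (rule someI_ex[OF coords_exist])

lemma coord_unique:
  assumes "f = (\<Sum>j<n. at_g (b j) * t_pow j)" "j < n"
  shows "coord f j = b j"
proof -
  have "(\<Sum>j<n. at_g (coord f j - b j) * t_pow j) = 0"
    using assms(1) coord_eq[of f] by (simp add: pcompose_diff left_diff_distrib sum_subtractf)
  from coords_unique_0[OF this assms(2)] show ?thesis by simp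
qed

lemma coord_inject: "(\<And>j. j < n \<Longrightarrow> coord f j = coord q j) \<Longrightarrow> f = q"
  by (subst coord_eq[of f], subst coord_eq[of q]) simp

lemma coord_at_g_sum: "j < n \<Longrightarrow> coord (\<Sum>j<n. at_g (b j) * t_pow j) j = b j"
  by (rule coord_unique) simp_all

lemma coord_at_g_mult: "j < n \<Longrightarrow> coord (at_g h * f) j = h * coord f j"
  by (rule coord_unique, subst coord_eq[of f])
     (simp_all add: sum_distrib_left mult.assoc pcompose_mult)

lemma coord_add: "j < n \<Longrightarrow> coord (f + q) j = coord f j + coord q j"
  by (rule coord_unique, subst coord_eq[of f], subst coord_eq[of q])
     (simp_all add: sum.distrib distrib_right pcompose_add)

lemma coord_0: "j < n \<Longrightarrow> coord 0 j = 0"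
  by (rule coord_unique) simp_all

lemma coord_sum: "j < n \<Longrightarrow> coord (sum u A) j = (\<Sum>i\<in>A. coord (u i) j)"
  by (induction A rule: infinite_finite_induct) (simp_all add: coord_0 coord_add)

lemma coord_t_pow: "i < n \<Longrightarrow> j < n \<Longrightarrow> coord (t_pow i) j = (if i = j then 1 else 0)"
proof (rule coord_unique)
  assume "i < n"
  have "(\<Sum>j<n. at_g (if i = j then 1 else 0) * t_pow j) = (\<Sum>j<n. if i = j then t_pow j else 0)"
    by (rule sum.cong) (auto simp: pcompose_1)
  then show "t_pow i = (\<Sum>j<n. at_g (if i = j then 1 else 0) * t_pow j)"
    using \<open>i < n\<close> by simp
qed

text \<open>The coefficients of \<open>g\<close> and of the powers of \<open>t\<close> are
  constants, so \<Delta> acts on the coordinates alone.\<close>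

lemma coord_Delta:
  assumes "j < n"
  shows "coord (\<Delta> f) j = \<Delta> (coord f j)"
proof -
  have "\<Delta> (t_pow j) = 0" for j by (simp add: poly_eq_iff)
  then have "\<Delta> f = (\<Sum>j<n. at_g (\<Delta> (coord f j)) * t_pow j)"
    by (subst coord_eq[of f]) (simp add: Delta_sum Delta_mult Delta_at_g)
  then show ?thesis using assms by (rule coord_unique)
qed

text \<open>Row \<open>i\<close> holds the coordinates of \<open>t ^ i f\<close>. As coordinates are
  row vectors, on which matrices act from the right, products keep their order in
  \<open>right_mat_mult\<close>.\<close>

definition right_mat :: "'k poly \<Rightarrow> 'k poly mat" where
  "right_mat f = mat n n (\<lambda>(i,j). coord (t_pow i \<star> f) j)"

lemma right_mat_carrier [simp]: "right_mat f \<in> carrier_mat n n"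
  by (simp add: right_mat_def)

lemma right_mat_dim [simp]: "dim_row (right_mat f) = n" "dim_col (right_mat f) = n"
  by (simp_all add: right_mat_def)

lemma coord_skew_mult:
  assumes "j < n"
  shows "coord (f \<star> q) j = (\<Sum>i<n. coord f i * right_mat q $$ (i,j))"
proof -
  have "f \<star> q = (\<Sum>i<n. at_g (coord f i) * (t_pow i \<star> q))"
    by (subst coord_eq[of f]) (simp add: skew_mult_sum_left mult_at_g_skew_mult)
  then show ?thesis
    using assms by (simp add: coord_sum coord_at_g_mult right_mat_def)
qed

lemma right_mat_mult: "right_mat (f \<star> q) = right_mat f * right_mat q"
proof (rule eq_matI)
  fix i j assume "i < dim_row (right_mat f * right_mat q)" "j < dim_col (right_mat f * right_mat q)"
  then have "i < n" "j < n" by simp_all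
  then have "right_mat (f \<star> q) $$ (i,j) = coord ((t_pow i \<star> f) \<star> q) j"
    by (simp add: right_mat_def skew_mult_assoc)
  also have "\<dots> = (\<Sum>k<n. right_mat f $$ (i,k) * right_mat q $$ (k,j))"
    unfolding coord_skew_mult[OF \<open>j < n\<close>] using \<open>i < n\<close> by (simp add: right_mat_def)
  finally show "right_mat (f \<star> q) $$ (i,j) = (right_mat f * right_mat q) $$ (i,j)"
    using \<open>i < n\<close> \<open>j < n\<close> by (simp add: scalar_prod_def atLeast0LessThan)
qed simp_all

lemma right_mat_add: "right_mat (f + q) = right_mat f + right_mat q"
  by (rule eq_matI) (simp_all add: right_mat_def skew_mult_add_right coord_add)

lemma right_mat_at_g:
  assumes "\<Delta> h = 0"
  shows "right_mat (at_g h) = h \<cdot>\<^sub>m 1\<^sub>m n"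
  by (rule eq_matI)
     (simp_all add: right_mat_def skew_mult_at_g[OF assms] mult.commute[of _ "at_g h"] coord_at_g_mult coord_t_pow)

lemma right_mat_1: "right_mat 1 = 1\<^sub>m n"
  by (rule eq_matI) (simp_all add: right_mat_def coord_t_pow)

lemma right_mat_inject: "right_mat f = right_mat q \<Longrightarrow> f = q"
proof (rule coord_inject)
  fix j assume *: "right_mat f = right_mat q" "j < n"
  have "coord f j = right_mat f $$ (0,j)" for f
    using *(2) n_pos by (simp add: right_mat_def)
  with *(1) show "coord f j = coord q j" by metis
qed

definition poly_norm :: "'k poly \<Rightarrow> 'k poly" where
  "poly_norm f = det (right_mat f)"

lemma poly_norm_mult: "poly_norm (f \<star> q) = poly_norm f * poly_norm q"
  by (simp add: poly_norm_def right_mat_mult det_mult[of _ n])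

lemma poly_norm_1: "poly_norm 1 = 1"
  by (simp add: poly_norm_def right_mat_1)

lemma Delta_poly_norm: "\<Delta> (poly_norm f) = 0"
  unfolding poly_norm_def
proof (rule derivation_det_eq_0[OF Delta_add Delta_mult])
  show "right_mat f \<in> carrier_mat n n" "right_mat var_t \<in> carrier_mat n n" by simp_all
  have Dt: "\<Delta> var_t = 0" by simp
  have "right_mat (var_t \<star> f) = right_mat (f \<star> var_t) + map_mat \<Delta> (right_mat f)"
  proof (rule eq_matI)
    fix i j
    assume "i < dim_row (right_mat (f \<star> var_t) + map_mat \<Delta> (right_mat f))"
      "j < dim_col (right_mat (f \<star> var_t) + map_mat \<Delta> (right_mat f))"
    then have ij: "i < n" "j < n" by simp_all
    have "t_pow i \<star> var_t = var_t \<star> t_pow i"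
      by (simp only: skew_mult_eq_mult[OF Dt] skew_mult_var) (simp add: D_eq poly_eq_iff mult.commute)
    \<comment> \<open>Left and right multiplication of \<open>t_pow i \<star> f\<close> by
      \<open>t\<close> differ by \<Delta>. Because \<open>t\<close> commutes with
      \<open>t_pow i\<close>, the left one equals \<open>t_pow i \<star> (var_t \<star> f)\<close>,
      which gives a row of a matrix product.\<close>
    then have "t_pow i \<star> (var_t \<star> f) = D (t_pow i \<star> f)"
      by (metis skew_mult_assoc skew_mult_var)
    also have "\<dots> = t_pow i \<star> (f \<star> var_t) + \<Delta> (t_pow i \<star> f)"
      unfolding skew_mult_assoc[symmetric] unfolding skew_mult_eq_mult[OF Dt] D_eq by (simp add: mult.commute)
    finally show "right_mat (var_t \<star> f) $$ (i,j) =
        (right_mat (f \<star> var_t) + map_mat \<Delta> (right_mat f)) $$ (i,j)"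
      using ij by (simp add: right_mat_def coord_add coord_Delta del: skew_mult_var)
  qed simp_all
  then have "right_mat var_t * right_mat f = right_mat f * right_mat var_t + map_mat \<Delta> (right_mat f)"
    by (simp only: right_mat_mult)
  then show "map_mat \<Delta> (right_mat f) = right_mat var_t * right_mat f - right_mat f * right_mat var_t"
    by (simp add: mat_eq_iff)
qed

lemma degree_0_of_poly_norm_unit:
  assumes "poly_norm f * u = 1"
  shows "Polynomial.degree f = 0"
proof -
  let ?P = "right_mat f" and ?Q = "adj_mat (right_mat f)"
  \<comment> \<open>Row \<open>0\<close> of the inverse of \<open>?P\<close>, read as coordinates.
    Times \<open>?P\<close> it gives row \<open>0\<close> of the identity, the coordinates of
    \<open>t_pow 0\<close>, that is, of \<open>1\<close>.\<close>
  define q where "q = (\<Sum>j<n. at_g (u * ?Q $$ (0,j)) * t_pow j)"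
  have Q: "?Q \<in> carrier_mat n n" "?Q * ?P = det ?P \<cdot>\<^sub>m 1\<^sub>m n"
    using adj_mat[of ?P n] by simp_all
  have "q \<star> f = 1"
  proof (rule coord_inject)
    fix j assume j: "j < n"
    have "coord (q \<star> f) j = (\<Sum>i<n. u * ?Q $$ (0,i) * ?P $$ (i,j))"
      using j by (simp add: coord_skew_mult q_def coord_at_g_sum)
    also have "\<dots> = u * (?Q * ?P) $$ (0,j)"
      using Q(1) j n_pos by (simp add: scalar_prod_def atLeast0LessThan sum_distrib_left mult.assoc)
    also have "\<dots> = coord (t_pow 0) j"
      unfolding Q(2) using j n_pos assms coord_t_pow[of 0 j]
      by (simp add: poly_norm_def mult.commute)
    finally show "coord (q \<star> f) j = coord 1 j" by simp
  qed
  then show ?thesis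
    using skew_mult_degree[of q f] by fastforce
qed

end

section \<open>Central localization\<close>

text \<open>The operations of \<open>ring_of_fractions\<close> are unions over all representatives;
  such a union collapses once the value does not depend on them.\<close>

lemma Union_const_image_pairs:
  assumes "\<And>a s b t. (a, s) \<in> U \<Longrightarrow> (b, t) \<in> V \<Longrightarrow> h a s b t = W"
    and "(a, s) \<in> U" "(b, t) \<in> V"
  shows "\<Union>{h a s b t | a s b t. (a, s) \<in> U \<and> (b, t) \<in> V} = W"
proof -
  have "{h a s b t | a s b t. (a, s) \<in> U \<and> (b, t) \<in> V} = {W}"
  proof (intro equalityI subsetI)
    fix x assume "x \<in> {h a s b t | a s b t. (a, s) \<in> U \<and> (b, t) \<in> V}"
    then show "x \<in> {W}" using assms(1) by blast
  next
    fix x assume "x \<in> {W}"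
    then have "x = h a s b t" using assms by simp
    then show "x \<in> {h a s b t | a s b t. (a, s) \<in> U \<and> (b, t) \<in> V}" using assms(2,3) by blast
  qed
  then show ?thesis by simp
qed

locale central_localization = ring R for R (structure) +
  fixes S
  assumes S_sub: "S \<subseteq> carrier R" and one_S: "\<one> \<in> S"
    and mult_S: "\<And>s t. s \<in> S \<Longrightarrow> t \<in> S \<Longrightarrow> s \<otimes> t \<in> S"
    and central: "\<And>s a. s \<in> S \<Longrightarrow> a \<in> carrier R \<Longrightarrow> s \<otimes> a = a \<otimes> s"
    and regular: "\<And>s a. s \<in> S \<Longrightarrow> a \<in> carrier R \<Longrightarrow> a \<otimes> s = \<zero> \<Longrightarrow> a = \<zero>"
begin

abbreviation Q where "Q \<equiv> ring_of_fractions R S"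
abbreviation frac where "frac \<equiv> fraction R S"

lemma S_carrier [simp]: "s \<in> S \<Longrightarrow> s \<in> carrier R"
  using S_sub by blast

lemma cancel_S:
  assumes "s \<in> S" "a \<in> carrier R" "b \<in> carrier R" "a \<otimes> s = b \<otimes> s"
  shows "a = b"
proof -
  have "(a \<ominus> b) \<otimes> s = \<zero>"
    using assms by (simp add: minus_eq l_distr l_minus r_neg)
  then have "a \<ominus> b = \<zero>" by (rule regular[OF assms(1) minus_closed[OF assms(2,3)]])
  then show ?thesis using r_right_minus_eq[OF assms(2,3)] by blast
qed

lemma mult_swap:
  assumes "s \<in> S" "a \<in> carrier R" "b \<in> carrier R"
  shows "(a \<otimes> s) \<otimes> b = (a \<otimes> b) \<otimes> s"
  using assms by (simp add: m_assoc central)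

lemma mult_interchange:
  assumes "s \<in> S" "t \<in> S" "a \<in> carrier R" "b \<in> carrier R"
  shows "(a \<otimes> s) \<otimes> (b \<otimes> t) = (a \<otimes> b) \<otimes> (s \<otimes> t)"
proof -
  have "(a \<otimes> s) \<otimes> (b \<otimes> t) = ((a \<otimes> s) \<otimes> b) \<otimes> t" using assms by (simp add: m_assoc)
  then show ?thesis using assms by (simp add: mult_swap) (simp add: m_assoc)
qed

lemma fraction_rel_iff:
  "((a, s), (b, t)) \<in> fraction_rel R S \<longleftrightarrow>
     a \<in> carrier R \<and> b \<in> carrier R \<and> s \<in> S \<and> t \<in> S \<and> a \<otimes> t = b \<otimes> s"
  by (simp add: fraction_rel_def)

lemma equiv_fraction_rel: "equiv (carrier R \<times> S) (fraction_rel R S)"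
proof (rule equivI)
  show "fraction_rel R S \<subseteq> (carrier R \<times> S) \<times> carrier R \<times> S"
    by (auto simp: fraction_rel_def)
  show "refl_on (carrier R \<times> S) (fraction_rel R S)"
    by (auto simp: refl_on_def fraction_rel_iff)
  show "sym (fraction_rel R S)"
    by (auto simp: sym_def fraction_rel_iff)
  show "trans (fraction_rel R S)"
  proof (rule transI, clarify)
    fix a s b t c u
    assume "((a, s), (b, t)) \<in> fraction_rel R S" "((b, t), (c, u)) \<in> fraction_rel R S"
    then have *: "a \<in> carrier R" "b \<in> carrier R" "c \<in> carrier R" "s \<in> S" "t \<in> S" "u \<in> S"
      "a \<otimes> t = b \<otimes> s" "b \<otimes> u = c \<otimes> t"
      by (auto simp: fraction_rel_iff)
    have "(a \<otimes> u) \<otimes> t = (b \<otimes> s) \<otimes> u" using * mult_swap[of t a u] by simp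
    also have "\<dots> = (c \<otimes> s) \<otimes> t" using * mult_swap[of s b u] mult_swap[of t c s] by simp
    \<comment> \<open>Transitivity rests on cancelling the middle denominator, hence on
      \<open>regular\<close>.\<close>
    finally have "a \<otimes> u = c \<otimes> s" by (rule cancel_S[of t, rotated 3]) (use * in auto)
    with * show "((a, s), (c, u)) \<in> fraction_rel R S" by (simp add: fraction_rel_iff)
  qed
qed

lemma mem_frac_iff:
  "(b, t) \<in> frac a s \<longleftrightarrow> a \<in> carrier R \<and> b \<in> carrier R \<and> s \<in> S \<and> t \<in> S \<and> a \<otimes> t = b \<otimes> s"
  by (simp add: fraction_def fraction_rel_iff)

lemma frac_eq_iff:
  assumes "a \<in> carrier R" "b \<in> carrier R" "s \<in> S" "t \<in> S"
  shows "frac a s = frac b t \<longleftrightarrow> a \<otimes> t = b \<otimes> s"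
  unfolding fraction_def using assms
  by (subst eq_equiv_class_iff[OF equiv_fraction_rel]) (auto simp: fraction_rel_iff)

lemma carrier_Q: "carrier Q = {frac a s | a s. a \<in> carrier R \<and> s \<in> S}"
  by (auto simp: ring_of_fractions_def quotient_def fraction_def)

lemma frac_in_carrier [simp]: "a \<in> carrier R \<Longrightarrow> s \<in> S \<Longrightarrow> frac a s \<in> carrier Q"
  by (auto simp: carrier_Q)

lemma one_Q: "\<one>\<^bsub>Q\<^esub> = frac \<one> \<one>" and zero_Q: "\<zero>\<^bsub>Q\<^esub> = frac \<zero> \<one>"
  by (simp_all add: ring_of_fractions_def)

lemma mult_Q:
  assumes "a \<in> carrier R" "b \<in> carrier R" "s \<in> S" "t \<in> S"
  shows "frac a s \<otimes>\<^bsub>Q\<^esub> frac b t = frac (a \<otimes> b) (s \<otimes> t)"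
proof -
  have "frac (a' \<otimes> b') (s' \<otimes> t') = frac (a \<otimes> b) (s \<otimes> t)"
    if "(a', s') \<in> frac a s" "(b', t') \<in> frac b t" for a' s' b' t'
  proof -
    have *: "a' \<in> carrier R" "b' \<in> carrier R" "s' \<in> S" "t' \<in> S" "a \<otimes> s' = a' \<otimes> s" "b \<otimes> t' = b' \<otimes> t"
      using that by (auto simp: mem_frac_iff)
    have "(a' \<otimes> b') \<otimes> (s \<otimes> t) = (a \<otimes> b) \<otimes> (s' \<otimes> t')"
      using * assms mult_interchange[of s t a' b'] mult_interchange[of s' t' a b] by simp
    then show ?thesis using * assms by (subst frac_eq_iff) (auto intro: mult_S)
  qed
  then show ?thesis
    unfolding ring_of_fractions_def monoid.simps
    by (rule Union_const_image_pairs[of _ _ _ _ a s b t]) (use assms in \<open>auto simp: mem_frac_iff\<close>)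
qed

lemma add_Q_general:
  assumes "a \<in> carrier R" "b \<in> carrier R" "s \<in> S" "t \<in> S"
  shows "frac a s \<oplus>\<^bsub>Q\<^esub> frac b t = frac ((a \<otimes> t) \<oplus> (b \<otimes> s)) (s \<otimes> t)"
proof -
  have "frac ((a' \<otimes> t') \<oplus> (b' \<otimes> s')) (s' \<otimes> t') = frac ((a \<otimes> t) \<oplus> (b \<otimes> s)) (s \<otimes> t)"
    if "(a', s') \<in> frac a s" "(b', t') \<in> frac b t" for a' s' b' t'
  proof -
    have *: "a' \<in> carrier R" "b' \<in> carrier R" "s' \<in> S" "t' \<in> S" "a \<otimes> s' = a' \<otimes> s" "b \<otimes> t' = b' \<otimes> t"
      using that by (auto simp: mem_frac_iff)
    have "(a' \<otimes> t') \<otimes> (s \<otimes> t) = (a \<otimes> t) \<otimes> (s' \<otimes> t')"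
      using * assms mult_interchange[of t' t a' s] mult_interchange[of s' t' a t] central[of t t'] by simp
    moreover have "(b' \<otimes> s') \<otimes> (s \<otimes> t) = (b \<otimes> s) \<otimes> (s' \<otimes> t')"
      using * assms mult_interchange[of s' s b' t] mult_interchange[of t' s' b s]
        central[of s t] central[of s s'] central[of t' s'] by simp
    ultimately have "((a' \<otimes> t') \<oplus> (b' \<otimes> s')) \<otimes> (s \<otimes> t) = ((a \<otimes> t) \<oplus> (b \<otimes> s)) \<otimes> (s' \<otimes> t')"
      using * assms by (simp add: l_distr mult_S)
    then show ?thesis using * assms by (subst frac_eq_iff) (auto intro: mult_S)
  qed
  then show ?thesis
    unfolding ring_of_fractions_def ring.simps
    by (rule Union_const_image_pairs[of _ _ _ _ a s b t]) (use assms in \<open>auto simp: mem_frac_iff\<close>)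
qed

text \<open>Elements brought to a common denominator are added in the numerators, which reduces the
  additive axioms for \<open>Q\<close> to those of \<open>R\<close>.\<close>

lemma add_Q:
  assumes "a \<in> carrier R" "b \<in> carrier R" "s \<in> S"
  shows "frac a s \<oplus>\<^bsub>Q\<^esub> frac b s = frac (a \<oplus> b) s"
proof -
  have "frac a s \<oplus>\<^bsub>Q\<^esub> frac b s = frac ((a \<oplus> b) \<otimes> s) (s \<otimes> s)"
    using assms by (simp add: add_Q_general l_distr)
  also have "\<dots> = frac (a \<oplus> b) s"
    using assms by (subst frac_eq_iff) (auto simp: m_assoc mult_S)
  finally show ?thesis .
qed

lemma frac_expand:
  assumes "a \<in> carrier R" "s \<in> S" "u \<in> S"
  shows "frac a s = frac (a \<otimes> u) (s \<otimes> u)"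
  using assms by (subst frac_eq_iff) (auto simp: m_assoc mult_S central[of s u])

lemma zero_Q_eq: "s \<in> S \<Longrightarrow> \<zero>\<^bsub>Q\<^esub> = frac \<zero> s"
  unfolding zero_Q by (subst frac_eq_iff) (auto simp: one_S)

lemma common_denominator2:
  assumes "x \<in> carrier Q" "y \<in> carrier Q"
  obtains a b s where "a \<in> carrier R" "b \<in> carrier R" "s \<in> S" "x = frac a s" "y = frac b s"
proof -
  obtain a s b t where *: "a \<in> carrier R" "b \<in> carrier R" "s \<in> S" "t \<in> S" "x = frac a s" "y = frac b t"
    using assms by (auto simp: carrier_Q)
  have "x = frac (a \<otimes> t) (s \<otimes> t)" using * frac_expand by blast
  moreover have "y = frac (b \<otimes> s) (s \<otimes> t)"
    using * frac_expand[of b t s] by (simp add: central)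
  ultimately show ?thesis using * by (intro that[of "a \<otimes> t" "b \<otimes> s" "s \<otimes> t"]) (auto intro: mult_S)
qed

lemma common_denominator3:
  assumes "x \<in> carrier Q" "y \<in> carrier Q" "z \<in> carrier Q"
  obtains a b c s where "a \<in> carrier R" "b \<in> carrier R" "c \<in> carrier R" "s \<in> S"
    "x = frac a s" "y = frac b s" "z = frac c s"
proof -
  obtain a b s where *: "a \<in> carrier R" "b \<in> carrier R" "s \<in> S" "x = frac a s" "y = frac b s"
    using common_denominator2[OF assms(1,2)] .
  obtain c t where **: "c \<in> carrier R" "t \<in> S" "z = frac c t"
    using assms(3) by (auto simp: carrier_Q)
  have "x = frac (a \<otimes> t) (s \<otimes> t)" "y = frac (b \<otimes> t) (s \<otimes> t)" using * ** frac_expand by blast+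
  moreover have "z = frac (c \<otimes> s) (s \<otimes> t)"
    using * ** frac_expand[of c t s] by (simp add: central)
  ultimately show ?thesis
    using * ** by (intro that[of "a \<otimes> t" "b \<otimes> t" "c \<otimes> s" "s \<otimes> t"]) (auto intro: mult_S)
qed

lemma ring_Q: "ring Q"
proof (rule ringI)
  show "abelian_group Q"
  proof (rule abelian_groupI)
    fix x y assume "x \<in> carrier Q" "y \<in> carrier Q"
    then obtain a b s where "a \<in> carrier R" "b \<in> carrier R" "s \<in> S" "x = frac a s" "y = frac b s"
      by (rule common_denominator2)
    then show "x \<oplus>\<^bsub>Q\<^esub> y \<in> carrier Q" "x \<oplus>\<^bsub>Q\<^esub> y = y \<oplus>\<^bsub>Q\<^esub> x"
      by (auto simp: add_Q a_comm)
  next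
    show "\<zero>\<^bsub>Q\<^esub> \<in> carrier Q" by (simp add: zero_Q one_S)
  next
    fix x y z assume "x \<in> carrier Q" "y \<in> carrier Q" "z \<in> carrier Q"
    then obtain a b c s where "a \<in> carrier R" "b \<in> carrier R" "c \<in> carrier R" "s \<in> S"
      "x = frac a s" "y = frac b s" "z = frac c s"
      by (rule common_denominator3)
    then show "(x \<oplus>\<^bsub>Q\<^esub> y) \<oplus>\<^bsub>Q\<^esub> z = x \<oplus>\<^bsub>Q\<^esub> (y \<oplus>\<^bsub>Q\<^esub> z)"
      by (simp add: add_Q a_assoc)
  next
    fix x assume "x \<in> carrier Q"
    then obtain a s where *: "a \<in> carrier R" "s \<in> S" "x = frac a s" by (auto simp: carrier_Q)
    then show "\<zero>\<^bsub>Q\<^esub> \<oplus>\<^bsub>Q\<^esub> x = x" by (simp add: zero_Q_eq[of s] add_Q)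
    show "\<exists>y\<in>carrier Q. y \<oplus>\<^bsub>Q\<^esub> x = \<zero>\<^bsub>Q\<^esub>"
      by (rule bexI[of _ "frac (\<ominus> a) s"]) (use * in \<open>auto simp: add_Q l_neg zero_Q_eq[of s]\<close>)
  qed
  show "monoid Q"
  proof (rule monoidI)
    fix x y assume "x \<in> carrier Q" "y \<in> carrier Q"
    then obtain a b s where "a \<in> carrier R" "b \<in> carrier R" "s \<in> S" "x = frac a s" "y = frac b s"
      by (rule common_denominator2)
    then show "x \<otimes>\<^bsub>Q\<^esub> y \<in> carrier Q" by (simp add: mult_Q mult_S)
  next
    show "\<one>\<^bsub>Q\<^esub> \<in> carrier Q" by (simp add: one_Q one_S)
  next
    fix x y z assume "x \<in> carrier Q" "y \<in> carrier Q" "z \<in> carrier Q"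
    then show "(x \<otimes>\<^bsub>Q\<^esub> y) \<otimes>\<^bsub>Q\<^esub> z = x \<otimes>\<^bsub>Q\<^esub> (y \<otimes>\<^bsub>Q\<^esub> z)"
      by (auto simp: carrier_Q mult_Q mult_S m_assoc)
  next
    fix x assume "x \<in> carrier Q"
    then show "\<one>\<^bsub>Q\<^esub> \<otimes>\<^bsub>Q\<^esub> x = x" "x \<otimes>\<^bsub>Q\<^esub> \<one>\<^bsub>Q\<^esub> = x"
      by (auto simp: carrier_Q one_Q mult_Q one_S)
  qed
  fix x y z assume "x \<in> carrier Q" "y \<in> carrier Q" "z \<in> carrier Q"
  then obtain a b c s where "a \<in> carrier R" "b \<in> carrier R" "c \<in> carrier R" "s \<in> S"
    "x = frac a s" "y = frac b s" "z = frac c s"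
    by (rule common_denominator3)
  then show "(x \<oplus>\<^bsub>Q\<^esub> y) \<otimes>\<^bsub>Q\<^esub> z = (x \<otimes>\<^bsub>Q\<^esub> z) \<oplus>\<^bsub>Q\<^esub> (y \<otimes>\<^bsub>Q\<^esub> z)"
    "z \<otimes>\<^bsub>Q\<^esub> (x \<oplus>\<^bsub>Q\<^esub> y) = (z \<otimes>\<^bsub>Q\<^esub> x) \<oplus>\<^bsub>Q\<^esub> (z \<otimes>\<^bsub>Q\<^esub> y)"
    by (simp_all add: add_Q mult_Q mult_S l_distr r_distr)
qed

end

section \<open>The ring of central quotients\<close>

context algebraic_derivation
begin

text \<open>\<open>simple_extension\<close> is generated by Horner steps: multiplication by
  \<open>g\<close> from the right and addition of a constant. They correspond to
  \<open>pCons\<close>, as the skew product with \<open>g\<close> on the right is the commutative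
  one.\<close>

lemma center_polys_eq: "center_polys \<delta> F g = at_g ` {h. \<Delta> h = 0}"
proof -
  note ext = ring.simple_extension.zero[OF ring_diff_poly_ring] ring.simple_extension.lin[OF ring_diff_poly_ring]
  let ?C = "ring.simple_extension R ((\<lambda>a. [:a:]) ` F) g"
  have "q \<in> at_g ` {h. \<Delta> h = 0}" if "q \<in> ?C" for q
    using that
  proof (induction rule: ring.simple_extension.induct[OF ring_diff_poly_ring, consumes 1])
    case 1
    show ?case by (auto intro!: image_eqI[of _ _ 0])
  next
    case (2 k1 k2)
    then obtain h a where "k1 = at_g h" "\<Delta> h = 0" "k2 = [:a:]" "\<delta> a = 0"
      by (auto simp: mem_F_iff)
    then show ?case
      by (intro image_eqI[of _ _ "pCons a h"])
         (simp_all add: pcompose_pCons skew_mult_eq_mult Delta_g add.commute mult.commute)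
  qed
  moreover have "at_g h \<in> ?C" if "\<Delta> h = 0" for h
    using that
  proof (induction h)
    case 0
    then show ?case using ext(1)[of "(\<lambda>a. [:a:]) ` F" g] by simp
  next
    case (pCons a h)
    then have "\<Delta> h = 0" "a \<in> F" by (simp_all add: mem_F_iff)
    with pCons.IH ext(2)[of "at_g h" "(\<lambda>a. [:a:]) ` F" g "[:a:]"] show ?case
      by (simp add: pcompose_pCons skew_mult_eq_mult Delta_g add.commute mult.commute)
  qed
  ultimately show ?thesis unfolding center_polys_def by blast
qed

sublocale loc: central_localization R "center_polys \<delta> F g - {0}"
proof (intro central_localization.intro central_localization_axioms.intro ring_diff_poly_ring)
  show "\<one>\<^bsub>R\<^esub> \<in> center_polys \<delta> F g - {0}"
    by (auto simp: center_polys_eq pcompose_1 one_pCons intro!: image_eqI[of _ _ 1])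
next
  fix s t assume "s \<in> center_polys \<delta> F g - {0}" "t \<in> center_polys \<delta> F g - {0}"
  then show "s \<otimes>\<^bsub>R\<^esub> t \<in> center_polys \<delta> F g - {0}"
    by (auto simp: center_polys_eq skew_mult_at_g pcompose_mult[symmetric] Delta_mult inj_at_g)
next
  fix s a assume "s \<in> center_polys \<delta> F g - {0}"
  then show "s \<otimes>\<^bsub>R\<^esub> a = a \<otimes>\<^bsub>R\<^esub> s"
    by (auto simp: center_polys_eq skew_mult_at_g at_g_skew_mult mult.commute)
next
  fix s a assume "s \<in> center_polys \<delta> F g - {0}" "a \<otimes>\<^bsub>R\<^esub> s = \<zero>\<^bsub>R\<^esub>"
  then show "a = \<zero>\<^bsub>R\<^esub>" by (simp add: skew_mult_eq_0_iff)
qed simp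

abbreviation Q :: "('k poly \<times> 'k poly) set ring" where "Q \<equiv> diff_quotients \<delta> F g"
abbreviation E :: "('k poly \<times> 'k poly) set set" where "E \<equiv> center_field \<delta> F g"

text \<open>Denominators are given by the polynomial \<open>h\<close> in \<open>x\<close> instead of
  the element \<open>h(g(t))\<close> of \<open>R\<close>, so that they are handled in a commutative
  ring.\<close>

definition quo :: "'k poly \<Rightarrow> 'k poly \<Rightarrow> ('k poly \<times> 'k poly) set" where
  "quo f h = diff_quot \<delta> F g f (at_g h)"

definition dens :: "'k poly set" where "dens = {h. \<Delta> h = 0 \<and> h \<noteq> 0}"

lemma dens_1 [simp]: "1 \<in> dens"
  by (simp add: dens_def)

lemma dens_mult: "h \<in> dens \<Longrightarrow> k \<in> dens \<Longrightarrow> h * k \<in> dens"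
  by (simp add: dens_def Delta_mult)

lemma at_g_dens: "h \<in> dens \<Longrightarrow> at_g h \<in> center_polys \<delta> F g - {0}"
  by (auto simp: dens_def center_polys_eq inj_at_g)

lemma skew_mult_dens: "h \<in> dens \<Longrightarrow> f \<star> at_g h = f * at_g h"
  by (simp add: dens_def skew_mult_at_g)

lemma quo_eq_iff:
  "h \<in> dens \<Longrightarrow> k \<in> dens \<Longrightarrow> quo f h = quo q k \<longleftrightarrow> f * at_g k = q * at_g h"
  unfolding quo_def diff_quot_def
  by (subst loc.frac_eq_iff) (auto simp: at_g_dens skew_mult_dens simp del: Diff_iff)

lemma carrier_quotients: "carrier Q = {quo f h | f h. h \<in> dens}"
proof -
  have "center_polys \<delta> F g - {0} = at_g ` dens"
    by (auto simp: center_polys_eq dens_def inj_at_g)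
  then show ?thesis
    unfolding diff_quotients_def loc.carrier_Q quo_def diff_quot_def by auto
qed

lemma quo_in_carrier [simp]: "h \<in> dens \<Longrightarrow> quo f h \<in> carrier Q"
  by (auto simp: carrier_quotients)

lemma quo_mult: "h \<in> dens \<Longrightarrow> k \<in> dens \<Longrightarrow> quo f h \<otimes>\<^bsub>Q\<^esub> quo q k = quo (f \<star> q) (h * k)"
  unfolding quo_def diff_quot_def diff_quotients_def
  by (subst loc.mult_Q) (auto simp: at_g_dens skew_mult_dens pcompose_mult simp del: Diff_iff)

lemma quo_add: "h \<in> dens \<Longrightarrow> quo f h \<oplus>\<^bsub>Q\<^esub> quo q h = quo (f + q) h"
  unfolding quo_def diff_quot_def diff_quotients_def
  by (subst loc.add_Q) (auto simp: at_g_dens simp del: Diff_iff)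

lemma quotients_common_denominator:
  assumes "x \<in> carrier Q" "y \<in> carrier Q"
  obtains f q h where "h \<in> dens" "x = quo f h" "y = quo q h"
proof -
  obtain f h q k where *: "h \<in> dens" "k \<in> dens" "x = quo f h" "y = quo q k"
    using assms by (auto simp: carrier_quotients)
  then have "x = quo (f * at_g k) (h * k)" "y = quo (q * at_g h) (h * k)"
    by (auto simp: quo_eq_iff dens_mult pcompose_mult)
  with * show ?thesis by (intro that[of "h * k"]) (auto intro: dens_mult)
qed

lemma one_quotients: "\<one>\<^bsub>Q\<^esub> = quo 1 1"
  by (simp add: diff_quotients_def loc.one_Q quo_def diff_quot_def pcompose_1)

lemma zero_quotients: "h \<in> dens \<Longrightarrow> \<zero>\<^bsub>Q\<^esub> = quo 0 h"
  using loc.zero_Q_eq[OF at_g_dens, of h] by (simp add: diff_quotients_def quo_def diff_quot_def)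

lemma ring_quotients: "ring Q"
  unfolding diff_quotients_def by (rule loc.ring_Q)

sublocale quotients: ring Q by (rule ring_quotients)

lemma embed_eq: "embed_diff_poly \<delta> F g f = quo f 1"
  by (simp add: embed_diff_poly_def quo_def pcompose_1)

lemma center_field_eq: "E = {quo (at_g a) h | a h. \<Delta> a = 0 \<and> h \<in> dens}"
proof -
  have "center_polys \<delta> F g - {0} = at_g ` dens"
    by (auto simp: center_polys_eq dens_def inj_at_g)
  then show ?thesis
    unfolding center_field_def quo_def by (auto simp: center_polys_eq)
qed

lemma quo_at_g_mult:
  "h \<in> dens \<Longrightarrow> k \<in> dens \<Longrightarrow> quo (at_g a) h \<otimes>\<^bsub>Q\<^esub> quo f k = quo (at_g a * f) (h * k)"
  by (simp add: quo_mult at_g_skew_mult)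

lemma quo_cancel: "h \<in> dens \<Longrightarrow> quo (at_g h) h = \<one>\<^bsub>Q\<^esub>"
  by (simp add: one_quotients quo_eq_iff pcompose_1)

lemma quo_minus: "h \<in> dens \<Longrightarrow> \<ominus>\<^bsub>Q\<^esub> (quo f h) = quo (- f) h"
  by (rule quotients.minus_equality) (simp_all add: quo_add zero_quotients[of h])

lemma center_common_denominator:
  assumes "x \<in> E" "y \<in> E"
  obtains a b h where "\<Delta> a = 0" "\<Delta> b = 0" "h \<in> dens" "x = quo (at_g a) h" "y = quo (at_g b) h"
proof -
  obtain a h b k where *: "\<Delta> a = 0" "\<Delta> b = 0" "h \<in> dens" "k \<in> dens" "x = quo (at_g a) h" "y = quo (at_g b) k"
    using assms by (auto simp: center_field_eq)
  have "x = quo (at_g (a * k)) (h * k)" "y = quo (at_g (b * h)) (h * k)"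
    using * by (auto simp: quo_eq_iff dens_mult pcompose_mult)
  moreover have "\<Delta> (a * k) = 0" "\<Delta> (b * h) = 0" using * by (auto simp: Delta_mult dens_def)
  ultimately show ?thesis using * dens_mult by (intro that[of "a * k" "b * h" "h * k"]) auto
qed

lemma subfield_center: "subfield E Q"
proof (rule quotients.subfieldI)
  have E_carrier: "E \<subseteq> carrier Q" by (auto simp: center_field_eq)
  have E_mem: "quo (at_g a) h \<in> E" if "\<Delta> a = 0" "h \<in> dens" for a h
    using that by (auto simp: center_field_eq)
  have one: "\<one>\<^bsub>Q\<^esub> \<in> E" using E_mem[of 1 1] by (simp add: one_quotients pcompose_1)
  have mult: "x \<otimes>\<^bsub>Q\<^esub> y \<in> E" "x \<otimes>\<^bsub>Q\<^esub> y = y \<otimes>\<^bsub>Q\<^esub> x" if xy: "x \<in> E" "y \<in> E" for x y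
  proof -
    obtain a b h where *: "\<Delta> a = 0" "\<Delta> b = 0" "h \<in> dens" "x = quo (at_g a) h" "y = quo (at_g b) h"
      using center_common_denominator[OF xy] .
    have "x \<otimes>\<^bsub>Q\<^esub> y = quo (at_g (a * b)) (h * h)" "y \<otimes>\<^bsub>Q\<^esub> x = quo (at_g (a * b)) (h * h)"
      using * by (simp_all add: quo_at_g_mult pcompose_mult mult.commute)
    with * show "x \<otimes>\<^bsub>Q\<^esub> y \<in> E" "x \<otimes>\<^bsub>Q\<^esub> y = y \<otimes>\<^bsub>Q\<^esub> x"
      by (auto intro!: E_mem dens_mult simp: Delta_mult)
  qed
  show "subcring E Q"
  proof (intro quotients.subcringI quotients.subringI E_carrier one mult)
    fix x assume "x \<in> E"
    then show "\<ominus>\<^bsub>Q\<^esub> x \<in> E"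
      by (auto simp: center_field_eq quo_minus pcompose_uminus[symmetric])
         (metis Delta_minus neg_equal_0_iff_equal)
  next
    fix x y assume "x \<in> E" "y \<in> E"
    then obtain a b h where "\<Delta> a = 0" "\<Delta> b = 0" "h \<in> dens" "x = quo (at_g a) h" "y = quo (at_g b) h"
      by (rule center_common_denominator)
    then show "x \<oplus>\<^bsub>Q\<^esub> y \<in> E"
      by (auto simp: quo_add pcompose_add[symmetric] Delta_add intro!: E_mem)
  qed
  show "Units (Q\<lparr>carrier := E\<rparr>) = E - {\<zero>\<^bsub>Q\<^esub>}"
  proof (intro equalityI subsetI)
    fix x assume "x \<in> Units (Q\<lparr>carrier := E\<rparr>)"
    then obtain y where "x \<in> E" "y \<in> E" "x \<otimes>\<^bsub>Q\<^esub> y = \<one>\<^bsub>Q\<^esub>" by (auto simp: Units_def)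
    moreover have "\<one>\<^bsub>Q\<^esub> \<noteq> \<zero>\<^bsub>Q\<^esub>" by (simp add: one_quotients zero_quotients[of 1] quo_eq_iff pcompose_1)
    ultimately show "x \<in> E - {\<zero>\<^bsub>Q\<^esub>}" using E_carrier quotients.l_null by auto
  next
    fix x assume x: "x \<in> E - {\<zero>\<^bsub>Q\<^esub>}"
    then obtain a h where *: "\<Delta> a = 0" "h \<in> dens" "x = quo (at_g a) h" by (auto simp: center_field_eq)
    have "a \<noteq> 0"
    proof
      assume "a = 0"
      then have "x = \<zero>\<^bsub>Q\<^esub>" unfolding *(3) zero_quotients[OF *(2)] by simp
      then show False using x by simp
    qed
    then have a: "a \<in> dens" using *(1) by (simp add: dens_def)
    have "x \<otimes>\<^bsub>Q\<^esub> quo (at_g h) a = \<one>\<^bsub>Q\<^esub>" "quo (at_g h) a \<otimes>\<^bsub>Q\<^esub> x = \<one>\<^bsub>Q\<^esub>"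
      using * a by (simp_all add: quo_at_g_mult one_quotients quo_eq_iff dens_mult pcompose_mult pcompose_1)
    moreover have "quo (at_g h) a \<in> E" using * a by (auto intro!: E_mem simp: dens_def)
    ultimately show "x \<in> Units (Q\<lparr>carrier := E\<rparr>)" using x by (auto simp: Units_def)
  qed
qed

text \<open>\<open>ks_span\<close> coefficient by coefficient: the same elements span
  \<open>K[x]\<close> over \<open>F[x]\<close>.\<close>

lemma ks_span_poly: "\<exists>h. (\<forall>i. \<Delta> (h i) = 0) \<and> q = (\<Sum>i<n. Polynomial.smult (ks i) (h i))"
proof (induction q)
  case 0
  show ?case by (rule exI[of _ "\<lambda>_. 0"]) simp
next
  case (pCons a q)
  then obtain h where h: "\<And>i. \<Delta> (h i) = 0" "q = (\<Sum>i<n. Polynomial.smult (ks i) (h i))" by blast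
  obtain u where u: "\<And>i. i < n \<Longrightarrow> \<delta> (u i) = 0" "a = (\<Sum>i<n. u i * ks i)" using ks_span by blast
  define h' where "h' i = (if i < n then pCons (u i) (h i) else 0)" for i
  have "[:sum v A:] = (\<Sum>i\<in>A. [:v i:])" for v :: "nat \<Rightarrow> 'k" and A
  proof (induction A rule: infinite_finite_induct)
    case (insert x A)
    then show ?case by (simp flip: insert.IH)
  qed simp_all
  moreover have "pCons 0 (sum v A) = (\<Sum>i\<in>A. pCons 0 (v i))" for v :: "nat \<Rightarrow> 'k poly" and A
  proof (induction A rule: infinite_finite_induct)
    case (insert x A)
    then show ?case by (simp flip: insert.IH)
  qed simp_all
  moreover have "pCons a q = [:a:] + pCons 0 q" by simp
  ultimately have "pCons a q = (\<Sum>i<n. [:u i * ks i:] + pCons 0 (Polynomial.smult (ks i) (h i)))"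
    by (simp only: u(2) h(2) sum.distrib)
  also have "\<dots> = (\<Sum>i<n. Polynomial.smult (ks i) (h' i))"
    by (rule sum.cong) (simp_all add: h'_def mult.commute)
  finally show ?case using h(1) u(1) by (intro exI[of _ h']) (auto simp: h'_def)
qed

end

section \<open>The splitting by right multiplications\<close>

text \<open>Bases in the definition of a splitting are lists, so pairs \<open>(i, j)\<close> are
  numbered by \<open>i * k + j\<close>.\<close>

lemma pair_index:
  fixes i j k :: nat
  assumes "j < k"
  shows "(i * k + j) div k = i" "(i * k + j) mod k = j" and "i < k \<Longrightarrow> i * k + j < k * k"
proof -
  assume "i < k"
  have "i * k + j < Suc i * k" using assms by simp
  also have "\<dots> \<le> k * k" using \<open>i < k\<close> by (intro mult_le_mono1) auto
  finally show "i * k + j < k * k" .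
qed (use assms in simp_all)

lemma sum_div_mod:
  fixes u :: "nat \<Rightarrow> nat \<Rightarrow> 'a::comm_monoid_add"
  shows "(\<Sum>m<k*k. u (m div k) (m mod k)) = (\<Sum>i<k. \<Sum>j<k. u i j)"
proof -
  have "(\<Sum>m<k*k. u (m div k) (m mod k)) = (\<Sum>(i,j)\<in>{..<k}\<times>{..<k}. u i j)"
  proof (rule sum.reindex_bij_witness[of _ "\<lambda>(i,j). i * k + j" "\<lambda>m. (m div k, m mod k)"])
    fix m assume "m \<in> {..<k * k}"
    then have "k > 0" "m < k * k" by (auto intro: Nat.gr0I)
    then show "(m div k, m mod k) \<in> {..<k} \<times> {..<k}" by (simp add: less_mult_imp_div_less)
  next
    fix ij assume "ij \<in> {..<k} \<times> {..<k}"
    then obtain i j where ij: "ij = (i,j)" "i < k" "j < k" by auto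
    then show "(case ij of (i,j) \<Rightarrow> i * k + j) \<in> {..<k * k}" by (simp add: pair_index)
  qed auto
  then show ?thesis by (simp add: sum.cartesian_product)
qed

lemma smult_smult_mat: "a \<cdot>\<^sub>m (b \<cdot>\<^sub>m M) = (a * b) \<cdot>\<^sub>m (M :: 'a::semigroup_mult mat)"
  by (rule eq_matI) (simp_all add: mult.assoc)

text \<open>Phrased with lists because \<open>splitting\<close> quantifies over lists of
  coefficients.\<close>

lemma ex1_list_solution:
  fixes A :: "'a::field mat"
  assumes A: "A \<in> carrier_mat m m" and b: "b \<in> carrier_vec m"
    and ker: "\<And>v. v \<in> carrier_vec m \<Longrightarrow> A *\<^sub>v v = 0\<^sub>v m \<Longrightarrow> v = 0\<^sub>v m"
  shows "\<exists>!ls. length ls = m \<and> A *\<^sub>v vec_of_list ls = b"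
proof -
  have "det A \<noteq> 0" using det_0_iff_vec_prod_zero_field[OF A] ker by blast
  then obtain v where v: "v \<in> carrier_vec m" "A *\<^sub>v v = b" using ex_solution[OF A _ b] by blast
  show ?thesis
  proof (rule ex1I[of _ "list_of_vec v"])
    show "length (list_of_vec v) = m \<and> A *\<^sub>v vec_of_list (list_of_vec v) = b"
      using v by (simp add: vec_list)
  next
    fix ls assume ls: "length ls = m \<and> A *\<^sub>v vec_of_list ls = b"
    then have c: "vec_of_list ls \<in> carrier_vec m" by (intro carrier_vecI) simp
    have "A *\<^sub>v (vec_of_list ls - v) = A *\<^sub>v vec_of_list ls - A *\<^sub>v v"
      using A c v(1) by (rule mult_minus_distrib_mat_vec)
    also have "\<dots> = 0\<^sub>v m" using ls v b by simp
    finally have "vec_of_list ls - v = 0\<^sub>v m" by (rule ker[rotated]) (use c v(1) in auto)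
    then have "vec_of_list ls = v"
      using ls v(1) by (auto simp: vec_eq_iff)
    then show "ls = list_of_vec v" by (metis list_vec)
  qed
qed

context algebraic_derivation
begin

interpretation fr: comm_ring_hom "to_fract :: 'k poly \<Rightarrow> 'k poly fract"
  by unfold_locales simp_all

abbreviation fract_mat :: "'k poly mat \<Rightarrow> 'k poly fract mat" where
  "fract_mat \<equiv> map_mat to_fract"

lemma right_mat_mult_at_g:
  assumes "\<Delta> h = 0"
  shows "right_mat (f * at_g h) = h \<cdot>\<^sub>m right_mat f"
proof -
  have "right_mat (f * at_g h) = right_mat f * (h \<cdot>\<^sub>m 1\<^sub>m n)"
    by (simp add: right_mat_mult right_mat_at_g[OF assms] flip: skew_mult_at_g[OF assms])
  then show ?thesis
    using mult_smult_distrib[of "right_mat f" n n "1\<^sub>m n" n h] by simp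
qed

text \<open>The extension of \<open>P\<close> to fractions: a central denominator \<open>h\<close>
  acts as the scalar \<open>h\<close>, which is inverted in \<open>K(x)\<close>.\<close>

definition rep :: "('k poly \<times> 'k poly) set \<Rightarrow> 'k poly fract mat" where
  "rep U = (SOME M. \<exists>f h. h \<in> dens \<and> U = quo f h \<and>
     M = inverse (to_fract h) \<cdot>\<^sub>m fract_mat (right_mat f))"

lemma rep_quo:
  assumes "h \<in> dens"
  shows "rep (quo f h) = inverse (to_fract h) \<cdot>\<^sub>m fract_mat (right_mat f)"
  unfolding rep_def
proof (rule some_equality)
  show "\<exists>f' h'. h' \<in> dens \<and> quo f h = quo f' h' \<and>
     inverse (to_fract h) \<cdot>\<^sub>m fract_mat (right_mat f) = inverse (to_fract h') \<cdot>\<^sub>m fract_mat (right_mat f')"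
    using assms by blast
next
  fix M assume "\<exists>f' h'. h' \<in> dens \<and> quo f h = quo f' h' \<and>
     M = inverse (to_fract h') \<cdot>\<^sub>m fract_mat (right_mat f')"
  then obtain q k where k: "k \<in> dens" "quo f h = quo q k" and M: "M = inverse (to_fract k) \<cdot>\<^sub>m fract_mat (right_mat q)"
    by blast
  then have "right_mat (f * at_g k) = right_mat (q * at_g h)"
    using assms by (simp add: quo_eq_iff)
  then have eq: "k \<cdot>\<^sub>m right_mat f = h \<cdot>\<^sub>m right_mat q"
    using assms k(1) by (simp add: right_mat_mult_at_g dens_def)
  show "M = inverse (to_fract h) \<cdot>\<^sub>m fract_mat (right_mat f)"
    unfolding M
  proof (rule eq_matI)
    fix i j assume "i < dim_row (inverse (to_fract h) \<cdot>\<^sub>m fract_mat (right_mat f))"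
      "j < dim_col (inverse (to_fract h) \<cdot>\<^sub>m fract_mat (right_mat f))"
    then have ij: "i < n" "j < n" by simp_all
    then have "k * right_mat f $$ (i,j) = h * right_mat q $$ (i,j)"
      using arg_cong[OF eq, of "\<lambda>M. M $$ (i,j)"] by simp
    then have "to_fract k * to_fract (right_mat f $$ (i,j)) = to_fract h * to_fract (right_mat q $$ (i,j))"
      by (simp only: to_fract_mult[symmetric])
    moreover have "to_fract k \<noteq> 0" "to_fract h \<noteq> 0" using k(1) assms by (auto simp: dens_def)
    ultimately show "(inverse (to_fract k) \<cdot>\<^sub>m fract_mat (right_mat q)) $$ (i,j) =
        (inverse (to_fract h) \<cdot>\<^sub>m fract_mat (right_mat f)) $$ (i,j)"
      using ij by (simp add: field_simps)
  qed simp_all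
qed

lemma rep_quo_1: "rep (quo f 1) = fract_mat (right_mat f)"
  by (intro eq_matI) (simp_all add: rep_quo)

lemma rep_ring_hom: "rep \<in> Ring.ring_hom Q (ring_mat TYPE('k poly fract) n ())"
proof (rule ring_hom_memI)
  fix x assume "x \<in> carrier Q"
  then show "rep x \<in> carrier (ring_mat TYPE('k poly fract) n ())"
    by (auto simp: carrier_quotients rep_quo ring_mat_def)
next
  fix x y assume "x \<in> carrier Q" "y \<in> carrier Q"
  then obtain f h q k where *: "h \<in> dens" "k \<in> dens" "x = quo f h" "y = quo q k"
    by (auto simp: carrier_quotients)
  have "rep x * rep y = (inverse (to_fract h) * inverse (to_fract k)) \<cdot>\<^sub>m (fract_mat (right_mat f) * fract_mat (right_mat q))"
    using * by (simp add: rep_quo mult_smult_assoc_mat[of _ n n _ n] mult_smult_distrib[of _ n n _ n] smult_smult_mat mult.commute)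
  also have "\<dots> = rep (x \<otimes>\<^bsub>Q\<^esub> y)"
    using * by (simp add: quo_mult rep_quo dens_mult right_mat_mult fr.mat_hom_mult[of _ n n _ n])
  finally show "rep (x \<otimes>\<^bsub>Q\<^esub> y) = rep x \<otimes>\<^bsub>ring_mat TYPE('k poly fract) n ()\<^esub> rep y"
    by (simp add: ring_mat_def)
next
  fix x y assume "x \<in> carrier Q" "y \<in> carrier Q"
  then obtain f q h where *: "h \<in> dens" "x = quo f h" "y = quo q h"
    by (rule quotients_common_denominator)
  show "rep (x \<oplus>\<^bsub>Q\<^esub> y) = rep x \<oplus>\<^bsub>ring_mat TYPE('k poly fract) n ()\<^esub> rep y"
    unfolding * by (rule eq_matI) (use *(1) in \<open>auto simp: quo_add rep_quo right_mat_add ring_mat_def distrib_left\<close>)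
next
  show "rep \<one>\<^bsub>Q\<^esub> = \<one>\<^bsub>ring_mat TYPE('k poly fract) n ()\<^esub>"
    by (simp add: one_quotients rep_quo_1 right_mat_1 ring_mat_def fr.mat_hom_one)
qed

lemma rep_carrier: "x \<in> carrier Q \<Longrightarrow> rep x \<in> carrier_mat n n"
  and rep_mult: "x \<in> carrier Q \<Longrightarrow> y \<in> carrier Q \<Longrightarrow> rep (x \<otimes>\<^bsub>Q\<^esub> y) = rep x * rep y"
  and rep_add: "x \<in> carrier Q \<Longrightarrow> y \<in> carrier Q \<Longrightarrow> rep (x \<oplus>\<^bsub>Q\<^esub> y) = rep x + rep y"
  using ring_hom_closed[OF rep_ring_hom] ring_hom_mult[OF rep_ring_hom] ring_hom_add[OF rep_ring_hom]
  by (auto simp: ring_mat_def)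

definition scal :: "('k poly \<times> 'k poly) set \<Rightarrow> 'k poly fract" where
  "scal x = rep x $$ (0,0)"

lemma rep_center:
  assumes "x \<in> E"
  shows "rep x = scal x \<cdot>\<^sub>m 1\<^sub>m n" "scal x = 0 \<longleftrightarrow> x = \<zero>\<^bsub>Q\<^esub>"
proof -
  obtain a h where *: "\<Delta> a = 0" "h \<in> dens" "x = quo (at_g a) h"
    using assms by (auto simp: center_field_eq)
  have eq: "rep x = (inverse (to_fract h) * to_fract a) \<cdot>\<^sub>m 1\<^sub>m n"
    using * by (intro eq_matI) (auto simp: rep_quo right_mat_at_g)
  then show "rep x = scal x \<cdot>\<^sub>m 1\<^sub>m n" using n_pos by (simp add: scal_def)
  have "scal x = inverse (to_fract h) * to_fract a" using eq n_pos by (simp add: scal_def)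
  then show "scal x = 0 \<longleftrightarrow> x = \<zero>\<^bsub>Q\<^esub>"
    using * by (simp add: zero_quotients[of h] quo_eq_iff dens_def inj_at_g)
qed

text \<open>The Leibniz rule for moving \<open>t ^ r\<close> past \<open>k\<close>, the case of
  \<open>additive_funpow_binomial\<close> for multiplication by \<open>t\<close> and
  \<Delta>.\<close>

lemma D_pow_monom:
  "(D ^^ r) (Polynomial.monom k j) =
     (\<Sum>s\<le>r. Polynomial.monom (of_nat (r choose s) * (\<delta> ^^ (r - s)) k) (s + j))"
proof -
  have M: "((*) var_t ^^ s) (Polynomial.monom a j) = Polynomial.monom a (s + j)" for s a
    by (induction s) (simp_all add: monom_Suc)
  have N: "(\<Delta> ^^ s) (Polynomial.monom k j) = Polynomial.monom ((\<delta> ^^ s) k) j" for s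
    by (induction s) (simp_all add: poly_eq_iff)
  have C: "of_nat m * Polynomial.monom a i = Polynomial.monom (of_nat m * a) i" for m i and a :: 'k
    by (induction m) (simp_all add: distrib_right add_monom)
  have "(D ^^ r) (Polynomial.monom k j) = (\<Sum>s\<le>r. of_nat (r choose s) * ((*) var_t ^^ s) ((\<Delta> ^^ (r - s)) (Polynomial.monom k j)))"
    by (rule additive_funpow_binomial) (auto simp: Delta_add Delta_mult D_eq algebra_simps)
  then show ?thesis by (simp add: M N C)
qed

lemma right_mat_monom:
  assumes "r < n" "q < n"
  shows "right_mat (Polynomial.monom k j) $$ (r,q) =
    (\<Sum>s\<le>r. [:of_nat (r choose s) * (\<delta> ^^ (r - s)) k:] * coord (t_pow (s + j)) q)"
proof -
  have monom: "coord (Polynomial.monom a m) q = [:a:] * coord (t_pow m) q" for a m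
    using coord_at_g_mult[OF assms(2), of "[:a:]" "t_pow m"] by (simp add: smult_monom)
  have "right_mat (Polynomial.monom k j) $$ (r,q) =
      (\<Sum>s\<le>r. coord (Polynomial.monom (of_nat (r choose s) * (\<delta> ^^ (r - s)) k) (s + j)) q)"
    using assms by (simp add: right_mat_def monom_skew_mult D_pow_monom coord_sum)
  also have "\<dots> = (\<Sum>s\<le>r. [:of_nat (r choose s) * (\<delta> ^^ (r - s)) k:] * coord (t_pow (s + j)) q)"
    by (intro sum.cong refl monom)
  finally show ?thesis .
qed

text \<open>Row \<open>r\<close> of the relation only involves the combinations \<open>d r' j\<close> with \<open>r' \<le> r\<close>, and \<open>d r c\<close> is
  the only one with \<open>r' = r\<close> in column \<open>c\<close>, which gives \<open>d = 0\<close> by induction on \<open>r\<close>.\<close>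

lemma basis_independent:
  fixes l :: "nat \<Rightarrow> nat \<Rightarrow> 'k poly fract"
  assumes "\<And>r c. r < n \<Longrightarrow> c < n \<Longrightarrow>
      (\<Sum>i<n. \<Sum>j<n. l i j * to_fract (right_mat (Polynomial.monom (ks i) j) $$ (r,c))) = 0"
    and "i < n" "j < n"
  shows "l i j = 0"
proof -
  define \<kappa> :: "'k \<Rightarrow> 'k poly fract" where "\<kappa> a = to_fract [:a:]" for a
  have \<kappa>: "comm_ring_hom \<kappa>"
    by unfold_locales (simp_all add: \<kappa>_def flip: to_fract_add to_fract_mult one_pCons)
  define d where "d r j = (\<Sum>i<n. l i j * \<kappa> ((\<delta> ^^ r) (ks i)))" for r j
  define \<tau> where "\<tau> s c = to_fract (coord (t_pow s) c)" for s c
  have "\<forall>c<n. d r c = 0" if "r < n" for r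
    using that
  proof (induction r rule: less_induct)
    case (less r)
    show ?case
    proof (intro allI impI)
      fix c assume "c < n"
      have "l i j * to_fract (right_mat (Polynomial.monom (ks i) j) $$ (r,c)) =
          (\<Sum>s\<le>r. l i j * \<kappa> ((\<delta> ^^ (r - s)) (ks i)) * (\<kappa> (of_nat (r choose s)) * \<tau> (s + j) c))" for i j
        unfolding right_mat_monom[OF less.prems \<open>c < n\<close>]
        by (simp add: sum_distrib_left \<kappa>_def \<tau>_def mult_ac flip: to_fract_mult)
      with assms(1)[OF less.prems \<open>c < n\<close>]
      have "0 = (\<Sum>i<n. \<Sum>j<n. \<Sum>s\<le>r. l i j * \<kappa> ((\<delta> ^^ (r - s)) (ks i)) * (\<kappa> (of_nat (r choose s)) * \<tau> (s + j) c))"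
        by simp
      also have "\<dots> = (\<Sum>i<n. \<Sum>s\<le>r. \<Sum>j<n. l i j * \<kappa> ((\<delta> ^^ (r - s)) (ks i)) * (\<kappa> (of_nat (r choose s)) * \<tau> (s + j) c))"
        by (rule sum.cong[OF refl], rule sum.swap)
      also have "\<dots> = (\<Sum>s\<le>r. \<Sum>i<n. \<Sum>j<n. l i j * \<kappa> ((\<delta> ^^ (r - s)) (ks i)) * (\<kappa> (of_nat (r choose s)) * \<tau> (s + j) c))"
        by (rule sum.swap)
      also have "\<dots> = (\<Sum>s\<le>r. \<Sum>j<n. \<Sum>i<n. l i j * \<kappa> ((\<delta> ^^ (r - s)) (ks i)) * (\<kappa> (of_nat (r choose s)) * \<tau> (s + j) c))"
        by (rule sum.cong[OF refl], rule sum.swap)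
      also have "\<dots> = (\<Sum>s\<le>r. \<Sum>j<n. d (r - s) j * (\<kappa> (of_nat (r choose s)) * \<tau> (s + j) c))"
        by (simp add: d_def sum_distrib_right)
      also have "\<dots> = (\<Sum>s\<in>{0}. \<Sum>j<n. d (r - s) j * (\<kappa> (of_nat (r choose s)) * \<tau> (s + j) c))"
        using less by (intro sum.mono_neutral_right) (auto intro!: sum.neutral)
      also have "\<dots> = (\<Sum>j<n. d r j * \<tau> j c)"
        by (simp add: \<kappa>_def flip: one_pCons)
      also have "\<dots> = (\<Sum>j<n. if j = c then d r j else 0)"
        using \<open>c < n\<close> by (intro sum.cong) (auto simp: \<tau>_def coord_t_pow)
      also have "\<dots> = d r c" using \<open>c < n\<close> by simp
      finally show "d r c = 0" by simp
    qed
  qed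
  then have "(\<Sum>i<n. l i j * \<kappa> ((\<delta> ^^ r) (ks i))) = 0" if "r < n" for r
    using that assms(3) by (simp add: d_def)
  then show ?thesis by (rule ks_independent_hom[OF \<kappa> _ assms(2)])
qed

section \<open>A basis of the ring of quotients over \<open>F(x)\<close>\<close>

definition basis :: "('k poly \<times> 'k poly) set list" where
  "basis = map (\<lambda>m. quo (Polynomial.monom (ks (m div n)) (m mod n)) 1) [0..<n*n]"

lemma length_basis: "length basis = n * n"
  by (simp add: basis_def)

lemma basis_carrier: "set basis \<subseteq> carrier Q"
  by (auto simp: basis_def)

text \<open>Independence over \<open>K(x)\<close>, more than the independence over
  \<open>F(x)\<close> asked of a basis. It serves twice: it is pulled back in
  \<open>independent_basis\<close>, and it makes the induced map on matrices bijective in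
  \<open>splitting_rep\<close>.\<close>

lemma rep_basis_independent:
  assumes "\<And>r c. r < n \<Longrightarrow> c < n \<Longrightarrow> (\<Sum>m<n*n. l m * rep (basis ! m) $$ (r,c)) = 0" and "m < n * n"
  shows "l m = 0"
proof -
  have "l (i * n + j) = 0" if "i < n" "j < n" for i j
  proof (rule basis_independent[where l = "\<lambda>i j. l (i * n + j)", OF _ that])
    fix r c assume rc: "r < n" "c < n"
    have "(\<Sum>i<n. \<Sum>j<n. l (i * n + j) * to_fract (right_mat (Polynomial.monom (ks i) j) $$ (r,c))) =
      (\<Sum>m<n*n. l (m div n * n + m mod n) * to_fract (right_mat (Polynomial.monom (ks (m div n)) (m mod n)) $$ (r,c)))"
      by (rule sum_div_mod[symmetric])
    also have "\<dots> = (\<Sum>m<n*n. l m * rep (basis ! m) $$ (r,c))"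
      using rc by (intro sum.cong) (simp_all add: basis_def rep_quo_1 div_mult_mod_eq)
    finally show "(\<Sum>i<n. \<Sum>j<n. l (i * n + j) * to_fract (right_mat (Polynomial.monom (ks i) j) $$ (r,c))) = 0"
      using assms(1)[OF rc] by simp
  qed
  note l = this
  have "l (m div n * n + m mod n) = 0"
    by (intro l less_mult_imp_div_less[OF assms(2)] mod_less_divisor[OF n_pos])
  then show ?thesis unfolding div_mult_mod_eq .
qed

text \<open>\<open>combine\<close> stops at the end of the shorter list, hence the
  \<open>min\<close>. Through this formula a relation over \<open>F(x)\<close> becomes one between
  matrices over \<open>K(x)\<close>.\<close>

lemma rep_combine:
  assumes "set xs \<subseteq> E" "set ys \<subseteq> carrier Q" "r < n" "q < n"
  shows "rep (quotients.combine xs ys) $$ (r,q) =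
    (\<Sum>m<min (length xs) (length ys). scal (xs ! m) * rep (ys ! m) $$ (r,q))"
  using assms(1,2)
proof (induction xs ys rule: quotients.combine.induct)
  case (1 k xs u ys)
  have E: "E \<subseteq> carrier Q" by (auto simp: center_field_eq)
  have "quotients.combine xs ys \<in> carrier Q" using 1 E by (intro quotients.combine_in_carrier) auto
  moreover have ku: "k \<in> carrier Q" "u \<in> carrier Q" using 1 E by auto
  ultimately have "rep (quotients.combine (k # xs) (u # ys)) = rep k * rep u + rep (quotients.combine xs ys)"
    by (simp add: rep_add rep_mult)
  moreover have "rep k * rep u = scal k \<cdot>\<^sub>m rep u"
    using 1 rep_carrier[OF ku(2)] by (simp add: rep_center(1) mult_smult_assoc_mat[of _ n n _ n])
  ultimately show ?case
    using 1 assms(3,4) rep_carrier[OF ku(2)] rep_carrier[OF \<open>quotients.combine xs ys \<in> carrier Q\<close>]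
    by (simp add: sum.lessThan_Suc_shift del: sum.lessThan_Suc)
next
  case ("2_1" ys)
  then show ?case
    using assms(3,4) by (simp add: zero_quotients[of 1] rep_quo_1 right_mat_def coord_0)
next
  case ("2_2" xs)
  then show ?case
    using assms(3,4) by (simp add: zero_quotients[of 1] rep_quo_1 right_mat_def coord_0)
qed

lemma independent_basis: "quotients.independent E basis"
proof (rule quotients.trivial_combine_imp_independent[OF subfield_center basis_carrier])
  fix xs assume xs: "set xs \<subseteq> E" "quotients.combine xs basis = \<zero>\<^bsub>Q\<^esub>"
  \<comment> \<open>\<open>xs\<close> may be shorter than \<open>basis\<close>; the missing
    coefficients count as zero.\<close>
  define l where "l m = (if m < length xs then scal (xs ! m) else 0)" for m
  have "l m = 0" if "m < n * n" for m
  proof (rule rep_basis_independent[OF _ that])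
    fix r c assume rc: "r < n" "c < n"
    have "(\<Sum>m<n*n. l m * rep (basis ! m) $$ (r,c)) =
        (\<Sum>m<min (length xs) (length basis). scal (xs ! m) * rep (basis ! m) $$ (r,c))"
      by (rule sum.mono_neutral_cong_right) (auto simp: l_def length_basis)
    also have "\<dots> = rep \<zero>\<^bsub>Q\<^esub> $$ (r,c)"
      unfolding xs(2)[symmetric] by (rule rep_combine[OF xs(1) basis_carrier rc, symmetric])
    also have "\<dots> = 0"
      using rc by (simp add: zero_quotients[of 1] rep_quo_1 right_mat_def coord_0)
    finally show "(\<Sum>m<n*n. l m * rep (basis ! m) $$ (r,c)) = 0" .
  qed
  note l = this
  have "xs ! m = \<zero>\<^bsub>Q\<^esub>" if "m < n * n" "m < length xs" for m
  proof -
    have "scal (xs ! m) = 0" using l[OF that(1)] that(2) by (simp add: l_def)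
    moreover have "xs ! m \<in> E" using that(2) xs(1) nth_mem by blast
    ultimately show ?thesis by (simp add: rep_center(2))
  qed
  then show "set (take (length basis) xs) \<subseteq> {\<zero>\<^bsub>Q\<^esub>}"
    by (auto simp: in_set_conv_nth length_basis)
qed

text \<open>A numerator is expanded along the tower \<open>F[x]\<close>, \<open>K[x]\<close>,
  \<open>R\<close>: in powers of \<open>t\<close> over \<open>K[x]\<close>, and each coordinate in
  the \<open>ks i\<close> over \<open>F[x]\<close>. The denominator is central and goes into the
  coefficients.\<close>

lemma Span_basis: "quotients.Span E basis = carrier Q"
proof
  note Span = quotients.Span_subgroup_props[OF subfield_center basis_carrier]
    quotients.Span_smult_closed[OF subfield_center basis_carrier]
  show "quotients.Span E basis \<subseteq> carrier Q" by (rule Span(1))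
  show "carrier Q \<subseteq> quotients.Span E basis"
  proof
    fix x assume "x \<in> carrier Q"
    then obtain f h where h: "h \<in> dens" and x: "x = quo f h" by (auto simp: carrier_quotients)
    have sum: "quo (sum v A) h \<in> quotients.Span E basis"
      if "\<And>i. i \<in> A \<Longrightarrow> quo (v i) h \<in> quotients.Span E basis" for v :: "nat \<Rightarrow> 'k poly" and A
      using that
    proof (induction A rule: infinite_finite_induct)
      case (insert i A)
      then have "quo (v i) h \<oplus>\<^bsub>Q\<^esub> quo (sum v A) h \<in> quotients.Span E basis"
        by (intro Span(3)) auto
      then show ?case using insert.hyps h by (simp add: quo_add)
    qed (use Span(2) h in \<open>simp_all add: zero_quotients[of h]\<close>)
    have mon: "quo (at_g a * Polynomial.monom (ks i) j) h \<in> quotients.Span E basis"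
      if "\<Delta> a = 0" "i < n" "j < n" for a i j
    proof -
      have "basis ! (i * n + j) = quo (Polynomial.monom (ks i) j) 1"
        using that by (simp add: basis_def pair_index)
      then have "quo (Polynomial.monom (ks i) j) 1 \<in> set basis"
        using that by (metis length_basis nth_mem pair_index(3))
      then have "quo (Polynomial.monom (ks i) j) 1 \<in> quotients.Span E basis"
        using quotients.Span_base_incl[OF subfield_center basis_carrier] by blast
      moreover have "quo (at_g a) h \<in> E" using that h by (auto simp: center_field_eq)
      ultimately have "quo (at_g a) h \<otimes>\<^bsub>Q\<^esub> quo (Polynomial.monom (ks i) j) 1 \<in> quotients.Span E basis"
        by (intro Span(5))
      then show ?thesis using h by (simp add: quo_at_g_mult)
    qed
    have "\<forall>j. \<exists>H. (\<forall>i. \<Delta> (H i) = 0) \<and> coord f j = (\<Sum>i<n. Polynomial.smult (ks i) (H i))"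
      by (intro allI ks_span_poly)
    from choice[OF this] obtain H where H: "\<And>j i. \<Delta> (H j i) = 0"
      "\<And>j. coord f j = (\<Sum>i<n. Polynomial.smult (ks i) (H j i))"
      by blast
    have "at_g (coord f j) * t_pow j = (\<Sum>i<n. at_g (H j i) * Polynomial.monom (ks i) j)" for j
      by (simp add: H(2) pcompose_sum pcompose_smult sum_distrib_right monom_altdef)
    then have f: "f = (\<Sum>j<n. \<Sum>i<n. at_g (H j i) * Polynomial.monom (ks i) j)"
      by (subst coord_eq[of f]) simp
    have "quo (\<Sum>j<n. \<Sum>i<n. at_g (H j i) * Polynomial.monom (ks i) j) h \<in> quotients.Span E basis"
      by (intro sum mon H(1)) (simp_all only: lessThan_iff)
    then show "x \<in> quotients.Span E basis" unfolding x f[symmetric] .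
  qed
qed

lemma splitting_rep: "splitting Q E n rep"
  unfolding splitting_def
proof (intro conjI exI[of _ basis] ballI)
  show "rep \<in> Ring.ring_hom Q (ring_mat TYPE('k poly fract) n ())" by (rule rep_ring_hom)
  show "\<exists>l. rep z = l \<cdot>\<^sub>m 1\<^sub>m n" if "z \<in> E" for z using rep_center(1)[OF that] by blast
  show "quotients.independent E basis" by (rule independent_basis)
  show "quotients.Span E basis = carrier Q" by (rule Span_basis)
next
  fix M :: "'k poly fract mat" assume M: "M \<in> carrier_mat n n"
  \<comment> \<open>Column \<open>m\<close> is the flattened matrix \<open>rep (basis ! m)\<close>.
    There are as many columns as entries, so independence alone gives unique solvability.\<close>
  define B where "B = mat (n*n) (n*n) (\<lambda>(a,m). rep (basis ! m) $$ (a div n, a mod n))"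
  define b where "b = vec (n*n) (\<lambda>a. M $$ (a div n, a mod n))"
  have B: "B \<in> carrier_mat (n*n) (n*n)" and b: "b \<in> carrier_vec (n*n)" by (simp_all add: B_def b_def)
  note ind = pair_index(3)[where k = n]
  have dm: "a div n < n" "a mod n < n" if "a < n * n" for a
    using that n_pos by (simp_all add: less_mult_imp_div_less)
  have Bv: "(B *\<^sub>v v) $ a = (\<Sum>m<n*n. v $ m * rep (basis ! m) $$ (a div n, a mod n))"
    if "v \<in> carrier_vec (n*n)" "a < n * n" for v a
    using that by (simp add: B_def scalar_prod_def atLeast0LessThan mult.commute)
  have "\<exists>!ls. length ls = n * n \<and> B *\<^sub>v vec_of_list ls = b"
  proof (rule ex1_list_solution[OF B b])
    fix v assume v: "v \<in> carrier_vec (n*n)" "B *\<^sub>v v = 0\<^sub>v (n*n)"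
    have "v $ m = 0" if "m < n * n" for m
    proof (rule rep_basis_independent[OF _ that])
      fix r c assume "r < n" "c < n"
      then show "(\<Sum>m<n*n. v $ m * rep (basis ! m) $$ (r,c)) = 0"
        using Bv[OF v(1), of "r * n + c"] ind[of c r] v(2) by (simp add: pair_index)
    qed
    then show "v = 0\<^sub>v (n*n)" using v(1) by (intro eq_vecI) auto
  qed
  moreover have "length ls = n * n \<and> B *\<^sub>v vec_of_list ls = b \<longleftrightarrow>
      length ls = length basis \<and> (\<forall>i<n. \<forall>j<n. M $$ (i,j) = (\<Sum>k<length basis. ls ! k * rep (basis ! k) $$ (i,j)))" for ls
  proof (cases "length ls = n * n")
    case True
    then have c: "vec_of_list ls \<in> carrier_vec (n*n)" by (intro carrier_vecI) simp
    have ls: "vec_of_list ls $ m = ls ! m" if "m < n * n" for m by (simp add: vec_of_list_index)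
    have "B *\<^sub>v vec_of_list ls = b \<longleftrightarrow> (\<forall>a<n*n. (B *\<^sub>v vec_of_list ls) $ a = b $ a)"
      using B b by (auto intro!: eq_vecI)
    also have "\<dots> \<longleftrightarrow> (\<forall>a<n*n. (\<Sum>m<n*n. ls ! m * rep (basis ! m) $$ (a div n, a mod n)) = M $$ (a div n, a mod n))"
      by (simp add: Bv[OF c] b_def ls)
    also have "\<dots> \<longleftrightarrow> (\<forall>i<n. \<forall>j<n. M $$ (i,j) = (\<Sum>m<n*n. ls ! m * rep (basis ! m) $$ (i,j)))"
    proof (intro iffI allI impI)
      fix i j assume *: "\<forall>a<n*n. (\<Sum>m<n*n. ls ! m * rep (basis ! m) $$ (a div n, a mod n)) = M $$ (a div n, a mod n)"
        and "i < n" "j < n"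
      then show "M $$ (i,j) = (\<Sum>m<n*n. ls ! m * rep (basis ! m) $$ (i,j))"
        using *[rule_format, OF ind[of j i]] by (simp add: pair_index)
    qed (use dm in auto)
    finally show ?thesis using True by (simp add: length_basis)
  qed (simp add: length_basis)
  ultimately show "\<exists>!ls. length ls = length basis \<and>
      (\<forall>i<n. \<forall>j<n. M $$ (i,j) = (\<Sum>k<length basis. ls ! k * rep (basis ! k) $$ (i,j)))"
    by simp
qed

end

section \<open>Arbitrary splittings\<close>

text \<open>The polynomial \<open>(X - a)\<^sup>p = X\<^sup>p - a\<^sup>p\<close> annihilates \<open>v\<close>, so the last nonzero vector among the
  \<open>(A - a)\<^sup>m v\<close> is an eigenvector.\<close>

lemma ex_eigenvector_CHAR:
  fixes A :: "'a::field mat"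
  assumes p: "Factorial_Ring.prime p" "CHAR('a) = p"
    and A: "A \<in> carrier_mat N N" and v: "v \<in> carrier_vec N" "v \<noteq> 0\<^sub>v N"
    and Apow: "(((*\<^sub>v) A) ^^ p) v = a ^ p \<cdot>\<^sub>v v"
  defines "B \<equiv> \<lambda>u. A *\<^sub>v u - a \<cdot>\<^sub>v u"
  shows "\<exists>m. (B ^^ m) v \<noteq> 0\<^sub>v N \<and> A *\<^sub>v ((B ^^ m) v) = a \<cdot>\<^sub>v ((B ^^ m) v)"
proof -
  define u where "u l i = vec_index ((((*\<^sub>v) A) ^^ l) v) i" for l i
  \<comment> \<open>Entry \<open>i\<close> of \<open>q(A) v\<close>, which turns identities between
    polynomials into identities between vectors.\<close>
  define \<psi> where "\<psi> q i = (\<Sum>l\<le>Polynomial.degree q. coeff q l * u l i)" for q i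
  have Ac: "(((*\<^sub>v) A) ^^ l) v \<in> carrier_vec N" for l
    using A v by (induction l) auto
  have Bc: "(B ^^ l) v \<in> carrier_vec N" for l
    using A v by (induction l) (auto simp: B_def)
  have psi: "\<psi> q i = (\<Sum>l<M. coeff q l * u l i)" if "Polynomial.degree q < M" for q i M
    unfolding \<psi>_def by (rule sum.mono_neutral_left) (use that in \<open>auto simp: coeff_eq_0\<close>)
  have psi_add: "\<psi> (q + r) i = \<psi> q i + \<psi> r i" for q r i
  proof -
    obtain M where "Polynomial.degree q < M" "Polynomial.degree r < M"
      using gt_ex[of "max (Polynomial.degree q) (Polynomial.degree r)"] by auto
    moreover from this have "Polynomial.degree (q + r) < M" by (rule degree_add_less)
    ultimately show ?thesis by (simp add: psi[of _ M] distrib_right sum.distrib)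
  qed
  have psi_smult: "\<psi> (Polynomial.smult b q) i = b * \<psi> q i" for b q i
    by (subst psi[of _ "Suc (Polynomial.degree q)"])
       (simp_all add: psi[of _ "Suc (Polynomial.degree q)"] sum_distrib_left mult.assoc
         le_imp_less_Suc degree_smult_le distrib_left)
  have psi_monom: "\<psi> (Polynomial.monom b m) i = b * u m i" for b m i
    by (subst psi[of _ "Suc m"]) (auto simp: le_imp_less_Suc degree_monom_le)
  have Au: "(\<Sum>j<N. A $$ (i,j) * u l j) = u (Suc l) i" if "i < N" for l i
    using that A Ac[of l] by (simp add: u_def scalar_prod_def atLeast0LessThan)
  have psi_shift: "\<psi> (pCons 0 q) i = (\<Sum>j<N. A $$ (i,j) * \<psi> q j)" if "i < N" for q i
  proof -
    have "\<psi> (pCons 0 q) i = (\<Sum>l<Suc (Suc (Polynomial.degree q)). coeff (pCons 0 q) l * u l i)"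
      by (rule psi) (simp add: le_imp_less_Suc degree_pCons_le)
    also have "\<dots> = (\<Sum>l\<le>Polynomial.degree q. coeff q l * u (Suc l) i)"
      by (subst sum.lessThan_Suc_shift) (simp add: lessThan_Suc_atMost)
    also have "\<dots> = (\<Sum>l\<le>Polynomial.degree q. \<Sum>j<N. coeff q l * (A $$ (i,j) * u l j))"
      by (simp add: Au[OF that, symmetric] sum_distrib_left)
    also have "\<dots> = (\<Sum>j<N. A $$ (i,j) * \<psi> q j)"
      unfolding \<psi>_def sum_distrib_left by (subst sum.swap) (simp add: mult_ac)
    finally show ?thesis .
  qed
  have B: "vec_index ((B ^^ m) v) i = \<psi> ([:- a, 1:] ^ m) i" if "i < N" for m i
    using that
  proof (induction m arbitrary: i)
    case 0
    then show ?case using psi_monom[of 1 0 i] by (simp add: u_def)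
  next
    case (Suc m)
    have "[:- a, 1:] ^ Suc m = pCons 0 ([:- a, 1:] ^ m) + Polynomial.smult (- a) ([:- a, 1:] ^ m)"
      by simp
    then have "\<psi> ([:- a, 1:] ^ Suc m) i =
        (\<Sum>j<N. A $$ (i,j) * vec_index ((B ^^ m) v) j) - a * vec_index ((B ^^ m) v) i"
      using Suc by (simp only: psi_add psi_smult psi_shift) simp
    also have "\<dots> = vec_index ((B ^^ Suc m) v) i"
      using Suc.prems A Bc[of m] by (simp add: B_def scalar_prod_def atLeast0LessThan)
    finally show ?case by simp
  qed
  have "(B ^^ p) v = 0\<^sub>v N"
  proof (rule eq_vecI)
    fix i assume "i < dim_vec (0\<^sub>v N :: 'a vec)"
    then have i: "i < N" by simp
    have "[:- a, 1:] ^ p = ([:0, 1:] + [:- a:]) ^ p" by simp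
    also have "\<dots> = [:0, 1:] ^ p + [:- a:] ^ p"
      by (rule freshmans_dream) (simp_all add: p)
    also have "\<dots> = Polynomial.monom 1 p + Polynomial.monom ((- a) ^ p) 0"
      by (simp add: monom_altdef poly_const_pow monom_0)
    finally have "vec_index ((B ^^ p) v) i = u p i + (- a) ^ p * u 0 i"
      by (simp only: B[OF i] psi_add psi_monom) simp
    also have "\<dots> = (a ^ p + (- a) ^ p) * vec_index v i"
      using Apow i v(1) by (simp add: u_def distrib_right)
    \<comment> \<open>Used backwards, the additivity of \<open>p\<close>-th powers gives
      \<open>(- a) ^ p = - (a ^ p)\<close> without distinguishing \<open>p = 2\<close>.\<close>
    also have "a ^ p + (- a) ^ p = (a + - a) ^ p"
      by (rule freshmans_dream[symmetric]) (simp_all add: p)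
    also have "\<dots> = 0" using p prime_gt_0_nat by (simp add: power_0_left)
    finally show "vec_index ((B ^^ p) v) i = vec_index (0\<^sub>v N) i" using i by simp
  qed (use Bc[of p] in simp)
  then obtain m where m: "(B ^^ m) v = 0\<^sub>v N" "\<And>m'. m' < m \<Longrightarrow> (B ^^ m') v \<noteq> 0\<^sub>v N"
    using exists_least_iff[of "\<lambda>m. (B ^^ m) v = 0\<^sub>v N"] by blast
  then obtain m' where m': "m = Suc m'" using v by (cases m) auto
  have "A *\<^sub>v ((B ^^ m') v) - a \<cdot>\<^sub>v ((B ^^ m') v) = 0\<^sub>v N"
    using m(1) by (simp add: m' B_def)
  then have "A *\<^sub>v ((B ^^ m') v) = a \<cdot>\<^sub>v ((B ^^ m') v)"
    using A Bc[of m'] by (simp add: vec_eq_iff)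
  then show ?thesis using m(2) m' by blast
qed

context algebraic_derivation
begin

lemma Delta_power: "\<Delta> (h ^ m) = of_nat m * h ^ (m - 1) * \<Delta> h"
proof (induction m)
  case (Suc m)
  then show ?case by (cases m) (simp_all add: Delta_mult algebra_simps)
qed simp

text \<open>The factor \<open>p\<close> of the power rule vanishes. So \<open>p\<close>-th powers of
  elements of \<open>K[x]\<close> lie in \<open>F[x]\<close>, the fact on which \<kappa>
  rests.\<close>

lemma Delta_power_p: "\<Delta> (h ^ p) = 0"
proof -
  have "of_nat p = (0 :: 'k poly)"
    using of_nat_CHAR[where ?'a = "'k poly"] by (simp add: CHAR_p)
  then show ?thesis by (simp add: Delta_power)
qed

end

text \<open>With \<open>N > 0\<close> a scalar can be read off entry \<open>(0,0)\<close>;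
  \<open>diff_norm_eq\<close> treats \<open>N = 0\<close> separately.\<close>

locale splitting_of_quotients = algebraic_derivation \<delta> p e F c g
  for \<delta> :: "'k::field \<Rightarrow> 'k" and p e F c g +
  fixes N :: nat and \<phi> :: "('k poly \<times> 'k poly) set \<Rightarrow> 'l::field mat"
  assumes splitting: "splitting Q E N \<phi>" and N_pos: "N > 0"
begin

lemma phi_hom: "\<phi> \<in> Ring.ring_hom Q (ring_mat TYPE('l) N ())"
  using splitting by (simp add: splitting_def)

lemma phi_carrier: "x \<in> carrier Q \<Longrightarrow> \<phi> x \<in> carrier_mat N N"
  and phi_mult: "x \<in> carrier Q \<Longrightarrow> y \<in> carrier Q \<Longrightarrow> \<phi> (x \<otimes>\<^bsub>Q\<^esub> y) = \<phi> x * \<phi> y"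
  and phi_add: "x \<in> carrier Q \<Longrightarrow> y \<in> carrier Q \<Longrightarrow> \<phi> (x \<oplus>\<^bsub>Q\<^esub> y) = \<phi> x + \<phi> y"
  and phi_one: "\<phi> \<one>\<^bsub>Q\<^esub> = 1\<^sub>m N"
  using ring_hom_closed[OF phi_hom] ring_hom_mult[OF phi_hom] ring_hom_add[OF phi_hom]
    ring_hom_one[OF phi_hom]
  by (auto simp: ring_mat_def)

definition \<Phi> :: "'k poly \<Rightarrow> 'l mat" where "\<Phi> f = \<phi> (quo f 1)"

lemma Phi_carrier [simp]: "\<Phi> f \<in> carrier_mat N N"
  by (simp add: \<Phi>_def phi_carrier)

lemma Phi_mult: "\<Phi> (f \<star> q) = \<Phi> f * \<Phi> q"
  by (simp add: \<Phi>_def phi_mult[symmetric] quo_mult)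

lemma Phi_add: "\<Phi> (f + q) = \<Phi> f + \<Phi> q"
  by (simp add: \<Phi>_def phi_add[symmetric] quo_add)

lemma Phi_1: "\<Phi> 1 = 1\<^sub>m N"
  by (simp add: \<Phi>_def phi_one[symmetric] one_quotients)

text \<open>On \<open>F[x]\<close> this is the embedding into \<open>'l\<close> induced by \<phi>,
  read off a scalar matrix. For other \<open>h\<close> the matrix need not be scalar, whence the
  hypotheses of \<open>iota_mult\<close>.\<close>

definition \<iota> :: "'k poly \<Rightarrow> 'l" where "\<iota> h = \<Phi> (at_g h) $$ (0,0)"

lemma Phi_at_g:
  assumes "\<Delta> h = 0"
  shows "\<Phi> (at_g h) = \<iota> h \<cdot>\<^sub>m 1\<^sub>m N"
proof -
  have "quo (at_g h) 1 \<in> E" unfolding center_field_eq using assms dens_1 by blast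
  then obtain l where "\<Phi> (at_g h) = l \<cdot>\<^sub>m 1\<^sub>m N"
    using splitting unfolding splitting_def \<Phi>_def by blast
  then show ?thesis using N_pos by (simp add: \<iota>_def)
qed

lemma iota_add: "\<iota> (h + k) = \<iota> h + \<iota> k"
  using N_pos carrier_matD[OF Phi_carrier] by (simp add: \<iota>_def pcompose_add Phi_add)

lemma iota_mult:
  assumes "\<Delta> h = 0" "\<Delta> k = 0"
  shows "\<iota> (h * k) = \<iota> h * \<iota> k"
proof -
  have "\<Phi> (at_g (h * k)) = \<Phi> (at_g h) * \<Phi> (at_g k)"
    by (simp add: pcompose_mult at_g_skew_mult flip: Phi_mult)
  also have "\<dots> = (\<iota> h \<cdot>\<^sub>m 1\<^sub>m N) * (\<iota> k \<cdot>\<^sub>m 1\<^sub>m N)" by (simp add: Phi_at_g assms)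
  also have "\<dots> = (\<iota> h * \<iota> k) \<cdot>\<^sub>m 1\<^sub>m N"
    using mult_smult_assoc_mat[of "1\<^sub>m N" N N "\<iota> k \<cdot>\<^sub>m 1\<^sub>m N" N "\<iota> h"] by (simp add: smult_smult_mat)
  finally show ?thesis using N_pos by (simp add: \<iota>_def[of "h * k"])
qed

lemma iota_1: "\<iota> 1 = 1"
  using N_pos by (simp add: \<iota>_def pcompose_1 Phi_1)

lemma iota_0: "\<iota> 0 = 0"
  by (metis add_cancel_right_right iota_add)

lemma iota_power: "\<Delta> h = 0 \<Longrightarrow> \<iota> (h ^ m) = \<iota> h ^ m"
  by (induction m) (simp_all add: iota_1 iota_mult Delta_power_eq_0)

section \<open>The Frobenius twist and the eigenvector of \<open>K\<close>\<close>

lemma CHAR_l: "CHAR('l) = p"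
proof -
  have "\<iota> (of_nat m) = of_nat m" for m
    by (induction m) (simp_all add: iota_0 iota_add iota_1)
  from this[of p] have "of_nat p = (0::'l)"
    using of_nat_CHAR[where ?'a = "'k poly"] by (simp add: CHAR_p iota_0)
  then have "CHAR('l) dvd p" by (simp add: of_nat_eq_0_iff_char_dvd)
  moreover have "CHAR('l) \<noteq> 1" by simp
  ultimately show ?thesis using prime_p by (auto simp: prime_nat_iff)
qed

text \<open>While \<iota> is multiplicative on \<open>F[x]\<close>, its composition with Frobenius
  is a ring homomorphism on all of \<open>K[x]\<close>, because \<open>h ^ p\<close> lies in
  \<open>F[x]\<close>. On \<open>F[x]\<close> it is the \<open>p\<close>-th power of \<iota>, so it
  matches the twisted matrices \<theta>.\<close>

definition \<kappa> :: "'k poly \<Rightarrow> 'l" where "\<kappa> h = \<iota> (h ^ p)"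

lemma kappa_central: "\<Delta> h = 0 \<Longrightarrow> \<kappa> h = \<iota> h ^ p"
  by (simp add: \<kappa>_def iota_power)

lemma kappa_hom: "comm_ring_hom \<kappa>"
proof
  have "p > 0" using p_gt_1 by simp
  show "\<kappa> 0 = 0" "\<kappa> 1 = 1" using \<open>p > 0\<close> by (simp_all add: \<kappa>_def iota_0 iota_1 power_0_left)
  show "\<kappa> (h + k) = \<kappa> h + \<kappa> k" for h k
    unfolding \<kappa>_def by (subst freshmans_dream) (simp_all add: CHAR_p prime_p iota_add)
  show "\<kappa> (h * k) = \<kappa> h * \<kappa> k" for h k
    by (simp add: \<kappa>_def power_mult_distrib iota_mult Delta_power_p)
qed

sublocale \<kappa>: comm_ring_hom \<kappa> by (rule kappa_hom)

lemma frobenius_hom: "comm_ring_hom (\<lambda>x::'l. x ^ p)"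
proof
  have "p > 0" using p_gt_1 by simp
  then show "(0::'l) ^ p = 0" by (simp add: power_0_left)
  show "(x + y) ^ p = x ^ p + y ^ p" for x y :: 'l
    by (rule freshmans_dream) (simp_all add: CHAR_l prime_p)
qed (simp_all add: power_mult_distrib)

sublocale frobenius: comm_ring_hom "\<lambda>x::'l. x ^ p" by (rule frobenius_hom)

definition \<theta> :: "'k poly \<Rightarrow> 'l mat" where "\<theta> f = map_mat (\<lambda>x. x ^ p) (\<Phi> f)"

lemma theta_carrier [simp]: "\<theta> f \<in> carrier_mat N N"
  by (simp add: \<theta>_def)

lemma theta_dim [simp]: "dim_row (\<theta> f) = N" "dim_col (\<theta> f) = N"
  using carrier_matD[OF theta_carrier] by auto

lemma theta_mult: "\<theta> (f \<star> q) = \<theta> f * \<theta> q"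
  by (simp add: \<theta>_def Phi_mult frobenius.mat_hom_mult[of _ N N _ N])

lemma theta_add: "\<theta> (f + q) = \<theta> f + \<theta> q"
  by (rule eq_matI) (simp_all add: \<theta>_def Phi_add frobenius.hom_add carrier_matD[OF Phi_carrier])

lemma theta_at_g: "\<Delta> h = 0 \<Longrightarrow> \<theta> (at_g h) = \<kappa> h \<cdot>\<^sub>m 1\<^sub>m N"
  using p_gt_1 by (intro eq_matI) (auto simp: \<theta>_def Phi_at_g kappa_central power_mult_distrib power_0_left)

text \<open>The row vector \<open>v\<close> times \<open>\<theta> f\<close>, written with columns
  and therefore with the transpose. It is a right action, whence the order of the factors in
  \<open>act_mult\<close>.\<close>

definition act :: "'k poly \<Rightarrow> 'l vec \<Rightarrow> 'l vec" where
  "act f v = transpose_mat (\<theta> f) *\<^sub>v v"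

lemma act_carrier [simp]: "act f v \<in> carrier_vec N"
  by (simp add: act_def carrier_vecI)

lemma act_dim [simp]: "dim_vec (act f v) = N"
  by (simp add: act_def)

lemma act_index: "v \<in> carrier_vec N \<Longrightarrow> i < N \<Longrightarrow> act f v $ i = (\<Sum>j<N. \<theta> f $$ (j,i) * v $ j)"
  by (simp add: act_def scalar_prod_def atLeast0LessThan)

lemma act_mult: "v \<in> carrier_vec N \<Longrightarrow> act (f \<star> q) v = act q (act f v)"
  unfolding act_def theta_mult
  by (subst transpose_mult[of _ N N _ N], simp, simp, subst assoc_mult_mat_vec[of _ N N _ N]) simp_all

lemma act_add: "v \<in> carrier_vec N \<Longrightarrow> act (f + q) v = act f v + act q v"
  by (rule eq_vecI) (simp_all add: act_index theta_add distrib_right sum.distrib)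

lemma act_at_g:
  assumes "v \<in> carrier_vec N" "\<Delta> h = 0"
  shows "act (at_g h) v = \<kappa> h \<cdot>\<^sub>v v"
proof (rule eq_vecI)
  fix i assume "i < dim_vec (\<kappa> h \<cdot>\<^sub>v v)"
  then have i: "i < N" using assms by simp
  have "act (at_g h) v $ i = (\<Sum>j<N. (\<kappa> h \<cdot>\<^sub>m 1\<^sub>m N) $$ (j,i) * v $ j)"
    by (simp only: act_index[OF assms(1) i] theta_at_g[OF assms(2)])
  also have "\<dots> = (\<Sum>j<N. if j = i then \<kappa> h * v $ j else 0)"
    using i by (intro sum.cong) auto
  finally show "act (at_g h) v $ i = (\<kappa> h \<cdot>\<^sub>v v) $ i" using i assms by simp
qed (use assms in simp)

lemma act_smult: "v \<in> carrier_vec N \<Longrightarrow> act f (a \<cdot>\<^sub>v v) = a \<cdot>\<^sub>v act f v"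
  by (rule eq_vecI) (simp_all add: act_index sum_distrib_left mult.left_commute)

lemma act_minus: "v \<in> carrier_vec N \<Longrightarrow> u \<in> carrier_vec N \<Longrightarrow> act f (v - u) = act f v - act f u"
  by (rule eq_vecI) (simp_all add: act_index right_diff_distrib sum_subtractf)

lemma act_sum_index:
  assumes "v \<in> carrier_vec N" "i < N"
  shows "act (sum u A) v $ i = (\<Sum>x\<in>A. act (u x) v $ i)"
proof (induction A rule: infinite_finite_induct)
  have "act 0 v $ i = 0" using act_at_g[of v 0] assms by simp
  then show "act (sum u {}) v $ i = (\<Sum>x\<in>{}. act (u x) v $ i)"
    "infinite A \<Longrightarrow> act (sum u A) v $ i = (\<Sum>x\<in>A. act (u x) v $ i)" for A by simp_all
qed (use assms in \<open>simp_all add: act_add\<close>)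

lemma act_const_funpow: "v \<in> carrier_vec N \<Longrightarrow> (act [:k:] ^^ m) v = act [:k ^ m:] v"
proof (induction m)
  case 0
  then show ?case using act_at_g[of v 1] by (simp add: pcompose_1 flip: one_pCons)
next
  case (Suc m)
  have "[:k ^ m:] \<star> [:k:] = [:k ^ Suc m:]" by (simp add: mult.commute)
  with Suc show ?case using act_mult[of v "[:k ^ m:]" "[:k:]"] by (simp add: mult.commute)
qed

text \<open>Elements of \<open>K\<close> commute, so the operator \<open>B\<close> for
  \<open>ks m\<close> maps common eigenvectors of the earlier \<open>ks i\<close> to such vectors or
  to zero, and a suitable iterate on \<open>w\<close> is an eigenvector for \<open>ks m\<close> too.
  This iterate exists because \<open>ks m ^ p\<close> lies in \<open>F\<close> and acts as the
  scalar \<open>a ^ p\<close>.\<close>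

lemma ex_common_eigenvector:
  "\<exists>w\<in>carrier_vec N. w \<noteq> 0\<^sub>v N \<and> (\<forall>i<m. act [:ks i:] w = \<kappa> [:ks i:] \<cdot>\<^sub>v w)"
proof (induction m)
  case 0
  have "unit_vec N 0 \<noteq> (0\<^sub>v N :: 'l vec)" using N_pos by (auto simp: vec_eq_iff)
  then show ?case by (intro bexI[of _ "unit_vec N 0"]) auto
next
  case (Suc m)
  then obtain w where w: "w \<in> carrier_vec N" "w \<noteq> 0\<^sub>v N"
    and eig: "\<And>i. i < m \<Longrightarrow> act [:ks i:] w = \<kappa> [:ks i:] \<cdot>\<^sub>v w" by blast
  define a where "a = \<kappa> [:ks m:]"
  define B where "B u = transpose_mat (\<theta> [:ks m:]) *\<^sub>v u - a \<cdot>\<^sub>v u" for u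
  have "(act [:ks m:] ^^ p) w = act (at_g ([:ks m:] ^ p)) w"
    by (simp add: act_const_funpow w poly_const_pow)
  also have "\<dots> = a ^ p \<cdot>\<^sub>v w"
    by (subst act_at_g) (simp_all add: w Delta_power_p a_def \<kappa>.hom_power)
  finally have "((*\<^sub>v) (transpose_mat (\<theta> [:ks m:])) ^^ p) w = a ^ p \<cdot>\<^sub>v w"
    by (simp add: act_def[abs_def])
  then obtain j where j: "(B ^^ j) w \<noteq> 0\<^sub>v N"
    "transpose_mat (\<theta> [:ks m:]) *\<^sub>v ((B ^^ j) w) = a \<cdot>\<^sub>v ((B ^^ j) w)"
    using ex_eigenvector_CHAR[OF prime_p CHAR_l _ w, of "transpose_mat (\<theta> [:ks m:])" a]
    unfolding B_def by auto
  have Bc: "(B ^^ l) w \<in> carrier_vec N" for l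
    using w by (induction l) (simp_all add: B_def flip: act_def)
  have "act [:ks i:] ((B ^^ l) w) = \<kappa> [:ks i:] \<cdot>\<^sub>v ((B ^^ l) w)" if "i < m" for i l
  proof (induction l)
    case (Suc l)
    let ?u = "(B ^^ l) w"
    have "act [:ks i:] (act [:ks m:] ?u) = act [:ks m:] (act [:ks i:] ?u)"
      by (simp add: mult.commute Bc flip: act_mult)
    then have "act [:ks i:] (B ?u) = act [:ks m:] (act [:ks i:] ?u) - a \<cdot>\<^sub>v act [:ks i:] ?u"
      using Bc[of l] by (simp add: B_def act_minus act_smult flip: act_def)
    also have "\<dots> = \<kappa> [:ks i:] \<cdot>\<^sub>v B ?u"
      using Bc[of l] unfolding Suc
      by (simp add: act_smult) (rule eq_vecI, simp_all add: B_def act_def algebra_simps)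
    finally show ?case by simp
  qed (simp add: eig that)
  moreover have "act [:ks m:] ((B ^^ j) w) = \<kappa> [:ks m:] \<cdot>\<^sub>v ((B ^^ j) w)"
    using j(2) by (simp add: act_def a_def)
  ultimately show ?case
    using j(1) Bc[of j] by (intro bexI[of _ "(B ^^ j) w"]) (auto simp: less_Suc_eq)
qed

definition w :: "'l vec" where
  "w = (SOME w. w \<in> carrier_vec N \<and> w \<noteq> 0\<^sub>v N \<and> (\<forall>i<n. act [:ks i:] w = \<kappa> [:ks i:] \<cdot>\<^sub>v w))"

lemma w: "w \<in> carrier_vec N" "w \<noteq> 0\<^sub>v N" "i < n \<Longrightarrow> act [:ks i:] w = \<kappa> [:ks i:] \<cdot>\<^sub>v w"
proof -
  have "\<exists>w. w \<in> carrier_vec N \<and> w \<noteq> 0\<^sub>v N \<and> (\<forall>i<n. act [:ks i:] w = \<kappa> [:ks i:] \<cdot>\<^sub>v w)"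
    using ex_common_eigenvector[of n] by blast
  from someI_ex[OF this] show "w \<in> carrier_vec N" "w \<noteq> 0\<^sub>v N"
    "i < n \<Longrightarrow> act [:ks i:] w = \<kappa> [:ks i:] \<cdot>\<^sub>v w"
    unfolding w_def by blast+
qed

text \<open>\<open>F[x]\<close> acts on every vector through \<kappa>, and the \<open>ks i\<close>,
  for which \<open>w\<close> is an eigenvector, span \<open>K[x]\<close> over
  \<open>F[x]\<close>.\<close>

lemma act_at_g_w: "act (at_g h) w = \<kappa> h \<cdot>\<^sub>v w"
proof (rule eq_vecI)
  fix i assume "i < dim_vec (\<kappa> h \<cdot>\<^sub>v w)"
  then have i: "i < N" using w(1) by simp
  obtain H where H: "\<And>j. \<Delta> (H j) = 0" "h = (\<Sum>j<n. Polynomial.smult (ks j) (H j))"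
    using ks_span_poly[of h] by blast
  have h: "h = (\<Sum>j<n. [:ks j:] * H j)" using H(2) by simp
  have "at_g h = (\<Sum>j<n. [:ks j:] \<star> at_g (H j))"
    by (simp add: H(2) pcompose_sum pcompose_smult)
  then have "act (at_g h) w $ i = (\<Sum>j<n. act (at_g (H j)) (act [:ks j:] w) $ i)"
    using w(1) i by (simp add: act_sum_index act_mult del: skew_mult_const)
  also have "\<dots> = (\<Sum>j<n. \<kappa> [:ks j:] * \<kappa> (H j) * w $ i)"
    using w(1) i H(1) by (intro sum.cong) (simp_all add: w(3) act_at_g mult.left_commute mult.assoc)
  also have "\<dots> = \<kappa> h * w $ i"
    by (subst h) (simp add: \<kappa>.hom_sum \<kappa>.hom_mult sum_distrib_right del: mult_pCons_left)
  finally show "act (at_g h) w $ i = (\<kappa> h \<cdot>\<^sub>v w) $ i" using i w(1) by simp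
qed (use w(1) in simp)

section \<open>The conjugating matrix\<close>

definition W :: "'l mat" where "W = mat n N (\<lambda>(j,i). act (t_pow j) w $ i)"

lemma W_carrier: "W \<in> carrier_mat n N"
  by (simp add: W_def)

text \<open>As \<open>w\<close> is an eigenvector of \<open>K[x]\<close>, the map
  \<open>f \<mapsto> act f w\<close> is semilinear along \<kappa> and determined by the rows of
  \<open>W\<close>.\<close>

lemma act_w_index:
  assumes "i < N"
  shows "act f w $ i = (\<Sum>j<n. \<kappa> (coord f j) * W $$ (j,i))"
proof -
  have "f = (\<Sum>j<n. at_g (coord f j) \<star> t_pow j)"
    by (subst coord_eq[of f]) (simp add: at_g_skew_mult)
  then have "act f w $ i = (\<Sum>j<n. act (at_g (coord f j) \<star> t_pow j) w $ i)"
    using act_sum_index[OF w(1) assms, of "\<lambda>j. at_g (coord f j) \<star> t_pow j" "{..<n}"] by simp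
  also have "\<dots> = (\<Sum>j<n. \<kappa> (coord f j) * W $$ (j,i))"
    using assms w(1) by (intro sum.cong) (simp_all add: act_mult act_at_g_w act_smult W_def)
  finally show ?thesis .
qed

text \<open>Row \<open>i\<close> of both sides is the image of \<open>w\<close> under
  \<open>t_pow i \<star> f\<close>.\<close>

lemma W_theta: "W * \<theta> f = map_mat \<kappa> (right_mat f) * W"
proof (rule eq_matI)
  fix i j assume "i < dim_row (map_mat \<kappa> (right_mat f) * W)" "j < dim_col (map_mat \<kappa> (right_mat f) * W)"
  then have ij: "i < n" "j < N" by (simp_all add: W_def)
  have "(W * \<theta> f) $$ (i,j) = act f (act (t_pow i) w) $ j"
    using ij by (simp add: act_index[of "act (t_pow i) w"] W_def scalar_prod_def atLeast0LessThan mult.commute)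
  also have "\<dots> = act (t_pow i \<star> f) w $ j" by (simp add: act_mult w(1))
  also have "\<dots> = (\<Sum>k<n. \<kappa> (right_mat f $$ (i,k)) * W $$ (k,j))"
    using ij by (simp add: act_w_index right_mat_def)
  also have "\<dots> = (map_mat \<kappa> (right_mat f) * W) $$ (i,j)"
    using ij carrier_matD[OF W_carrier] by (simp add: scalar_prod_def atLeast0LessThan)
  finally show "(W * \<theta> f) $$ (i,j) = (map_mat \<kappa> (right_mat f) * W) $$ (i,j)" .
qed (simp_all add: W_def)

lemma W_0: "i < N \<Longrightarrow> W $$ (0,i) = w $ i"
  using act_at_g[of w 1] w(1) n_pos by (simp add: W_def pcompose_1)

text \<open>The Leibniz rule applied to \<open>w\<close>. The range \<open>s < m\<close> is the same
  for all \<open>j\<close>, the binomial coefficients with \<open>s > j\<close> being zero, so that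
  a whole relation of length \<open>m\<close> can be summed.\<close>

lemma act_t_pow_const:
  assumes "i < N" "j < m" "m \<le> n"
  shows "act (t_pow j \<star> [:k:]) w $ i =
    (\<Sum>s<m. \<kappa> [:of_nat (j choose s) * (\<delta> ^^ (j - s)) k:] * W $$ (s,i))"
proof -
  have monom: "act (Polynomial.monom b s) w $ i = \<kappa> [:b:] * W $$ (s,i)" if "s < n" for b s
  proof -
    have "Polynomial.monom b s = at_g [:b:] \<star> t_pow s" by (simp add: smult_monom)
    then show ?thesis
      using w(1) assms(1) that by (simp add: act_mult act_at_g_w act_smult W_def del: pcompose_const)
  qed
  have "t_pow j \<star> [:k:] = (\<Sum>s\<le>j. Polynomial.monom (of_nat (j choose s) * (\<delta> ^^ (j - s)) k) s)"
    using D_pow_monom[of j k 0] by (simp add: monom_skew_mult monom_0)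
  then have "act (t_pow j \<star> [:k:]) w $ i =
      (\<Sum>s\<le>j. \<kappa> [:of_nat (j choose s) * (\<delta> ^^ (j - s)) k:] * W $$ (s,i))"
    using assms w(1) by (simp add: act_sum_index monom)
  also have "\<dots> = (\<Sum>s<m. \<kappa> [:of_nat (j choose s) * (\<delta> ^^ (j - s)) k:] * W $$ (s,i))"
    using assms by (intro sum.mono_neutral_left) (auto simp: binomial_eq_0)
  finally show ?thesis .
qed

text \<open>Applying \<open>k - \<kappa> k\<close> for \<open>k \<in> K\<close> to a relation between the rows \<open>w t\<^sup>j\<close>, \<open>j \<le> m\<close>, gives a shorter one,
  whose coefficient at \<open>w\<close> is the image of a Wronskian relation.\<close>

lemma W_left_kernel:
  assumes "\<And>i. i < N \<Longrightarrow> (\<Sum>j<m. l j * W $$ (j,i)) = 0" "m \<le> n" "j < m"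
  shows "l j = 0"
proof -
  have "\<forall>l. (\<forall>i<N. (\<Sum>j<m. l j * W $$ (j,i)) = 0) \<longrightarrow> (\<forall>j<m. l j = 0)"
    using assms(2)
  proof (induction m)
    case (Suc m)
    show ?case
    proof (intro allI impI)
      fix l j assume rel: "\<forall>i<N. (\<Sum>j<Suc m. l j * W $$ (j,i)) = 0" and "j < Suc m"
      \<comment> \<open>Index \<open>0\<close> is left out because subtracting
        \<open>\<kappa> [:k:]\<close> times the relation cancels the term of \<open>l 0\<close> in
        row \<open>0\<close>; zeros extend the rest to the length \<open>n\<close> of a Wronskian
        relation.\<close>
      define u where "u j = (if 0 < j \<and> j < Suc m then l j else 0)" for j
      have u: "(\<Sum>j<n. u j * \<kappa> [:(\<delta> ^^ j) k:]) = 0" for k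
      proof (cases "m = 0")
        case True
        then show ?thesis by (intro sum.neutral) (auto simp: u_def)
      next
        case False
        \<comment> \<open>\<open>E s\<close> is the coefficient of row \<open>s\<close> after
          \<open>k\<close> has acted on the relation. In row \<open>m\<close> only
          \<open>j = m\<close> contributes, with \<open>l m * \<kappa> [:k:]\<close>, which the
          subtraction in \<open>E'\<close> removes.\<close>
        define E where "E s = (\<Sum>j<Suc m. l j * \<kappa> [:of_nat (j choose s) * (\<delta> ^^ (j - s)) k:])" for s
        define E' where "E' s = E s - \<kappa> [:k:] * l s" for s
        have "(\<Sum>s<m. E' s * W $$ (s,i)) = 0" if i: "i < N" for i
        proof -
          have "(\<Sum>s<Suc m. E s * W $$ (s,i)) = (\<Sum>j<Suc m. l j * act (t_pow j \<star> [:k:]) w $ i)"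
            unfolding E_def sum_distrib_right
            by (subst sum.swap, rule sum.cong[OF refl], subst act_t_pow_const[OF i _ Suc.prems])
               (simp_all add: sum_distrib_left mult.assoc del: sum.lessThan_Suc)
          also have "\<dots> = (\<Sum>j<Suc m. \<Sum>b<N. \<theta> [:k:] $$ (b,i) * (l j * W $$ (j,b)))"
          proof (rule sum.cong[OF refl])
            fix j assume "j \<in> {..<Suc m}"
            then have "j < n" using Suc.prems by simp
            then show "l j * act (t_pow j \<star> [:k:]) w $ i = (\<Sum>b<N. \<theta> [:k:] $$ (b,i) * (l j * W $$ (j,b)))"
              using i w(1) by (simp add: act_mult act_index[of "act (t_pow j) w"] W_def sum_distrib_left mult_ac)
          qed
          also have "\<dots> = (\<Sum>b<N. \<theta> [:k:] $$ (b,i) * (\<Sum>j<Suc m. l j * W $$ (j,b)))"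
            by (subst sum.swap) (simp only: sum_distrib_left)
          also have "\<dots> = 0" using rel by (intro sum.neutral) simp
          finally have "(\<Sum>s<Suc m. E' s * W $$ (s,i)) = - \<kappa> [:k:] * (\<Sum>s<Suc m. l s * W $$ (s,i))"
            unfolding E'_def left_diff_distrib sum_subtractf sum_distrib_left by (simp add: mult.assoc sum_negf)
          also have "\<dots> = 0" using rel i by simp
          finally have "(\<Sum>s<Suc m. E' s * W $$ (s,i)) = 0" .
          moreover have "E' m = 0"
          proof -
            have "E m = (\<Sum>j\<in>{m}. l j * \<kappa> [:of_nat (j choose m) * (\<delta> ^^ (j - m)) k:])"
              unfolding E_def by (intro sum.mono_neutral_right) (auto simp: binomial_eq_0)
            then show ?thesis by (simp add: E'_def)
          qed
          ultimately show ?thesis by simp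
        qed
        with Suc.IH Suc.prems False have "E' 0 = 0" by simp
        then have "(\<Sum>j<Suc m. l j * \<kappa> [:(\<delta> ^^ j) k:]) = l 0 * \<kappa> [:k:]"
          by (simp add: E'_def E_def)
        moreover have "(\<Sum>j<Suc m. l j * \<kappa> [:(\<delta> ^^ j) k:]) = l 0 * \<kappa> [:k:] + (\<Sum>j<Suc m. u j * \<kappa> [:(\<delta> ^^ j) k:])"
          unfolding sum.lessThan_Suc_shift by (simp add: u_def)
        moreover have "(\<Sum>j<n. u j * \<kappa> [:(\<delta> ^^ j) k:]) = (\<Sum>j<Suc m. u j * \<kappa> [:(\<delta> ^^ j) k:])"
          using Suc.prems by (intro sum.mono_neutral_right) (auto simp: u_def)
        ultimately show ?thesis by simp
      qed
      have hom: "comm_ring_hom (\<lambda>k. \<kappa> [:k:])"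
        by unfold_locales (simp_all add: mult.commute flip: \<kappa>.hom_add \<kappa>.hom_mult one_pCons)
      have u0: "l j = 0" if "0 < j" "j < Suc m" for j
        using ks_independent_hom'[OF hom u, of j] that Suc.prems by (simp add: u_def)
      obtain i where i: "i < N" "w $ i \<noteq> 0" using w(1,2) by (auto simp: vec_eq_iff)
      have "(\<Sum>j<Suc m. l j * W $$ (j,i)) = l 0 * w $ i"
        unfolding sum.lessThan_Suc_shift using u0 i W_0 by simp
      then have "l 0 = 0" using rel i by simp
      then show "l j = 0" using u0[of j] \<open>j < Suc m\<close> by (cases "j = 0") auto
    qed
  qed simp
  then show ?thesis using assms by blast
qed

text \<open>The rows of \<open>W\<close> span the orbit of \<open>w\<close> under the twisted
  action, and this must be everything because the matrices \<open>\<phi> x\<close> span all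
  matrices. Concretely, \<open>v\<close> is orthogonal to \<open>w\<close> times each twisted
  \<open>\<phi> x\<close>, hence to \<open>w\<close> times each matrix unit, which leaves
  \<open>w $ a * v $ b = 0\<close>.\<close>

lemma W_right_kernel:
  assumes v: "v \<in> carrier_vec N" and Wv: "\<And>j. j < n \<Longrightarrow> (\<Sum>i<N. W $$ (j,i) * v $ i) = 0"
  shows "v = 0\<^sub>v N"
proof -
  obtain bs where bs: "quotients.independent E bs" "quotients.Span E bs = carrier Q"
    and ex: "\<forall>M\<in>carrier_mat N N. \<exists>!ls. length ls = length bs \<and>
           (\<forall>i<N. \<forall>j<N. M $$ (i, j) = (\<Sum>k<length bs. ls ! k * \<phi> (bs ! k) $$ (i, j)))"
    using splitting unfolding splitting_def by blast
  have bs_carrier: "set bs \<subseteq> carrier Q" using quotients.independent_in_carrier[OF bs(1)] .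
  have act_v: "(\<Sum>i<N. act f w $ i * v $ i) = 0" for f
  proof -
    have "(\<Sum>i<N. act f w $ i * v $ i) = (\<Sum>i<N. \<Sum>j<n. \<kappa> (coord f j) * (W $$ (j,i) * v $ i))"
      by (rule sum.cong) (simp_all add: act_w_index sum_distrib_right mult.assoc)
    also have "\<dots> = (\<Sum>j<n. \<kappa> (coord f j) * (\<Sum>i<N. W $$ (j,i) * v $ i))"
      by (subst sum.swap) (simp only: sum_distrib_left)
    also have "\<dots> = 0" using Wv by (intro sum.neutral) simp
    finally show ?thesis .
  qed
  have phi_v: "(\<Sum>i<N. (\<Sum>j<N. (\<phi> x $$ (j,i)) ^ p * w $ j) * v $ i) = 0" if x: "x \<in> carrier Q" for x
  proof -
    obtain f h where h: "h \<in> dens" and x: "x = quo f h" using x by (auto simp: carrier_quotients)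
    have "quo (at_g h) 1 \<otimes>\<^bsub>Q\<^esub> x = quo f 1"
      using h by (simp add: x quo_at_g_mult) (simp add: quo_eq_iff pcompose_1 mult.commute)
    then have "\<Phi> f = \<Phi> (at_g h) * \<phi> x"
      using phi_mult[of "quo (at_g h) 1" x] that by (simp add: \<Phi>_def)
    moreover have \<Delta>h: "\<Delta> h = 0" using h by (simp add: dens_def)
    ultimately have "\<Phi> f = \<iota> h \<cdot>\<^sub>m \<phi> x"
      using phi_carrier[OF that] mult_smult_assoc_mat[of "1\<^sub>m N" N N "\<phi> x" N "\<iota> h"] by (simp add: Phi_at_g)
    then have theta: "\<theta> f $$ (j,i) = \<iota> h ^ p * (\<phi> x $$ (j,i)) ^ p" if "i < N" "j < N" for i j
      using phi_carrier[OF \<open>x \<in> carrier Q\<close>] that by (simp add: \<theta>_def power_mult_distrib)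
    have "\<iota> h * \<phi> (quo 1 h) $$ (0,0) = 1"
    proof -
      have "\<Phi> (at_g h) * \<phi> (quo 1 h) = 1\<^sub>m N"
        using h by (simp add: \<Phi>_def phi_mult[symmetric] quo_at_g_mult quo_cancel phi_one)
      then have "\<iota> h \<cdot>\<^sub>m \<phi> (quo 1 h) = 1\<^sub>m N"
        using \<Delta>h h phi_carrier[of "quo 1 h"] mult_smult_assoc_mat[of "1\<^sub>m N" N N "\<phi> (quo 1 h)" N "\<iota> h"]
        by (simp add: Phi_at_g)
      from arg_cong[OF this, of "\<lambda>M. M $$ (0,0)"] show ?thesis
        using N_pos h phi_carrier[of "quo 1 h"] by simp
    qed
    then have "\<iota> h \<noteq> 0" by auto
    then have iota: "\<iota> h ^ p \<noteq> 0" by (rule power_not_zero)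
    have eq: "(\<Sum>i<N. act f w $ i * v $ i) = \<iota> h ^ p * (\<Sum>i<N. (\<Sum>j<N. (\<phi> x $$ (j,i)) ^ p * w $ j) * v $ i)"
      unfolding sum_distrib_left
      by (intro sum.cong) (simp_all add: act_index[OF w(1)] theta sum_distrib_left sum_distrib_right mult.assoc)
    from trans[OF eq[symmetric] act_v] iota show ?thesis unfolding mult_eq_0_iff by blast
  qed
  obtain a where a: "a < N" "w $ a \<noteq> 0" using w(1,2) by (auto simp: vec_eq_iff)
  have "v $ b = 0" if b: "b < N" for b
  proof -
    \<comment> \<open>A matrix unit. Its entries \<open>0\<close> and \<open>1\<close> are fixed by
      Frobenius, so entrywise \<open>p\<close>-th powers of its expansion in the
      \<open>\<phi> (bs ! k)\<close> express it through the twisted matrices.\<close>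
    define M :: "'l mat" where "M = mat N N (\<lambda>(i,j). if i = a \<and> j = b then 1 else 0)"
    have "M \<in> carrier_mat N N" by (simp add: M_def)
    from ex1_implies_ex[OF bspec[OF ex this]] obtain ls
      where "\<forall>i<N. \<forall>j<N. M $$ (i,j) = (\<Sum>k<length bs. ls ! k * \<phi> (bs ! k) $$ (i,j))"
      by (elim exE conjE)
    then have ls: "M $$ (i,j) = (\<Sum>k<length bs. ls ! k * \<phi> (bs ! k) $$ (i,j))" if "i < N" "j < N" for i j
      using that by simp
    have M: "M $$ (i,j) = (\<Sum>k<length bs. (ls ! k) ^ p * (\<phi> (bs ! k) $$ (i,j)) ^ p)" if "i < N" "j < N" for i j
    proof -
      have "M $$ (i,j) = (M $$ (i,j)) ^ p"
        using that p_gt_1 by (simp add: M_def power_0_left)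
      also have "\<dots> = (\<Sum>k<length bs. ls ! k * \<phi> (bs ! k) $$ (i,j)) ^ p" using ls[OF that] by simp
      also have "\<dots> = (\<Sum>k<length bs. (ls ! k) ^ p * (\<phi> (bs ! k) $$ (i,j)) ^ p)"
        by (subst frobenius.hom_sum) (simp add: power_mult_distrib)
      finally show ?thesis .
    qed
    have "w $ a * v $ b = (\<Sum>i<N. (\<Sum>j<N. M $$ (j,i) * w $ j) * v $ i)"
    proof -
      have "(\<Sum>j<N. M $$ (j,i) * w $ j) = (if i = b then w $ a else 0)" if "i < N" for i
      proof -
        have "(\<Sum>j<N. M $$ (j,i) * w $ j) = (\<Sum>j<N. if j = a then (if i = b then w $ a else 0) else 0)"
          using that by (intro sum.cong) (auto simp: M_def)
        then show ?thesis using a by simp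
      qed
      then have "(\<Sum>i<N. (\<Sum>j<N. M $$ (j,i) * w $ j) * v $ i) = (\<Sum>i<N. if i = b then w $ a * v $ b else 0)"
        by (intro sum.cong) auto
      then show ?thesis using b by simp
    qed
    also have "\<dots> = (\<Sum>i<N. \<Sum>j<N. \<Sum>k<length bs. (ls ! k) ^ p * ((\<phi> (bs ! k) $$ (j,i)) ^ p * w $ j * v $ i))"
      by (intro sum.cong refl) (simp add: M sum_distrib_right mult.assoc)
    also have "\<dots> = (\<Sum>i<N. \<Sum>k<length bs. \<Sum>j<N. (ls ! k) ^ p * ((\<phi> (bs ! k) $$ (j,i)) ^ p * w $ j * v $ i))"
      by (rule sum.cong[OF refl], rule sum.swap)
    also have "\<dots> = (\<Sum>k<length bs. \<Sum>i<N. \<Sum>j<N. (ls ! k) ^ p * ((\<phi> (bs ! k) $$ (j,i)) ^ p * w $ j * v $ i))"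
      by (rule sum.swap)
    also have "\<dots> = (\<Sum>k<length bs. (ls ! k) ^ p * (\<Sum>i<N. (\<Sum>j<N. (\<phi> (bs ! k) $$ (j,i)) ^ p * w $ j) * v $ i))"
      by (simp add: sum_distrib_left sum_distrib_right)
    also have "\<dots> = 0"
      using bs_carrier nth_mem by (intro sum.neutral) (fastforce simp: phi_v)
    finally show ?thesis using a by simp
  qed
  then show ?thesis using v by (intro eq_vecI) auto
qed

text \<open>Both kernels of \<open>W\<close> are trivial, whereas a matrix with more columns than
  rows has a nontrivial kernel.\<close>

lemma N_eq: "N = n"
proof (rule antisym)
  show "N \<le> n"
  proof (rule ccontr)
    assume "\<not> N \<le> n"
    then obtain v where v: "v \<in> carrier_vec N" "v \<noteq> 0\<^sub>v N" "W *\<^sub>v v = 0\<^sub>v n"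
      using ex_kernel_wide_mat[OF W_carrier] by auto
    have "(\<Sum>i<N. W $$ (j,i) * v $ i) = 0" if "j < n" for j
      using arg_cong[OF v(3), of "\<lambda>u. u $ j"] that v(1) carrier_matD[OF W_carrier]
      by (simp add: scalar_prod_def atLeast0LessThan)
    then show False using W_right_kernel[OF v(1)] v(2) by blast
  qed
  show "n \<le> N"
  proof (rule ccontr)
    assume "\<not> n \<le> N"
    then obtain v where v: "v \<in> carrier_vec n" "v \<noteq> 0\<^sub>v n" "transpose_mat W *\<^sub>v v = 0\<^sub>v N"
      using ex_kernel_wide_mat[of "transpose_mat W" N n] W_carrier by auto
    have "(\<Sum>j<n. v $ j * W $$ (j,i)) = 0" if "i < N" for i
      using arg_cong[OF v(3), of "\<lambda>u. u $ i"] that v(1) carrier_matD[OF W_carrier]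
      by (simp add: scalar_prod_def atLeast0LessThan mult.commute)
    then have "v $ j = 0" if "j < n" for j
      using W_left_kernel[where m = n and l = "\<lambda>j. v $ j" and j = j] that by simp
    then show False using v(1,2) by (auto simp: vec_eq_iff)
  qed
qed

lemma det_W: "det W \<noteq> 0"
proof
  assume "det W = 0"
  have W: "W \<in> carrier_mat N N" using W_carrier N_eq by simp
  with \<open>det W = 0\<close> obtain v where v: "v \<in> carrier_vec N" "v \<noteq> 0\<^sub>v N" "W *\<^sub>v v = 0\<^sub>v N"
    using det_0_iff_vec_prod_zero_field[OF W] by blast
  have "(\<Sum>i<N. W $$ (j,i) * v $ i) = 0" if "j < n" for j
    using arg_cong[OF v(3), of "\<lambda>u. u $ j"] that v(1) carrier_matD[OF W_carrier] N_eq
    by (simp add: scalar_prod_def atLeast0LessThan)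
  then show False using W_right_kernel[OF v(1)] v(2) by blast
qed

lemma det_Phi: "det (\<Phi> f) = \<iota> (poly_norm f)"
proof -
  have W: "W \<in> carrier_mat N N" and P: "map_mat \<kappa> (right_mat f) \<in> carrier_mat N N"
    using W_carrier N_eq by simp_all
  have "det W * det (\<theta> f) = det (W * \<theta> f)" using W by (simp add: det_mult[of _ N])
  also have "\<dots> = det (map_mat \<kappa> (right_mat f)) * det W"
    unfolding W_theta using W P by (simp add: det_mult[of _ N])
  finally have "det (\<theta> f) = det (map_mat \<kappa> (right_mat f))" using det_W by simp
  then have "det (\<theta> f) = \<kappa> (poly_norm f)" by (simp add: poly_norm_def)
  then have "det (\<Phi> f) ^ p = \<iota> (poly_norm f) ^ p"
    by (simp add: \<theta>_def kappa_central Delta_poly_norm)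
  \<comment> \<open>Injectivity of Frobenius: equal \<open>p\<close>-th powers make the
    \<open>p\<close>-th power of the difference zero.\<close>
  moreover have "(x - y) ^ p + y ^ p = x ^ p" for x y :: 'l
    using frobenius.hom_add[of "x - y" y] by simp
  ultimately have "(det (\<Phi> f) - \<iota> (poly_norm f)) ^ p = 0"
    by (metis add_cancel_left_left)
  then show ?thesis by simp
qed

lemma phi_poly_norm: "\<phi> (quo (at_g (poly_norm f)) 1) = det (\<phi> (quo f 1)) \<cdot>\<^sub>m 1\<^sub>m N"
  using Phi_at_g[OF Delta_poly_norm, of f] by (simp add: \<Phi>_def[symmetric] det_Phi)

end

section \<open>The reduced norm\<close>

context algebraic_derivation
begin

abbreviation central_quo :: "'k poly \<Rightarrow> ('k poly \<times> 'k poly) set" where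
  "central_quo h \<equiv> quo (at_g h) 1"

lemma central_quo_eq_iff: "central_quo h = central_quo k \<longleftrightarrow> h = k"
  using inj_at_g[of "h - k"] by (auto simp: quo_eq_iff pcompose_1 pcompose_diff)

lemma rep_center_inject:
  assumes "x \<in> E" "y \<in> E" "rep x = rep y"
  shows "x = y"
proof -
  obtain a b h where *: "h \<in> dens" "x = quo (at_g a) h" "y = quo (at_g b) h"
    using center_common_denominator[OF assms(1,2)] by metis
  have "to_fract h \<noteq> 0" using *(1) by (auto simp: dens_def)
  have "right_mat (at_g a) = right_mat (at_g b)"
  proof (rule eq_matI)
    fix i j assume "i < dim_row (right_mat (at_g b))" "j < dim_col (right_mat (at_g b))"
    then show "right_mat (at_g a) $$ (i,j) = right_mat (at_g b) $$ (i,j)"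
      using arg_cong[OF assms(3), of "\<lambda>M. M $$ (i,j)"] \<open>to_fract h \<noteq> 0\<close> * by (simp add: rep_quo)
  qed simp_all
  then show ?thesis using * right_mat_inject by metis
qed

lemma diff_norm_eq: "diff_norm \<delta> F g f = central_quo (poly_norm f)"
  unfolding diff_norm_def reduced_norm_def embed_eq
proof (rule the_equality)
  have E: "central_quo (poly_norm f) \<in> E"
    unfolding center_field_eq using Delta_poly_norm dens_1 by blast
  have phi: "\<phi> (central_quo (poly_norm f)) = det (\<phi> (quo f 1)) \<cdot>\<^sub>m 1\<^sub>m N"
    if "splitting Q E N \<phi>" for N and \<phi> :: "_ \<Rightarrow> 'k poly fract mat"
  proof (cases "N = 0")
    \<comment> \<open>All \<open>0 \<times> 0\<close> matrices coincide.\<close>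
    case True
    have "\<phi> \<in> Ring.ring_hom Q (ring_mat TYPE('k poly fract) N ())"
      using that by (simp add: splitting_def)
    from ring_hom_closed[OF this, of "central_quo (poly_norm f)"]
    have "\<phi> (central_quo (poly_norm f)) \<in> carrier_mat 0 0" using True by (simp add: ring_mat_def)
    then show ?thesis using True by (intro eq_matI) auto
  next
    case False
    then interpret splitting_of_quotients \<delta> p e F c g N \<phi>
      by unfold_locales (use that in auto)
    show ?thesis by (rule phi_poly_norm)
  qed
  show "central_quo (poly_norm f) \<in> E \<and>
    (\<forall>N (\<phi> :: _ \<Rightarrow> 'k poly fract mat). splitting Q E N \<phi> \<longrightarrow>
        \<phi> (central_quo (poly_norm f)) = det (\<phi> (quo f 1)) \<cdot>\<^sub>m 1\<^sub>m N)"
    using E phi by blast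
  fix x assume x: "x \<in> E \<and> (\<forall>N (\<phi> :: _ \<Rightarrow> 'k poly fract mat). splitting Q E N \<phi> \<longrightarrow>
        \<phi> x = det (\<phi> (quo f 1)) \<cdot>\<^sub>m 1\<^sub>m N)"
  then have "rep x = rep (central_quo (poly_norm f))"
    using phi[OF splitting_rep] splitting_rep by metis
  then show "x = central_quo (poly_norm f)" using rep_center_inject x E by blast
qed

section \<open>Irreducibility in \<open>F[x]\<close> and in \<open>R\<close>\<close>

abbreviation C :: "('k poly \<times> 'k poly) set ring" where "C \<equiv> center_poly_ring \<delta> F g"

lemma center_poly_ring_simps:
  "carrier C = central_quo ` {h. \<Delta> h = 0}"
  "central_quo h \<otimes>\<^bsub>C\<^esub> central_quo k = central_quo (h * k)"
  "\<one>\<^bsub>C\<^esub> = central_quo 1" "\<zero>\<^bsub>C\<^esub> = central_quo 0"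
  by (auto simp: center_poly_ring_def embed_eq center_polys_eq quo_mult at_g_skew_mult pcompose_mult
      one_quotients zero_quotients[of 1] pcompose_1)

lemma central_quo_unit_iff:
  assumes "\<Delta> h = 0"
  shows "central_quo h \<in> Units C \<longleftrightarrow> (\<exists>k. \<Delta> k = 0 \<and> h * k = 1)"
  using assms
  by (auto simp: Units_def center_poly_ring_simps central_quo_eq_iff mult.commute)

lemma irreducible_of_norm_irreducible:
  assumes "ring_irreducible\<^bsub>C\<^esub> (diff_norm \<delta> F g f)"
  shows "irreducible_diff_poly \<delta> f"
proof -
  let ?N = poly_norm
  have "central_quo (?N f) \<noteq> central_quo 0" and irr: "Divisibility.irreducible C (central_quo (?N f))"
    using assms unfolding ring_irreducible_def diff_norm_eq center_poly_ring_simps(4) by blast+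
  then have nonzero: "?N f \<noteq> 0" by (simp only: central_quo_eq_iff not_False_eq_True)
  have not_unit: "central_quo (?N f) \<notin> Units C"
    and factors: "\<And>b. b \<in> carrier C \<Longrightarrow> properfactor C b (central_quo (?N f)) \<Longrightarrow> b \<in> Units C"
    using irr unfolding Divisibility.irreducible_def by blast+
  have unit_degree: "Polynomial.degree q = 0" if "central_quo (?N q) \<in> Units C" for q
    using that degree_0_of_poly_norm_unit by (auto simp: central_quo_unit_iff Delta_poly_norm)
  show ?thesis
    unfolding irreducible_diff_poly_def
  proof (intro conjI notI)
    assume "f \<in> Units R"
    then obtain q where "f \<star> q = 1" by (auto simp: Units_def)
    then have "?N f * ?N q = 1" using poly_norm_mult[of f q] by (simp add: poly_norm_1)
    then have "central_quo (?N f) \<in> Units C"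
      using Delta_poly_norm central_quo_unit_iff by blast
    with not_unit show False by contradiction
  next
    assume "\<exists>q r. f = q \<otimes>\<^bsub>R\<^esub> r \<and> 1 \<le> Polynomial.degree q \<and> Polynomial.degree q < Polynomial.degree f \<and>
          1 \<le> Polynomial.degree r \<and> Polynomial.degree r < Polynomial.degree f"
    then obtain q r where f: "f = q \<star> r" and deg: "1 \<le> Polynomial.degree q" "1 \<le> Polynomial.degree r"
      by auto
    have Nf: "?N f = ?N q * ?N r" by (simp add: f poly_norm_mult)
    have q: "central_quo (?N q) \<in> carrier C" and r: "central_quo (?N r) \<in> carrier C"
      by (auto simp: center_poly_ring_simps Delta_poly_norm)
    \<comment> \<open>A nonunit divisor of the irreducible \<open>?N f\<close> cannot be proper, so
      \<open>?N f\<close> divides \<open>?N q\<close>. Cancelling \<open>?N q\<close> makes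
      \<open>?N r\<close> a unit, against the degree of \<open>r\<close>.\<close>
    have "central_quo (?N q) \<notin> Units C" using unit_degree[of q] deg by auto
    with factors[OF q] have "\<not> properfactor C (central_quo (?N q)) (central_quo (?N f))" by blast
    moreover have "central_quo (?N q) divides\<^bsub>C\<^esub> central_quo (?N f)"
      unfolding factor_def using r by (intro bexI[of _ "central_quo (?N r)"]) (simp_all add: Nf center_poly_ring_simps)
    ultimately have "central_quo (?N f) divides\<^bsub>C\<^esub> central_quo (?N q)"
      by (simp add: properfactor_def)
    then obtain k where k: "\<Delta> k = 0" "?N q = ?N f * k"
      by (auto simp: factor_def center_poly_ring_simps central_quo_eq_iff)
    then have "?N q * (?N r * k) = ?N q * 1" by (simp add: Nf mult.assoc)
    moreover have "?N q \<noteq> 0" using nonzero Nf by auto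
    ultimately have "?N r * k = 1" by (simp only: mult_cancel_left) blast
    then have "central_quo (?N r) \<in> Units C"
      using k(1) Delta_poly_norm central_quo_unit_iff by blast
    with unit_degree[of r] deg show False by auto
  qed
qed

end

theorem lemma21:
  fixes p e :: nat
    and F :: "'k::field set"
    and \<delta> :: "'k \<Rightarrow> 'k"
    and c :: "nat \<Rightarrow> 'k"
    and g f :: "'k poly"
  assumes "subfield F (ring_of_type_algebra :: 'k ring)"
    and "Factorial_Ring.prime p" and "CHAR('k) = p"
    and "purely_inseparable_of_exponent p 1 F"
    and "derivation \<delta>" and "algebraic_over F \<delta>"
    and "Const \<delta> = F"
    and "\<And>i. 1 \<le> i \<Longrightarrow> i \<le> e \<Longrightarrow> c i \<in> F"
    and "g = Polynomial.monom 1 (p ^ e) + (\<Sum>i=1..e. Polynomial.monom (c i) (p ^ (e - i)))"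
    and "minimum_polynomial F \<delta> g"
    and "diff_norm \<delta> F g f \<in> carrier (center_poly_ring \<delta> F g)"
    and "ring_irreducible\<^bsub>center_poly_ring \<delta> F g\<^esub> (diff_norm \<delta> F g f)"
  shows "irreducible_diff_poly \<delta> f"
proof -
  interpret algebraic_derivation \<delta> p e F c g
    by unfold_locales (use assms in auto)
  show ?thesis using assms(12) by (rule irreducible_of_norm_irreducible)
qed

end
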